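(* Let $J\colon\mathcal{C}\to\mathcal{D}$ be a pseudofunctor between 2-categories, let $T$ be a relative pseudomonad over $J$, and let $S\colon\mathcal{D}\to\mathcal{D}$ be a 2-monad that restricts along $J$. Assume that $T$ admits a lifting to pseudoalgebras for $S$. Then the function sending $X\in\mathcal{C}$ to $TS(X)\in\mathcal{D}$ admits the structure of a relative pseudomonad over $J\colon\mathcal{C}\to\mathcal{D}$.
   Context: "$\cdot$" is vertical composition of 2-cells, juxtaposition is composition of morphisms and whiskering; associativity and unit isomorphisms of bicategories are suppressed. Relative pseudomonad. A relative pseudomonad $T$ over $J\colon\mathcal{C}\to\mathcal{D}$ consists of: an object $TX\in\mathcal{D}$ for each $X\in\mathcal{C}$; functors $(-)^*\colon\mathcal{D}[JX,TY]\to\mathcal{D}[TX,TY]$; morphisms $i_X\colon JX\to TX$; invertible 2-cells $\mu_{g,f}\colon(g^*f)^*\to g^*f^*$, natural in $f\colon JX\to TY$, $g\colon JY\to TZ$; invertible 2-cells $\eta_f\colon f\to f^*i_X$, natural in $f$; invertible 2-cells $\theta_X\colon (i_X)^*\to 1_{TX}$; such that, for $f\colon JX\to TY$, $g\colon JY\to TZ$, $h\colon JZ\to TV$, one has $(h^*\mu_{g,f})\cdot\mu_{h,g^*f}\cdot(\mu_{h,g}f)^*=(\mu_{h,g}f^* )\cdot\mu_{h^*g,f}$ and $(f^*\theta_X)\cdot\mu_{f,i_X}\cdot(\eta_f)^*=1_{f^*}$. 2-monads and algebras. A 2-monad $S$ has multiplication $m\colon S^2\to S$ and unit $e\colon1\to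 S$ satisfying the monad axioms strictly. A pseudoalgebra is an object $A$ with $a\colon SA\to A$ and invertible 2-cells $a\,S(a)\to a\,m_A$ and $1_A\to a\,e_A$ satisfying the usual two coherence axioms; it is a strict algebra when these 2-cells are identities. A pseudomorphism $(A,a)\to(B,b)$ is a morphism $f\colon A\to B$ with an invertible 2-cell $\bar f\colon b\,S(f)\to f\,a$ satisfying the usual two coherence axioms; an algebra 2-cell $f\to g$ is a 2-cell compatible with $\bar f,\bar g$. $\mathrm{Ps}\text{-}S\text{-}\mathrm{Alg}$ is the 2-category of pseudoalgebras, pseudomorphisms and algebra 2-cells, and $S\text{-}\mathrm{Alg}$ its sub-2-category of strict algebras, with all pseudomorphisms and algebra 2-cells between them; a subscript $\mathcal{C}$ or $\mathcal{D}$ indicates the base. $S$ restricts along $J$: $S$ restricts to a 2-monad, also written $S$, on $\mathcal{C}$ with $JS=SJ$ and with multiplication and unit components $m_X\colon S^2X\to SX$, $e_X\colon X\to SX$ in $\mathcal{C}$ corresponding under $J$ to those of $S$ on $\mathcal{D}$. Consequently $J$ lifts to pseudofunctors, also written $J$, $\mathrm{Ps}\text{-}S\text{-}\mathrm{Alg}_{\mathcal{C}}\to\mathrm{Ps}\text{-}S\text{-}\mathrm{Alg}_{\mathcal{D}}$ and $S\text{-}\mathrm{Alg}_{\mathcal{C}}\to S\text{-}\mathrm{Alg}_{\mathcal{D}}$, commuting with the inclusions and forgetful 2-functors. Lifting. A lifting of $T$ to pseudoalgebras for $S$ consists of: a pseudoalgebra structure on $TA$ for every $A\in S\text{-}\mathrm{Alg}_{\mathcal{C}}$;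 a pseudomorphism structure on $f^*\colon TA\to TB$ for every pseudomorphism $f\colon JA\to TB$; a pseudomorphism structure on $i_A\colon JA\to TA$ for every $A\in S\text{-}\mathrm{Alg}_{\mathcal{C}}$; such that $\mu_{g,f}$ (for pseudomorphisms $f\colon JA\to TB$, $g\colon JB\to TC$), $\eta_f$ (for pseudomorphisms $f\colon JA\to TB$) and $\theta_A$ (for $A\in S\text{-}\mathrm{Alg}_{\mathcal{C}}$) are algebra 2-cells.
   Formalization: A lifting is additionally required to make the functor (-)^* send algebra 2-cells between pseudomorphisms JA → TB to algebra 2-cells TA → TB; the listed conditions on f^*, i, μ, η, θ do not imply this, and without it the conclusion can fail. *)

theory Defs
  imports Main
begin

section \<open>2-categories\<close>

record ('o, 'm, 'c) two_cat =
  Obj   :: "'o set"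
  Mor   :: "'m set"
  Cel   :: "'c set"
  src   :: "'m \<Rightarrow> 'o"
  trg   :: "'m \<Rightarrow> 'o"
  cdom  :: "'c \<Rightarrow> 'm"
  ccod  :: "'c \<Rightarrow> 'm"
  idm   :: "'o \<Rightarrow> 'm"
  idc   :: "'m \<Rightarrow> 'c"
  comp  :: "'m \<Rightarrow> 'm \<Rightarrow> 'm"  (infixr \<open>\<odot>\<index>\<close> 75)
  hcomp :: "'c \<Rightarrow> 'c \<Rightarrow> 'c"  (infixr \<open>\<star>\<index>\<close> 70)
  vcomp :: "'c \<Rightarrow> 'c \<Rightarrow> 'c"  (infixr \<open>\<cdot>\<index>\<close> 65)

definition Hom :: "('o, 'm, 'c) two_cat \<Rightarrow> 'o \<Rightarrow> 'o \<Rightarrow> 'm set" where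
  "Hom D A B = {f \<in> Mor D. src D f = A \<and> trg D f = B}"

definition Cells :: "('o, 'm, 'c) two_cat \<Rightarrow> 'm \<Rightarrow> 'm \<Rightarrow> 'c set" where
  "Cells D f g = {\<alpha> \<in> Cel D. cdom D \<alpha> = f \<and> ccod D \<alpha> = g}"

definition lwhisk :: "('o, 'm, 'c) two_cat \<Rightarrow> 'm \<Rightarrow> 'c \<Rightarrow> 'c"  (infixr \<open>\<rhd>\<index>\<close> 70) where
  "g \<rhd>\<^bsub>D\<^esub> \<alpha> = idc D g \<star>\<^bsub>D\<^esub> \<alpha>"

definition rwhisk :: "('o, 'm, 'c) two_cat \<Rightarrow> 'c \<Rightarrow> 'm \<Rightarrow> 'c"  (infixl \<open>\<lhd>\<index>\<close> 70) where
  "\<alpha> \<lhd>\<^bsub>D\<^esub> f = \<alpha> \<star>\<^bsub>D\<^esub> idc D f"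

definition inverse_cells :: "('o, 'm, 'c) two_cat \<Rightarrow> 'c \<Rightarrow> 'c \<Rightarrow> bool" where
  "inverse_cells D \<alpha> \<beta> \<longleftrightarrow> \<beta> \<in> Cells D (ccod D \<alpha>) (cdom D \<alpha>) \<and>
     \<beta> \<cdot>\<^bsub>D\<^esub> \<alpha> = idc D (cdom D \<alpha>) \<and> \<alpha> \<cdot>\<^bsub>D\<^esub> \<beta> = idc D (ccod D \<alpha>)"

definition IsoCells :: "('o, 'm, 'c) two_cat \<Rightarrow> 'm \<Rightarrow> 'm \<Rightarrow> 'c set" where
  "IsoCells D f g = {\<alpha> \<in> Cells D f g. \<exists>\<beta>. inverse_cells D \<alpha> \<beta>}"

definition inv_cell :: "('o, 'm, 'c) two_cat \<Rightarrow> 'c \<Rightarrow> 'c" where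
  "inv_cell D \<alpha> = (THE \<beta>. inverse_cells D \<alpha> \<beta>)"

locale two_category =
  fixes D :: "('o, 'm, 'c) two_cat" (structure)
  assumes src_Obj: "f \<in> Mor D \<Longrightarrow> src D f \<in> Obj D"
    and trg_Obj: "f \<in> Mor D \<Longrightarrow> trg D f \<in> Obj D"
    and idm_Hom: "A \<in> Obj D \<Longrightarrow> idm D A \<in> Hom D A A"
    and comp_Hom: "\<lbrakk>f \<in> Hom D A B; g \<in> Hom D B E\<rbrakk> \<Longrightarrow> g \<odot> f \<in> Hom D A E"
    and comp_idm_right: "f \<in> Hom D A B \<Longrightarrow> f \<odot> idm D A = f"
    and comp_idm_left: "f \<in> Hom D A B \<Longrightarrow> idm D B \<odot> f = f"
    and comp_assoc:
      "\<lbrakk>f \<in> Hom D A B; g \<in> Hom D B E; h \<in> Hom D E F\<rbrakk> \<Longrightarrow> (h \<odot> g) \<odot> f = h \<odot> (g \<odot> f)"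
    and cdom_Mor: "\<alpha> \<in> Cel D \<Longrightarrow> cdom D \<alpha> \<in> Mor D"
    and ccod_Mor: "\<alpha> \<in> Cel D \<Longrightarrow> ccod D \<alpha> \<in> Mor D"
    and cell_src: "\<alpha> \<in> Cel D \<Longrightarrow> src D (cdom D \<alpha>) = src D (ccod D \<alpha>)"
    and cell_trg: "\<alpha> \<in> Cel D \<Longrightarrow> trg D (cdom D \<alpha>) = trg D (ccod D \<alpha>)"
    and idc_Cells: "f \<in> Mor D \<Longrightarrow> idc D f \<in> Cells D f f"
    and vcomp_Cells: "\<lbrakk>\<alpha> \<in> Cells D f g; \<beta> \<in> Cells D g h\<rbrakk> \<Longrightarrow> \<beta> \<cdot> \<alpha> \<in> Cells D f h"
    and vcomp_idc_right: "\<alpha> \<in> Cells D f g \<Longrightarrow> \<alpha> \<cdot> idc D f = \<alpha>"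
    and vcomp_idc_left: "\<alpha> \<in> Cells D f g \<Longrightarrow> idc D g \<cdot> \<alpha> = \<alpha>"
    and vcomp_assoc:
      "\<lbrakk>\<alpha> \<in> Cells D f g; \<beta> \<in> Cells D g h; \<gamma> \<in> Cells D h k\<rbrakk>
        \<Longrightarrow> (\<gamma> \<cdot> \<beta>) \<cdot> \<alpha> = \<gamma> \<cdot> (\<beta> \<cdot> \<alpha>)"
    and hcomp_Cells:
      "\<lbrakk>f \<in> Hom D A B; g \<in> Hom D B E; \<alpha> \<in> Cells D f f'; \<beta> \<in> Cells D g g'\<rbrakk>
        \<Longrightarrow> \<beta> \<star> \<alpha> \<in> Cells D (g \<odot> f) (g' \<odot> f')"
    and hcomp_idm_right: "\<lbrakk>f \<in> Hom D A B; \<alpha> \<in> Cells D f f'\<rbrakk> \<Longrightarrow> \<alpha> \<star> idc D (idm D A) = \<alpha>"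
    and hcomp_idm_left: "\<lbrakk>f \<in> Hom D A B; \<alpha> \<in> Cells D f f'\<rbrakk> \<Longrightarrow> idc D (idm D B) \<star> \<alpha> = \<alpha>"
    and hcomp_assoc:
      "\<lbrakk>f \<in> Hom D A B; g \<in> Hom D B E; h \<in> Hom D E F;
        \<alpha> \<in> Cells D f f'; \<beta> \<in> Cells D g g'; \<gamma> \<in> Cells D h h'\<rbrakk>
        \<Longrightarrow> (\<gamma> \<star> \<beta>) \<star> \<alpha> = \<gamma> \<star> (\<beta> \<star> \<alpha>)"
    and hcomp_idc: "\<lbrakk>f \<in> Hom D A B; g \<in> Hom D B E\<rbrakk> \<Longrightarrow> idc D g \<star> idc D f = idc D (g \<odot> f)"
    and interchange:
      "\<lbrakk>f \<in> Hom D A B; g \<in> Hom D B E; \<alpha> \<in> Cells D f f'; \<alpha>' \<in> Cells D f' f'';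
        \<beta> \<in> Cells D g g'; \<beta>' \<in> Cells D g' g''\<rbrakk>
        \<Longrightarrow> (\<beta>' \<cdot> \<beta>) \<star> (\<alpha>' \<cdot> \<alpha>) = (\<beta>' \<star> \<alpha>') \<cdot> (\<beta> \<star> \<alpha>)"


section \<open>Pseudofunctors and 2-monads\<close>

record ('o, 'm, 'c, 'p, 'n, 'd) two_map =
  ob  :: "'o \<Rightarrow> 'p"
  mor :: "'m \<Rightarrow> 'n"
  cel :: "'c \<Rightarrow> 'd"

locale local_functors = C: two_category C + D: two_category D
  for C :: "('o, 'm, 'c) two_cat" and D :: "('p, 'n, 'd) two_cat" +
  fixes F :: "('o, 'm, 'c, 'p, 'n, 'd, 'z) two_map_scheme"
  assumes ob_Obj: "X \<in> Obj C \<Longrightarrow> ob F X \<in> Obj D"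
    and mor_Hom: "f \<in> Hom C X Y \<Longrightarrow> mor F f \<in> Hom D (ob F X) (ob F Y)"
    and cel_Cells: "\<alpha> \<in> Cells C f g \<Longrightarrow> cel F \<alpha> \<in> Cells D (mor F f) (mor F g)"
    and cel_idc: "f \<in> Mor C \<Longrightarrow> cel F (idc C f) = idc D (mor F f)"
    and cel_vcomp: "\<lbrakk>\<alpha> \<in> Cells C f g; \<beta> \<in> Cells C g h\<rbrakk>
      \<Longrightarrow> cel F (\<beta> \<cdot>\<^bsub>C\<^esub> \<alpha>) = cel F \<beta> \<cdot>\<^bsub>D\<^esub> cel F \<alpha>"

locale two_functor = local_functors C D F
  for C :: "('o, 'm, 'c) two_cat" and D :: "('p, 'n, 'd) two_cat"
    and F :: "('o, 'm, 'c, 'p, 'n, 'd, 'z) two_map_scheme" +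
  assumes mor_idm: "X \<in> Obj C \<Longrightarrow> mor F (idm C X) = idm D (ob F X)"
    and mor_comp: "\<lbrakk>f \<in> Hom C X Y; g \<in> Hom C Y Z\<rbrakk> \<Longrightarrow> mor F (g \<odot>\<^bsub>C\<^esub> f) = mor F g \<odot>\<^bsub>D\<^esub> mor F f"
    and cel_hcomp: "\<lbrakk>f \<in> Hom C X Y; g \<in> Hom C Y Z; \<alpha> \<in> Cells C f f'; \<beta> \<in> Cells C g g'\<rbrakk>
      \<Longrightarrow> cel F (\<beta> \<star>\<^bsub>C\<^esub> \<alpha>) = cel F \<beta> \<star>\<^bsub>D\<^esub> cel F \<alpha>"

text \<open>
  Constraints of a pseudofunctor \<open>J\<close>: \<open>phi J g f : Jg Jf \<Rightarrow> J(gf)\<close> and \<open>phi0 J X : 1 \<Rightarrow> J(1)\<close>.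
\<close>
record ('o, 'm, 'c, 'p, 'n, 'd) psfun = "('o, 'm, 'c, 'p, 'n, 'd) two_map" +
  phi  :: "'m \<Rightarrow> 'm \<Rightarrow> 'd"
  phi0 :: "'o \<Rightarrow> 'd"

locale pseudofunctor = local_functors C D J
  for C :: "('o, 'm, 'c) two_cat" and D :: "('p, 'n, 'd) two_cat"
    and J :: "('o, 'm, 'c, 'p, 'n, 'd) psfun" +
  assumes phi_Iso: "\<lbrakk>f \<in> Hom C X Y; g \<in> Hom C Y Z\<rbrakk>
      \<Longrightarrow> phi J g f \<in> IsoCells D (mor J g \<odot>\<^bsub>D\<^esub> mor J f) (mor J (g \<odot>\<^bsub>C\<^esub> f))"
    and phi0_Iso: "X \<in> Obj C \<Longrightarrow> phi0 J X \<in> IsoCells D (idm D (ob J X)) (mor J (idm C X))"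
    and phi_natural: "\<lbrakk>f \<in> Hom C X Y; g \<in> Hom C Y Z; \<alpha> \<in> Cells C f f'; \<beta> \<in> Cells C g g'\<rbrakk>
      \<Longrightarrow> phi J g' f' \<cdot>\<^bsub>D\<^esub> (cel J \<beta> \<star>\<^bsub>D\<^esub> cel J \<alpha>) = cel J (\<beta> \<star>\<^bsub>C\<^esub> \<alpha>) \<cdot>\<^bsub>D\<^esub> phi J g f"
    and phi_assoc: "\<lbrakk>f \<in> Hom C X Y; g \<in> Hom C Y Z; h \<in> Hom C Z V\<rbrakk>
      \<Longrightarrow> phi J (h \<odot>\<^bsub>C\<^esub> g) f \<cdot>\<^bsub>D\<^esub> (phi J h g \<lhd>\<^bsub>D\<^esub> mor J f)
        = phi J h (g \<odot>\<^bsub>C\<^esub> f) \<cdot>\<^bsub>D\<^esub> (mor J h \<rhd>\<^bsub>D\<^esub> phi J g f)"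
    and phi_unit_right: "f \<in> Hom C X Y
      \<Longrightarrow> phi J f (idm C X) \<cdot>\<^bsub>D\<^esub> (mor J f \<rhd>\<^bsub>D\<^esub> phi0 J X) = idc D (mor J f)"
    and phi_unit_left: "f \<in> Hom C X Y
      \<Longrightarrow> phi J (idm C Y) f \<cdot>\<^bsub>D\<^esub> (phi0 J Y \<lhd>\<^bsub>D\<^esub> mor J f) = idc D (mor J f)"

record ('o, 'm, 'c) two_mnd = "('o, 'm, 'c, 'o, 'm, 'c) two_map" +
  mult :: "'o \<Rightarrow> 'm"
  unit :: "'o \<Rightarrow> 'm"

locale two_monad = two_functor D D S
  for D :: "('o, 'm, 'c) two_cat" (structure) and S :: "('o, 'm, 'c) two_mnd" +
  assumes mult_Hom: "A \<in> Obj D \<Longrightarrow> mult S A \<in> Hom D (ob S (ob S A)) (ob S A)"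
    and unit_Hom: "A \<in> Obj D \<Longrightarrow> unit S A \<in> Hom D A (ob S A)"
    and mult_natural: "f \<in> Hom D A B \<Longrightarrow> mult S B \<odot> mor S (mor S f) = mor S f \<odot> mult S A"
    and unit_natural: "f \<in> Hom D A B \<Longrightarrow> unit S B \<odot> f = mor S f \<odot> unit S A"
    and mult_natural_cell: "\<lbrakk>f \<in> Hom D A B; \<alpha> \<in> Cells D f g\<rbrakk>
      \<Longrightarrow> mult S B \<rhd> cel S (cel S \<alpha>) = cel S \<alpha> \<lhd> mult S A"
    and unit_natural_cell: "\<lbrakk>f \<in> Hom D A B; \<alpha> \<in> Cells D f g\<rbrakk>
      \<Longrightarrow> unit S B \<rhd> \<alpha> = cel S \<alpha> \<lhd> unit S A"
    and mult_assoc: "A \<in> Obj D \<Longrightarrow> mult S A \<odot> mor S (mult S A) = mult S A \<odot> mult S (ob S A)"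
    and mult_unit: "A \<in> Obj D \<Longrightarrow> mult S A \<odot> unit S (ob S A) = idm D (ob S A)"
    and mult_unit': "A \<in> Obj D \<Longrightarrow> mult S A \<odot> mor S (unit S A) = idm D (ob S A)"


section \<open>Pseudoalgebras\<close>

text \<open>
  Algebra data \<open>a : SA \<rightarrow> A\<close>, \<open>aassoc : a S(a) \<Rightarrow> a m\<close>, \<open>aunit : 1 \<Rightarrow> a e\<close>.
\<close>
record ('o, 'm, 'c) alg =
  aob    :: 'o
  act    :: 'm
  aassoc :: 'c
  aunit  :: 'c

locale pseudoalgebra = two_monad D S
  for D :: "('o, 'm, 'c) two_cat" (structure) and S :: "('o, 'm, 'c) two_mnd" +
  fixes A :: "('o, 'm, 'c) alg"
  assumes aob_Obj: "aob A \<in> Obj D"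
    and act_Hom: "act A \<in> Hom D (ob S (aob A)) (aob A)"
    and aassoc_Iso: "aassoc A \<in> IsoCells D (act A \<odot> mor S (act A)) (act A \<odot> mult S (aob A))"
    and aunit_Iso: "aunit A \<in> IsoCells D (idm D (aob A)) (act A \<odot> unit S (aob A))"
    and alg_assoc:
      "(aassoc A \<lhd> mult S (ob S (aob A))) \<cdot> (aassoc A \<lhd> mor S (mor S (act A)))
        = (aassoc A \<lhd> mor S (mult S (aob A))) \<cdot> (act A \<rhd> cel S (aassoc A))"
    and alg_unit:
      "(aassoc A \<lhd> mor S (unit S (aob A))) \<cdot> (act A \<rhd> cel S (aunit A)) = idc D (act A)"

text \<open>
  That the 2-cells are identities entails, by their typing in \<^const>\<open>pseudoalgebra\<close>,
  the equations \<open>a S(a) = a m\<close> and \<open>a e = 1\<close>.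
\<close>
definition strict_algebra ::
    "('o, 'm, 'c) two_cat \<Rightarrow> ('o, 'm, 'c) two_mnd \<Rightarrow> ('o, 'm, 'c) alg \<Rightarrow> bool" where
  "strict_algebra D S A \<longleftrightarrow> pseudoalgebra D S A \<and>
     aassoc A = idc D (act A \<odot>\<^bsub>D\<^esub> mor S (act A)) \<and> aunit A = idc D (idm D (aob A))"

text \<open>
  \<open>fb : b S(f) \<Rightarrow> f a\<close> is the structure 2-cell. The equations only involve the data of \<open>A\<close>, \<open>B\<close>.
\<close>
definition pseudomorphism ::
    "('o, 'm, 'c) two_cat \<Rightarrow> ('o, 'm, 'c) two_mnd \<Rightarrow> ('o, 'm, 'c) alg \<Rightarrow> ('o, 'm, 'c) alg
      \<Rightarrow> 'm \<Rightarrow> 'c \<Rightarrow> bool" where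
  "pseudomorphism D S A B f fb \<longleftrightarrow>
     f \<in> Hom D (aob A) (aob B) \<and>
     fb \<in> IsoCells D (act B \<odot>\<^bsub>D\<^esub> mor S f) (f \<odot>\<^bsub>D\<^esub> act A) \<and>
     (f \<rhd>\<^bsub>D\<^esub> aassoc A) \<cdot>\<^bsub>D\<^esub> (fb \<lhd>\<^bsub>D\<^esub> mor S (act A)) \<cdot>\<^bsub>D\<^esub> (act B \<rhd>\<^bsub>D\<^esub> cel S fb)
       = (fb \<lhd>\<^bsub>D\<^esub> mult S (aob A)) \<cdot>\<^bsub>D\<^esub> (aassoc B \<lhd>\<^bsub>D\<^esub> mor S (mor S f)) \<and>
     (fb \<lhd>\<^bsub>D\<^esub> unit S (aob A)) \<cdot>\<^bsub>D\<^esub> (aunit B \<lhd>\<^bsub>D\<^esub> f) = f \<rhd>\<^bsub>D\<^esub> aunit A"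

text \<open>
  Structure 2-cells of the composite \<open>(g, gb) (f, fb)\<close> and of the identity on \<open>A\<close>.
\<close>
definition comp_str ::
    "('o, 'm, 'c) two_cat \<Rightarrow> ('o, 'm, 'c) two_mnd \<Rightarrow> 'm \<Rightarrow> 'c \<Rightarrow> 'm \<Rightarrow> 'c \<Rightarrow> 'c" where
  "comp_str D S g gb f fb = (g \<rhd>\<^bsub>D\<^esub> fb) \<cdot>\<^bsub>D\<^esub> (gb \<lhd>\<^bsub>D\<^esub> mor S f)"

definition id_str :: "('o, 'm, 'c) two_cat \<Rightarrow> ('o, 'm, 'c) alg \<Rightarrow> 'c" where
  "id_str D A = idc D (act A)"

definition algebra_cell ::
    "('o, 'm, 'c) two_cat \<Rightarrow> ('o, 'm, 'c) two_mnd \<Rightarrow> ('o, 'm, 'c) alg \<Rightarrow> ('o, 'm, 'c) alg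
      \<Rightarrow> 'm \<Rightarrow> 'c \<Rightarrow> 'm \<Rightarrow> 'c \<Rightarrow> 'c \<Rightarrow> bool" where
  "algebra_cell D S A B f fb g gb \<alpha> \<longleftrightarrow>
     \<alpha> \<in> Cells D f g \<and>
     gb \<cdot>\<^bsub>D\<^esub> (act B \<rhd>\<^bsub>D\<^esub> cel S \<alpha>) = (\<alpha> \<lhd>\<^bsub>D\<^esub> act A) \<cdot>\<^bsub>D\<^esub> fb"


section \<open>Restriction of a 2-monad along a pseudofunctor\<close>

text \<open>
  \<open>R\<close> is the restriction of \<open>S\<close> to \<open>C\<close>. The assumptions \<open>ob_restr\<close> to \<open>phi0_restr\<close> say
  that the pseudofunctors \<open>JR\<close> and \<open>SJ\<close> coincide, constraints included.
\<close>
locale restricts_along =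
    pseudofunctor C D J + Rm: two_monad C R + Sm: two_monad D S
  for C :: "('o, 'm, 'c) two_cat" and D :: "('p, 'n, 'd) two_cat"
    and J :: "('o, 'm, 'c, 'p, 'n, 'd) psfun"
    and R :: "('o, 'm, 'c) two_mnd" and S :: "('p, 'n, 'd) two_mnd" +
  assumes ob_restr: "X \<in> Obj C \<Longrightarrow> ob J (ob R X) = ob S (ob J X)"
    and mor_restr: "f \<in> Mor C \<Longrightarrow> mor J (mor R f) = mor S (mor J f)"
    and cel_restr: "\<alpha> \<in> Cel C \<Longrightarrow> cel J (cel R \<alpha>) = cel S (cel J \<alpha>)"
    and phi_restr: "\<lbrakk>f \<in> Hom C X Y; g \<in> Hom C Y Z\<rbrakk> \<Longrightarrow> phi J (mor R g) (mor R f) = cel S (phi J g f)"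
    and phi0_restr: "X \<in> Obj C \<Longrightarrow> phi0 J (ob R X) = cel S (phi0 J X)"
    and mult_restr: "X \<in> Obj C \<Longrightarrow> mor J (mult R X) = mult S (ob J X)"
    and unit_restr: "X \<in> Obj C \<Longrightarrow> mor J (unit R X) = unit S (ob J X)"

text \<open>
  The value at \<open>(A, a)\<close> of the lift of \<open>J\<close> to algebras: action \<open>Ja : SJA = JRA \<rightarrow> JA\<close> and 2-cells
  \<open>Ja S(Ja) = Ja J(Ra) \<Rightarrow> J(a R(a)) \<Rightarrow> J(a m) \<Rightarrow> Ja m\<close> and \<open>1 \<Rightarrow> J1 \<Rightarrow> J(a e) \<Rightarrow> Ja e\<close>.
\<close>
definition alg_image ::
    "('o, 'm, 'c) two_cat \<Rightarrow> ('p, 'n, 'd) two_cat \<Rightarrow> ('o, 'm, 'c, 'p, 'n, 'd) psfun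
      \<Rightarrow> ('o, 'm, 'c) two_mnd \<Rightarrow> ('o, 'm, 'c) alg \<Rightarrow> ('p, 'n, 'd) alg" where
  "alg_image C D J R A =
    \<lparr> aob = ob J (aob A),
      act = mor J (act A),
      aassoc = inv_cell D (phi J (act A) (mult R (aob A))) \<cdot>\<^bsub>D\<^esub> cel J (aassoc A)
                 \<cdot>\<^bsub>D\<^esub> phi J (act A) (mor R (act A)),
      aunit = inv_cell D (phi J (act A) (unit R (aob A))) \<cdot>\<^bsub>D\<^esub> cel J (aunit A)
                 \<cdot>\<^bsub>D\<^esub> phi0 J (aob A) \<rparr>"


section \<open>Relative pseudomonads\<close>

text \<open>
  \<open>ext T X Y\<close> and \<open>ext2 T X Y\<close> are the functor \<open>(-)\<^sup>* : D[JX, TY] \<rightarrow> D[TX, TY]\<close>. As neither \<open>J\<close> nor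
  \<open>T\<close> need be injective on objects, operations on a morphism \<open>f : JX \<rightarrow> TY\<close> take \<open>X\<close>, \<open>Y\<close> as
  explicit arguments.
\<close>
record ('o, 'p, 'n, 'd) rel_psmnd =
  Tob   :: "'o \<Rightarrow> 'p"
  ext   :: "'o \<Rightarrow> 'o \<Rightarrow> 'n \<Rightarrow> 'n"
  ext2  :: "'o \<Rightarrow> 'o \<Rightarrow> 'd \<Rightarrow> 'd"
  tunit :: "'o \<Rightarrow> 'n"
  mu    :: "'o \<Rightarrow> 'o \<Rightarrow> 'o \<Rightarrow> 'n \<Rightarrow> 'n \<Rightarrow> 'd"
  eta   :: "'o \<Rightarrow> 'o \<Rightarrow> 'n \<Rightarrow> 'd"
  theta :: "'o \<Rightarrow> 'd"

locale relative_pseudomonad = pseudofunctor C D J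
  for C :: "('o, 'm, 'c) two_cat" and D :: "('p, 'n, 'd) two_cat"
    and J :: "('o, 'm, 'c, 'p, 'n, 'd) psfun" +
  fixes T :: "('o, 'p, 'n, 'd) rel_psmnd"
  assumes Tob_Obj: "X \<in> Obj C \<Longrightarrow> Tob T X \<in> Obj D"
    and ext_Hom:
      "\<lbrakk>X \<in> Obj C; Y \<in> Obj C; f \<in> Hom D (ob J X) (Tob T Y)\<rbrakk>
        \<Longrightarrow> ext T X Y f \<in> Hom D (Tob T X) (Tob T Y)"
    and ext2_Cells:
      "\<lbrakk>X \<in> Obj C; Y \<in> Obj C; f \<in> Hom D (ob J X) (Tob T Y); \<alpha> \<in> Cells D f f'\<rbrakk>
        \<Longrightarrow> ext2 T X Y \<alpha> \<in> Cells D (ext T X Y f) (ext T X Y f')"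
    and ext2_idc:
      "\<lbrakk>X \<in> Obj C; Y \<in> Obj C; f \<in> Hom D (ob J X) (Tob T Y)\<rbrakk>
        \<Longrightarrow> ext2 T X Y (idc D f) = idc D (ext T X Y f)"
    and ext2_vcomp:
      "\<lbrakk>X \<in> Obj C; Y \<in> Obj C; f \<in> Hom D (ob J X) (Tob T Y); \<alpha> \<in> Cells D f f'; \<beta> \<in> Cells D f' f''\<rbrakk>
        \<Longrightarrow> ext2 T X Y (\<beta> \<cdot>\<^bsub>D\<^esub> \<alpha>) = ext2 T X Y \<beta> \<cdot>\<^bsub>D\<^esub> ext2 T X Y \<alpha>"
    and tunit_Hom: "X \<in> Obj C \<Longrightarrow> tunit T X \<in> Hom D (ob J X) (Tob T X)"
    and mu_Iso:
      "\<lbrakk>X \<in> Obj C; Y \<in> Obj C; Z \<in> Obj C; f \<in> Hom D (ob J X) (Tob T Y); g \<in> Hom D (ob J Y) (Tob T Z)\<rbrakk>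
        \<Longrightarrow> mu T X Y Z g f \<in> IsoCells D (ext T X Z (ext T Y Z g \<odot>\<^bsub>D\<^esub> f)) (ext T Y Z g \<odot>\<^bsub>D\<^esub> ext T X Y f)"
    and mu_natural:
      "\<lbrakk>X \<in> Obj C; Y \<in> Obj C; Z \<in> Obj C; f \<in> Hom D (ob J X) (Tob T Y); g \<in> Hom D (ob J Y) (Tob T Z);
        \<alpha> \<in> Cells D f f'; \<beta> \<in> Cells D g g'\<rbrakk>
        \<Longrightarrow> mu T X Y Z g' f' \<cdot>\<^bsub>D\<^esub> ext2 T X Z (ext2 T Y Z \<beta> \<star>\<^bsub>D\<^esub> \<alpha>)
          = (ext2 T Y Z \<beta> \<star>\<^bsub>D\<^esub> ext2 T X Y \<alpha>) \<cdot>\<^bsub>D\<^esub> mu T X Y Z g f"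
    and eta_Iso:
      "\<lbrakk>X \<in> Obj C; Y \<in> Obj C; f \<in> Hom D (ob J X) (Tob T Y)\<rbrakk>
        \<Longrightarrow> eta T X Y f \<in> IsoCells D f (ext T X Y f \<odot>\<^bsub>D\<^esub> tunit T X)"
    and eta_natural:
      "\<lbrakk>X \<in> Obj C; Y \<in> Obj C; f \<in> Hom D (ob J X) (Tob T Y); \<alpha> \<in> Cells D f f'\<rbrakk>
        \<Longrightarrow> eta T X Y f' \<cdot>\<^bsub>D\<^esub> \<alpha> = (ext2 T X Y \<alpha> \<lhd>\<^bsub>D\<^esub> tunit T X) \<cdot>\<^bsub>D\<^esub> eta T X Y f"
    and theta_Iso: "X \<in> Obj C \<Longrightarrow> theta T X \<in> IsoCells D (ext T X X (tunit T X)) (idm D (Tob T X))"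
    and mu_assoc:
      "\<lbrakk>X \<in> Obj C; Y \<in> Obj C; Z \<in> Obj C; V \<in> Obj C; f \<in> Hom D (ob J X) (Tob T Y);
        g \<in> Hom D (ob J Y) (Tob T Z); h \<in> Hom D (ob J Z) (Tob T V)\<rbrakk>
        \<Longrightarrow> (ext T Z V h \<rhd>\<^bsub>D\<^esub> mu T X Y Z g f)
              \<cdot>\<^bsub>D\<^esub> mu T X Z V h (ext T Y Z g \<odot>\<^bsub>D\<^esub> f)
              \<cdot>\<^bsub>D\<^esub> ext2 T X V (mu T Y Z V h g \<lhd>\<^bsub>D\<^esub> f)
          = (mu T Y Z V h g \<lhd>\<^bsub>D\<^esub> ext T X Y f) \<cdot>\<^bsub>D\<^esub> mu T X Y V (ext T Z V h \<odot>\<^bsub>D\<^esub> g) f"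
    and mu_unit:
      "\<lbrakk>X \<in> Obj C; Y \<in> Obj C; f \<in> Hom D (ob J X) (Tob T Y)\<rbrakk>
        \<Longrightarrow> (ext T X Y f \<rhd>\<^bsub>D\<^esub> theta T X) \<cdot>\<^bsub>D\<^esub> mu T X X Y f (tunit T X) \<cdot>\<^bsub>D\<^esub> ext2 T X Y (eta T X Y f)
          = idc D (ext T X Y f)"


section \<open>Liftings\<close>

text \<open>
  \<open>ext_str L A B f fb\<close> is the structure 2-cell of the extension of the pseudomorphism
  \<open>(f, fb) : JA \<rightarrow> TB\<close>, and \<open>tunit_str L A\<close> that of \<open>i\<^sub>A : JA \<rightarrow> TA\<close>.
\<close>
record ('o, 'm, 'c, 'p, 'n, 'd) lift_data =
  Talg      :: "('o, 'm, 'c) alg \<Rightarrow> ('p, 'n, 'd) alg"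
  ext_str   :: "('o, 'm, 'c) alg \<Rightarrow> ('o, 'm, 'c) alg \<Rightarrow> 'n \<Rightarrow> 'd \<Rightarrow> 'd"
  tunit_str :: "('o, 'm, 'c) alg \<Rightarrow> 'd"

text \<open>
  Assumption \<open>lift_ext2\<close> is the action on 2-cells of the lifted functor \<open>(-)\<^sup>*\<close> from pseudomorphisms
  \<open>JA \<rightarrow> TB\<close> to pseudomorphisms \<open>TA \<rightarrow> TB\<close>; it is left implicit when only the action on
  morphisms is listed, and it does not follow from the other assumptions.
\<close>
locale lifting = relative_pseudomonad C D J T + restricts_along C D J R S
  for C :: "('o, 'm, 'c) two_cat" and D :: "('p, 'n, 'd) two_cat"
    and J :: "('o, 'm, 'c, 'p, 'n, 'd) psfun" and T :: "('o, 'p, 'n, 'd) rel_psmnd"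
    and R :: "('o, 'm, 'c) two_mnd" and S :: "('p, 'n, 'd) two_mnd" +
  fixes L :: "('o, 'm, 'c, 'p, 'n, 'd) lift_data"
  assumes lift_ob: "strict_algebra C R A \<Longrightarrow> aob (Talg L A) = Tob T (aob A)"
    and lift_alg: "strict_algebra C R A \<Longrightarrow> pseudoalgebra D S (Talg L A)"
    and lift_ext:
      "\<lbrakk>strict_algebra C R A; strict_algebra C R B;
        pseudomorphism D S (alg_image C D J R A) (Talg L B) f fb\<rbrakk>
        \<Longrightarrow> pseudomorphism D S (Talg L A) (Talg L B) (ext T (aob A) (aob B) f) (ext_str L A B f fb)"
    and lift_ext2:
      "\<lbrakk>strict_algebra C R A; strict_algebra C R B;
        pseudomorphism D S (alg_image C D J R A) (Talg L B) f fb;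
        pseudomorphism D S (alg_image C D J R A) (Talg L B) g gb;
        algebra_cell D S (alg_image C D J R A) (Talg L B) f fb g gb \<alpha>\<rbrakk>
        \<Longrightarrow> algebra_cell D S (Talg L A) (Talg L B)
              (ext T (aob A) (aob B) f) (ext_str L A B f fb)
              (ext T (aob A) (aob B) g) (ext_str L A B g gb)
              (ext2 T (aob A) (aob B) \<alpha>)"
    and lift_tunit:
      "strict_algebra C R A
        \<Longrightarrow> pseudomorphism D S (alg_image C D J R A) (Talg L A) (tunit T (aob A)) (tunit_str L A)"
    and lift_mu:
      "\<lbrakk>strict_algebra C R A; strict_algebra C R B; strict_algebra C R E;
        pseudomorphism D S (alg_image C D J R A) (Talg L B) f fb;
        pseudomorphism D S (alg_image C D J R B) (Talg L E) g gb\<rbrakk>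
        \<Longrightarrow> algebra_cell D S (Talg L A) (Talg L E)
              (ext T (aob A) (aob E) (ext T (aob B) (aob E) g \<odot>\<^bsub>D\<^esub> f))
              (ext_str L A E (ext T (aob B) (aob E) g \<odot>\<^bsub>D\<^esub> f)
                 (comp_str D S (ext T (aob B) (aob E) g) (ext_str L B E g gb) f fb))
              (ext T (aob B) (aob E) g \<odot>\<^bsub>D\<^esub> ext T (aob A) (aob B) f)
              (comp_str D S (ext T (aob B) (aob E) g) (ext_str L B E g gb)
                 (ext T (aob A) (aob B) f) (ext_str L A B f fb))
              (mu T (aob A) (aob B) (aob E) g f)"
    and lift_eta:
      "\<lbrakk>strict_algebra C R A; strict_algebra C R B;
        pseudomorphism D S (alg_image C D J R A) (Talg L B) f fb\<rbrakk>
        \<Longrightarrow> algebra_cell D S (alg_image C D J R A) (Talg L B)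
              f fb
              (ext T (aob A) (aob B) f \<odot>\<^bsub>D\<^esub> tunit T (aob A))
              (comp_str D S (ext T (aob A) (aob B) f) (ext_str L A B f fb)
                 (tunit T (aob A)) (tunit_str L A))
              (eta T (aob A) (aob B) f)"
    and lift_theta:
      "strict_algebra C R A
        \<Longrightarrow> algebra_cell D S (Talg L A) (Talg L A)
              (ext T (aob A) (aob A) (tunit T (aob A)))
              (ext_str L A A (tunit T (aob A)) (tunit_str L A))
              (idm D (Tob T (aob A))) (id_str D (Talg L A))
              (theta T (aob A))"

end

theory Submission
  imports Defs
begin

text \<open>
  Write \<open>a\<close> for the action on \<open>TSY\<close>, the lifting of \<open>T\<close> at the free algebra on \<open>Y\<close>. A morphism
  \<open>f : JX \<rightarrow> TSY\<close> extends to the pseudomorphism \<open>f\<^sup>S = a S(f) : SJX \<rightarrow> TSY\<close> and then to \<open>(f\<^sup>S)\<^sup>*\<close>,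
  which is the extension operation of the composite. The structure 2-cell of the
  pseudomorphism \<open>(g\<^sup>S)\<^sup>*\<close>, whiskered with \<open>S(f)\<close>, compares \<open>((g\<^sup>S)\<^sup>* f)\<^sup>S\<close> with \<open>(g\<^sup>S)\<^sup>* f\<^sup>S\<close>; its extension
  followed by \<open>\<mu>\<close> is the new \<open>\<mu>\<close>. The coherence axioms reduce to those of \<open>T\<close>, because \<open>\<mu>\<close>, \<open>\<eta>\<close> and the
  comparison 2-cells are algebra 2-cells.

  The algebra \<open>JSX\<close> agrees with the free algebra on \<open>JX\<close> only up to the constraints of \<open>J\<close>, and
  its pseudoalgebra axioms are not evident. They are only used after whiskering with a morphism into
  some \<open>TSY\<close>; as every \<open>k : JSX \<rightarrow> TSY\<close> is isomorphic to \<open>k\<^sup>* i\<close>, whiskering with \<open>i\<close> suffices, and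
  there the pseudomorphism axioms for \<open>i\<close> apply.
\<close>

section \<open>Calculus of 2-cells\<close>

context two_category
begin

text \<open>The axioms speak of \<open>Hom\<close> and \<open>Cells\<close>, whose parameters need
  not occur in the conclusion. Restated through \<open>src\<close>, \<open>trg\<close>,
  \<open>cdom\<close> and \<open>ccod\<close>, they become conditional equations by which the typing
  of any composite is computed by rewriting.\<close>

lemma comp_typ:
  assumes "f \<in> Mor D" "g \<in> Mor D" "trg D f = src D g"
  shows "g \<odot> f \<in> Mor D" "src D (g \<odot> f) = src D f" "trg D (g \<odot> f) = trg D g"
  using comp_Hom[of f "src D f" "trg D f" g "trg D g"] assms by (auto simp: Hom_def)

lemma idm_typ:
  assumes "A \<in> Obj D"
  shows "idm D A \<in> Mor D" "src D (idm D A) = A" "trg D (idm D A) = A"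
  using idm_Hom[OF assms] by (auto simp: Hom_def)

lemma idm_comp: "\<lbrakk>f \<in> Mor D; trg D f = A\<rbrakk> \<Longrightarrow> idm D A \<odot> f = f"
  using comp_idm_left[of f "src D f" A] by (auto simp: Hom_def)

lemma comp_idm: "\<lbrakk>f \<in> Mor D; src D f = A\<rbrakk> \<Longrightarrow> f \<odot> idm D A = f"
  using comp_idm_right[of f A] by (auto simp: Hom_def)

lemma comp_assoc_Mor:
  "\<lbrakk>f \<in> Mor D; g \<in> Mor D; h \<in> Mor D; trg D f = src D g; trg D g = src D h\<rbrakk>
    \<Longrightarrow> (h \<odot> g) \<odot> f = h \<odot> (g \<odot> f)"
  using comp_assoc[of f "src D f" "trg D f" g "trg D g" h "trg D h"] by (auto simp: Hom_def)

lemma cell_typ: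
  assumes "\<alpha> \<in> Cel D"
  shows "cdom D \<alpha> \<in> Mor D" "ccod D \<alpha> \<in> Mor D"
    "src D (ccod D \<alpha>) = src D (cdom D \<alpha>)" "trg D (ccod D \<alpha>) = trg D (cdom D \<alpha>)"
  using assms cdom_Mor ccod_Mor cell_src cell_trg by auto

lemma idc_typ:
  assumes "f \<in> Mor D"
  shows "idc D f \<in> Cel D" "cdom D (idc D f) = f" "ccod D (idc D f) = f"
  using idc_Cells[OF assms] by (auto simp: Cells_def)

lemma vcomp_typ:
  assumes "\<alpha> \<in> Cel D" "\<beta> \<in> Cel D" "ccod D \<alpha> = cdom D \<beta>"
  shows "\<beta> \<cdot> \<alpha> \<in> Cel D" "cdom D (\<beta> \<cdot> \<alpha>) = cdom D \<alpha>" "ccod D (\<beta> \<cdot> \<alpha>) = ccod D \<beta>"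
  using vcomp_Cells[of \<alpha> "cdom D \<alpha>" "ccod D \<alpha>" \<beta> "ccod D \<beta>"] assms by (auto simp: Cells_def)

lemma idc_vcomp: "\<lbrakk>\<alpha> \<in> Cel D; ccod D \<alpha> = f\<rbrakk> \<Longrightarrow> idc D f \<cdot> \<alpha> = \<alpha>"
  using vcomp_idc_left[of \<alpha> "cdom D \<alpha>" f] by (auto simp: Cells_def)

lemma vcomp_idc: "\<lbrakk>\<alpha> \<in> Cel D; cdom D \<alpha> = f\<rbrakk> \<Longrightarrow> \<alpha> \<cdot> idc D f = \<alpha>"
  using vcomp_idc_right[of \<alpha> f "ccod D \<alpha>"] by (auto simp: Cells_def)

lemma vcomp_assoc_Cel:
  "\<lbrakk>\<alpha> \<in> Cel D; \<beta> \<in> Cel D; \<gamma> \<in> Cel D; ccod D \<alpha> = cdom D \<beta>; ccod D \<beta> = cdom D \<gamma>\<rbrakk>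
    \<Longrightarrow> (\<gamma> \<cdot> \<beta>) \<cdot> \<alpha> = \<gamma> \<cdot> (\<beta> \<cdot> \<alpha>)"
  using vcomp_assoc[of \<alpha> "cdom D \<alpha>" "ccod D \<alpha>" \<beta> "ccod D \<beta>" \<gamma> "ccod D \<gamma>"]
  by (auto simp: Cells_def)

lemma hcomp_typ:
  assumes "\<alpha> \<in> Cel D" "\<beta> \<in> Cel D" "trg D (cdom D \<alpha>) = src D (cdom D \<beta>)"
  shows "\<beta> \<star> \<alpha> \<in> Cel D" "cdom D (\<beta> \<star> \<alpha>) = cdom D \<beta> \<odot> cdom D \<alpha>"
    "ccod D (\<beta> \<star> \<alpha>) = ccod D \<beta> \<odot> ccod D \<alpha>"
  using hcomp_Cells[of "cdom D \<alpha>" "src D (cdom D \<alpha>)" "trg D (cdom D \<alpha>)" "cdom D \<beta>"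
      "trg D (cdom D \<beta>)" \<alpha> "ccod D \<alpha>" \<beta> "ccod D \<beta>"] assms
  by (auto simp: Cells_def Hom_def cell_typ)

lemma hcomp_assoc_Cel:
  "\<lbrakk>\<alpha> \<in> Cel D; \<beta> \<in> Cel D; \<gamma> \<in> Cel D; trg D (cdom D \<alpha>) = src D (cdom D \<beta>);
    trg D (cdom D \<beta>) = src D (cdom D \<gamma>)\<rbrakk>
    \<Longrightarrow> (\<gamma> \<star> \<beta>) \<star> \<alpha> = \<gamma> \<star> (\<beta> \<star> \<alpha>)"
  by (rule hcomp_assoc[of "cdom D \<alpha>" "src D (cdom D \<alpha>)" "trg D (cdom D \<alpha>)" "cdom D \<beta>"
      "trg D (cdom D \<beta>)" "cdom D \<gamma>" "trg D (cdom D \<gamma>)" _ "ccod D \<alpha>" _ "ccod D \<beta>" _ "ccod D \<gamma>"])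
    (auto simp: Cells_def Hom_def cell_typ)

lemma hcomp_idcs: "\<lbrakk>f \<in> Mor D; g \<in> Mor D; trg D f = src D g\<rbrakk>
    \<Longrightarrow> idc D g \<star> idc D f = idc D (g \<odot> f)"
  using hcomp_idc[of f "src D f" "trg D f" g "trg D g"] by (auto simp: Hom_def)

lemma interchange_Cel:
  "\<lbrakk>\<alpha> \<in> Cel D; \<beta> \<in> Cel D; \<alpha>' \<in> Cel D; \<beta>' \<in> Cel D; trg D (cdom D \<alpha>) = src D (cdom D \<beta>);
    ccod D \<alpha> = cdom D \<alpha>'; ccod D \<beta> = cdom D \<beta>'\<rbrakk>
    \<Longrightarrow> (\<beta>' \<star> \<alpha>') \<cdot> (\<beta> \<star> \<alpha>) = (\<beta>' \<cdot> \<beta>) \<star> (\<alpha>' \<cdot> \<alpha>)"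
  by (rule interchange[symmetric, of "cdom D \<alpha>" "src D (cdom D \<alpha>)" "trg D (cdom D \<alpha>)" "cdom D \<beta>"
      "trg D (cdom D \<beta>)" \<alpha> "ccod D \<alpha>" \<alpha>' "ccod D \<alpha>'" \<beta> "ccod D \<beta>" \<beta>' "ccod D \<beta>'"])
    (auto simp: Cells_def Hom_def cell_typ)

lemma idm_hcomp: "\<lbrakk>\<alpha> \<in> Cel D; trg D (cdom D \<alpha>) = B\<rbrakk> \<Longrightarrow> idc D (idm D B) \<star> \<alpha> = \<alpha>"
  using hcomp_idm_left[of "cdom D \<alpha>" "src D (cdom D \<alpha>)" B \<alpha> "ccod D \<alpha>"]
  by (auto simp: Cells_def Hom_def cell_typ)

lemma hcomp_idm: "\<lbrakk>\<alpha> \<in> Cel D; src D (cdom D \<alpha>) = A\<rbrakk> \<Longrightarrow> \<alpha> \<star> idc D (idm D A) = \<alpha>"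
  using hcomp_idm_right[of "cdom D \<alpha>" A "trg D (cdom D \<alpha>)" \<alpha> "ccod D \<alpha>"]
  by (auto simp: Cells_def Hom_def cell_typ)

lemmas category_simps = comp_typ idm_typ idm_comp comp_idm cell_typ idc_typ vcomp_typ idc_vcomp vcomp_idc
  src_Obj trg_Obj comp_assoc_Mor vcomp_assoc_Cel

lemma lwhisk_typ:
  assumes "\<alpha> \<in> Cel D" "h \<in> Mor D" "trg D (cdom D \<alpha>) = src D h"
  shows "h \<rhd> \<alpha> \<in> Cel D" "cdom D (h \<rhd> \<alpha>) = h \<odot> cdom D \<alpha>" "ccod D (h \<rhd> \<alpha>) = h \<odot> ccod D \<alpha>"
  using hcomp_typ[of \<alpha> "idc D h"] assms by (auto simp: lwhisk_def idc_typ)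

lemma rwhisk_typ:
  assumes "\<alpha> \<in> Cel D" "f \<in> Mor D" "trg D f = src D (cdom D \<alpha>)"
  shows "\<alpha> \<lhd> f \<in> Cel D" "cdom D (\<alpha> \<lhd> f) = cdom D \<alpha> \<odot> f" "ccod D (\<alpha> \<lhd> f) = ccod D \<alpha> \<odot> f"
  using hcomp_typ[of "idc D f" \<alpha>] assms by (auto simp: rwhisk_def idc_typ)

lemma lwhisk_comp:
  "\<lbrakk>\<alpha> \<in> Cel D; g \<in> Mor D; h \<in> Mor D; trg D (cdom D \<alpha>) = src D g; trg D g = src D h\<rbrakk>
    \<Longrightarrow> h \<rhd> (g \<rhd> \<alpha>) = (h \<odot> g) \<rhd> \<alpha>"
  by (simp add: lwhisk_def hcomp_assoc_Cel[symmetric] hcomp_idcs idc_typ)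

lemma rwhisk_comp:
  "\<lbrakk>\<alpha> \<in> Cel D; f \<in> Mor D; g \<in> Mor D; trg D g = src D (cdom D \<alpha>); trg D f = src D g\<rbrakk>
    \<Longrightarrow> (\<alpha> \<lhd> g) \<lhd> f = \<alpha> \<lhd> (g \<odot> f)"
  by (simp add: rwhisk_def hcomp_assoc_Cel hcomp_idcs idc_typ)

lemma whisk_swap:
  "\<lbrakk>\<alpha> \<in> Cel D; f \<in> Mor D; h \<in> Mor D; trg D f = src D (cdom D \<alpha>); trg D (cdom D \<alpha>) = src D h\<rbrakk>
    \<Longrightarrow> (h \<rhd> \<alpha>) \<lhd> f = h \<rhd> (\<alpha> \<lhd> f)"
  by (simp add: rwhisk_def lwhisk_def hcomp_assoc_Cel idc_typ)

lemma lwhisk_idc: "\<lbrakk>f \<in> Mor D; g \<in> Mor D; trg D f = src D g\<rbrakk> \<Longrightarrow> g \<rhd> idc D f = idc D (g \<odot> f)"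
  by (simp add: lwhisk_def hcomp_idcs)

lemma rwhisk_idc: "\<lbrakk>f \<in> Mor D; g \<in> Mor D; trg D f = src D g\<rbrakk> \<Longrightarrow> idc D g \<lhd> f = idc D (g \<odot> f)"
  by (simp add: rwhisk_def hcomp_idcs)

lemma lwhisk_idm: "\<lbrakk>\<alpha> \<in> Cel D; trg D (cdom D \<alpha>) = B\<rbrakk> \<Longrightarrow> idm D B \<rhd> \<alpha> = \<alpha>"
  by (simp add: lwhisk_def idm_hcomp)

lemma rwhisk_idm: "\<lbrakk>\<alpha> \<in> Cel D; src D (cdom D \<alpha>) = A\<rbrakk> \<Longrightarrow> \<alpha> \<lhd> idm D A = \<alpha>"
  by (simp add: rwhisk_def hcomp_idm)

lemma lwhisk_vcomp:
  "\<lbrakk>\<alpha> \<in> Cel D; \<beta> \<in> Cel D; h \<in> Mor D; ccod D \<alpha> = cdom D \<beta>; trg D (cdom D \<alpha>) = src D h\<rbrakk>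
    \<Longrightarrow> h \<rhd> (\<beta> \<cdot> \<alpha>) = (h \<rhd> \<beta>) \<cdot> (h \<rhd> \<alpha>)"
  by (simp add: lwhisk_def interchange_Cel idc_typ idc_vcomp)

lemma rwhisk_vcomp:
  "\<lbrakk>\<alpha> \<in> Cel D; \<beta> \<in> Cel D; f \<in> Mor D; ccod D \<alpha> = cdom D \<beta>; trg D f = src D (cdom D \<alpha>)\<rbrakk>
    \<Longrightarrow> (\<beta> \<cdot> \<alpha>) \<lhd> f = (\<beta> \<lhd> f) \<cdot> (\<alpha> \<lhd> f)"
  by (simp add: rwhisk_def interchange_Cel idc_typ idc_vcomp)

lemma hcomp_whisk:
  "\<lbrakk>\<alpha> \<in> Cel D; \<beta> \<in> Cel D; trg D (cdom D \<alpha>) = src D (cdom D \<beta>)\<rbrakk>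
    \<Longrightarrow> \<beta> \<star> \<alpha> = (\<beta> \<lhd> ccod D \<alpha>) \<cdot> (cdom D \<beta> \<rhd> \<alpha>)"
  by (simp add: rwhisk_def lwhisk_def interchange_Cel idc_typ idc_vcomp vcomp_idc cell_typ)

text \<open>Both sides are equal to \<open>\<beta> \<star> \<alpha>\<close>. Neither side is simpler
  than the other, so this law stays outside the rewrite system and is invoked by hand, mostly in the
  facts named \<open>ex\<close>.\<close>

lemma whisk_exchange:
  "\<lbrakk>\<alpha> \<in> Cel D; \<beta> \<in> Cel D; trg D (cdom D \<alpha>) = src D (cdom D \<beta>)\<rbrakk>
    \<Longrightarrow> (ccod D \<beta> \<rhd> \<alpha>) \<cdot> (\<beta> \<lhd> cdom D \<alpha>) = (\<beta> \<lhd> ccod D \<alpha>) \<cdot> (cdom D \<beta> \<rhd> \<alpha>)"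
  by (simp add: rwhisk_def lwhisk_def interchange_Cel idc_typ idc_vcomp vcomp_idc cell_typ)

text \<open>As rewrite rules these bring a pasting into the form of a vertical composite of cells
  \<open>h \<rhd> (\<alpha> \<lhd> f)\<close>, each whiskered once on either side. Two pastings that
  differ by no interchange then agree syntactically.\<close>

lemmas whisker_simps = lwhisk_typ rwhisk_typ lwhisk_comp rwhisk_comp whisk_swap lwhisk_idc rwhisk_idc
  lwhisk_idm rwhisk_idm lwhisk_vcomp rwhisk_vcomp

section \<open>Invertible 2-cells and cancellation\<close>

definition iso :: "'c \<Rightarrow> bool" where
  "iso \<alpha> \<longleftrightarrow> \<alpha> \<in> Cel D \<and> (\<exists>\<beta>. inverse_cells D \<alpha> \<beta>)"

lemma IsoCells_iff: "\<alpha> \<in> IsoCells D f g \<longleftrightarrow> iso \<alpha> \<and> cdom D \<alpha> = f \<and> ccod D \<alpha> = g"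
  by (auto simp: IsoCells_def Cells_def iso_def)

lemma isoI:
  "\<lbrakk>\<alpha> \<in> Cel D; \<beta> \<in> Cel D; cdom D \<beta> = ccod D \<alpha>; ccod D \<beta> = cdom D \<alpha>;
    \<beta> \<cdot> \<alpha> = idc D (cdom D \<alpha>); \<alpha> \<cdot> \<beta> = idc D (ccod D \<alpha>)\<rbrakk> \<Longrightarrow> iso \<alpha>"
  by (auto simp: iso_def inverse_cells_def Cells_def)

lemma isoE:
  assumes "iso \<alpha>"
  obtains \<beta> where "\<alpha> \<in> Cel D" "\<beta> \<in> Cel D" "cdom D \<beta> = ccod D \<alpha>" "ccod D \<beta> = cdom D \<alpha>"
    "\<beta> \<cdot> \<alpha> = idc D (cdom D \<alpha>)" "\<alpha> \<cdot> \<beta> = idc D (ccod D \<alpha>)"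
  using assms by (auto simp: iso_def inverse_cells_def Cells_def)

lemma iso_Cel: "iso \<alpha> \<Longrightarrow> \<alpha> \<in> Cel D"
  by (simp add: iso_def)

lemma iso_idc: "f \<in> Mor D \<Longrightarrow> iso (idc D f)"
  by (rule isoI[where \<beta> = "idc D f"]) (auto simp: idc_typ idc_vcomp)

lemma iso_vcomp:
  assumes "iso \<alpha>" "iso \<beta>" "ccod D \<alpha> = cdom D \<beta>"
  shows "iso (\<beta> \<cdot> \<alpha>)"
proof -
  obtain \<alpha>' where a: "\<alpha> \<in> Cel D" "\<alpha>' \<in> Cel D" "cdom D \<alpha>' = ccod D \<alpha>" "ccod D \<alpha>' = cdom D \<alpha>"
    "\<alpha>' \<cdot> \<alpha> = idc D (cdom D \<alpha>)" "\<alpha> \<cdot> \<alpha>' = idc D (ccod D \<alpha>)"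
    using assms(1) by (rule isoE)
  obtain \<beta>' where b: "\<beta> \<in> Cel D" "\<beta>' \<in> Cel D" "cdom D \<beta>' = ccod D \<beta>" "ccod D \<beta>' = cdom D \<beta>"
    "\<beta>' \<cdot> \<beta> = idc D (cdom D \<beta>)" "\<beta> \<cdot> \<beta>' = idc D (ccod D \<beta>)"
    using assms(2) by (rule isoE)
  have 1: "\<beta>' \<cdot> (\<beta> \<cdot> \<alpha>) = \<alpha>"
    using a(1) b assms(3) by (simp add: category_simps flip: vcomp_assoc_Cel)
  have 2: "\<alpha> \<cdot> (\<alpha>' \<cdot> \<beta>') = \<beta>'"
    using a b assms(3) by (simp add: category_simps flip: vcomp_assoc_Cel)
  show ?thesis
    by (rule isoI[where \<beta> = "\<alpha>' \<cdot> \<beta>'"]) (use a b assms(3) 1 2 in \<open>simp_all add: category_simps\<close>)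
qed

lemma iso_lwhisk:
  assumes "iso \<alpha>" "h \<in> Mor D" "trg D (cdom D \<alpha>) = src D h"
  shows "iso (h \<rhd> \<alpha>)"
  using assms(1)
proof (rule isoE)
  fix \<beta> assume b: "\<alpha> \<in> Cel D" "\<beta> \<in> Cel D" "cdom D \<beta> = ccod D \<alpha>" "ccod D \<beta> = cdom D \<alpha>"
    "\<beta> \<cdot> \<alpha> = idc D (cdom D \<alpha>)" "\<alpha> \<cdot> \<beta> = idc D (ccod D \<alpha>)"
  show ?thesis
    by (rule isoI[where \<beta> = "h \<rhd> \<beta>"])
      (use b assms in \<open>simp_all add: category_simps lwhisk_typ lwhisk_idc flip: lwhisk_vcomp\<close>)
qed

lemma iso_rwhisk:
  assumes "iso \<alpha>" "f \<in> Mor D" "trg D f = src D (cdom D \<alpha>)"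
  shows "iso (\<alpha> \<lhd> f)"
  using assms(1)
proof (rule isoE)
  fix \<beta> assume b: "\<alpha> \<in> Cel D" "\<beta> \<in> Cel D" "cdom D \<beta> = ccod D \<alpha>" "ccod D \<beta> = cdom D \<alpha>"
    "\<beta> \<cdot> \<alpha> = idc D (cdom D \<alpha>)" "\<alpha> \<cdot> \<beta> = idc D (ccod D \<alpha>)"
  show ?thesis
    by (rule isoI[where \<beta> = "\<beta> \<lhd> f"])
      (use b assms in \<open>simp_all add: category_simps rwhisk_typ rwhisk_idc flip: rwhisk_vcomp\<close>)
qed

lemma iso_cancel_left:
  assumes "iso \<alpha>" "\<beta> \<in> Cel D" "\<gamma> \<in> Cel D" "ccod D \<beta> = cdom D \<alpha>" "ccod D \<gamma> = cdom D \<alpha>"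
    and eq: "\<alpha> \<cdot> \<beta> = \<alpha> \<cdot> \<gamma>"
  shows "\<beta> = \<gamma>"
  using assms(1)
proof (rule isoE)
  fix \<alpha>' assume a: "\<alpha> \<in> Cel D" "\<alpha>' \<in> Cel D" "cdom D \<alpha>' = ccod D \<alpha>" "ccod D \<alpha>' = cdom D \<alpha>"
    "\<alpha>' \<cdot> \<alpha> = idc D (cdom D \<alpha>)" "\<alpha> \<cdot> \<alpha>' = idc D (ccod D \<alpha>)"
  have "\<beta> = (\<alpha>' \<cdot> \<alpha>) \<cdot> \<beta>"
    using a assms by (simp add: category_simps del: vcomp_assoc_Cel)
  also have "\<dots> = (\<alpha>' \<cdot> \<alpha>) \<cdot> \<gamma>"
    using a(1-4) assms by (simp add: category_simps)
  also have "\<dots> = \<gamma>"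
    using a assms by (simp add: category_simps del: vcomp_assoc_Cel)
  finally show ?thesis .
qed

lemma iso_cancel_right:
  assumes "iso \<alpha>" "\<beta> \<in> Cel D" "\<gamma> \<in> Cel D" "cdom D \<beta> = ccod D \<alpha>" "cdom D \<gamma> = ccod D \<alpha>"
    and eq: "\<beta> \<cdot> \<alpha> = \<gamma> \<cdot> \<alpha>"
  shows "\<beta> = \<gamma>"
  using assms(1)
proof (rule isoE)
  fix \<alpha>' assume a: "\<alpha> \<in> Cel D" "\<alpha>' \<in> Cel D" "cdom D \<alpha>' = ccod D \<alpha>" "ccod D \<alpha>' = cdom D \<alpha>"
    "\<alpha>' \<cdot> \<alpha> = idc D (cdom D \<alpha>)" "\<alpha> \<cdot> \<alpha>' = idc D (ccod D \<alpha>)"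
  have "\<beta> = (\<beta> \<cdot> \<alpha>) \<cdot> \<alpha>'"
    using a assms(2-5) by (simp add: category_simps)
  also have "\<dots> = (\<gamma> \<cdot> \<alpha>) \<cdot> \<alpha>'"
    by (simp add: eq)
  also have "\<dots> = \<gamma>"
    using a assms(2-5) by (simp add: category_simps)
  finally show ?thesis .
qed

text \<open>Inverses are unique by cancellation, so the definite description in
  \<open>inv_cell\<close> denotes.\<close>

lemma inv_cell_inverse:
  assumes "iso \<alpha>"
  shows "inv_cell D \<alpha> \<in> Cel D" "cdom D (inv_cell D \<alpha>) = ccod D \<alpha>"
    "ccod D (inv_cell D \<alpha>) = cdom D \<alpha>"
    "inv_cell D \<alpha> \<cdot> \<alpha> = idc D (cdom D \<alpha>)" "\<alpha> \<cdot> inv_cell D \<alpha> = idc D (ccod D \<alpha>)"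
    "iso (inv_cell D \<alpha>)"
proof -
  obtain \<beta> where b: "inverse_cells D \<alpha> \<beta>"
    using assms by (auto simp: iso_def)
  have "inv_cell D \<alpha> = \<beta>"
    unfolding inv_cell_def
  proof (rule the_equality)
    show "inverse_cells D \<alpha> \<beta>" by (rule b)
  next
    fix \<gamma> assume "inverse_cells D \<alpha> \<gamma>"
    then show "\<gamma> = \<beta>"
      using b assms iso_cancel_left[OF assms, of \<gamma> \<beta>] by (auto simp: inverse_cells_def Cells_def)
  qed
  then show 1: "inv_cell D \<alpha> \<in> Cel D" "cdom D (inv_cell D \<alpha>) = ccod D \<alpha>"
    "ccod D (inv_cell D \<alpha>) = cdom D \<alpha>"
    "inv_cell D \<alpha> \<cdot> \<alpha> = idc D (cdom D \<alpha>)" "\<alpha> \<cdot> inv_cell D \<alpha> = idc D (ccod D \<alpha>)"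
    using b by (auto simp: inverse_cells_def Cells_def)
  show "iso (inv_cell D \<alpha>)"
    by (rule isoI[where \<beta> = \<alpha>]) (use 1 iso_Cel[OF assms] in auto)
qed

lemmas iso_intros = iso_Cel iso_idc iso_vcomp iso_lwhisk iso_rwhisk

end

section \<open>Functors on typed, whiskered and invertible 2-cells\<close>

context local_functors
begin

lemma mor_typ:
  assumes "f \<in> Mor C"
  shows "mor F f \<in> Mor D" "src D (mor F f) = ob F (src C f)" "trg D (mor F f) = ob F (trg C f)"
  using mor_Hom[of f "src C f" "trg C f"] assms by (auto simp: Hom_def)

lemma cel_typ:
  assumes "\<alpha> \<in> Cel C"
  shows "cel F \<alpha> \<in> Cel D" "cdom D (cel F \<alpha>) = mor F (cdom C \<alpha>)"
    "ccod D (cel F \<alpha>) = mor F (ccod C \<alpha>)"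
  using cel_Cells[of \<alpha> "cdom C \<alpha>" "ccod C \<alpha>"] assms by (auto simp: Cells_def)

lemma cel_vcomp_Cel: "\<lbrakk>\<alpha> \<in> Cel C; \<beta> \<in> Cel C; ccod C \<alpha> = cdom C \<beta>\<rbrakk>
    \<Longrightarrow> cel F (\<beta> \<cdot>\<^bsub>C\<^esub> \<alpha>) = cel F \<beta> \<cdot>\<^bsub>D\<^esub> cel F \<alpha>"
  using cel_vcomp[of \<alpha> "cdom C \<alpha>" "ccod C \<alpha>" \<beta> "ccod C \<beta>"] by (auto simp: Cells_def)

lemma iso_cel:
  assumes "C.iso \<alpha>"
  shows "D.iso (cel F \<alpha>)"
  using assms
proof (rule C.isoE)
  fix \<beta> assume b: "\<alpha> \<in> Cel C" "\<beta> \<in> Cel C" "cdom C \<beta> = ccod C \<alpha>" "ccod C \<beta> = cdom C \<alpha>"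
    "\<beta> \<cdot>\<^bsub>C\<^esub> \<alpha> = idc C (cdom C \<alpha>)" "\<alpha> \<cdot>\<^bsub>C\<^esub> \<beta> = idc C (ccod C \<alpha>)"
  show ?thesis
    by (rule D.isoI[where \<beta> = "cel F \<beta>"])
      (use b assms in \<open>simp_all add: cel_typ cel_idc C.cell_typ flip: cel_vcomp_Cel\<close>)
qed

lemmas functor_simps = mor_typ cel_typ cel_vcomp_Cel cel_idc ob_Obj

end

context two_functor
begin

lemma mor_comp_Mor: "\<lbrakk>f \<in> Mor C; g \<in> Mor C; trg C f = src C g\<rbrakk>
    \<Longrightarrow> mor F (g \<odot>\<^bsub>C\<^esub> f) = mor F g \<odot>\<^bsub>D\<^esub> mor F f"
  using mor_comp[of f "src C f" "trg C f" g "trg C g"] by (auto simp: Hom_def)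

lemma cel_lwhisk:
  assumes "\<alpha> \<in> Cel C" "h \<in> Mor C" "trg C (cdom C \<alpha>) = src C h"
  shows "cel F (h \<rhd>\<^bsub>C\<^esub> \<alpha>) = mor F h \<rhd>\<^bsub>D\<^esub> cel F \<alpha>"
  using cel_hcomp[of "cdom C \<alpha>" "src C (cdom C \<alpha>)" "trg C (cdom C \<alpha>)" h "trg C h" \<alpha> "ccod C \<alpha>"
      "idc C h" h] assms
  by (auto simp: Hom_def Cells_def lwhisk_def cel_idc C.category_simps)

lemma cel_rwhisk:
  assumes "\<alpha> \<in> Cel C" "f \<in> Mor C" "trg C f = src C (cdom C \<alpha>)"
  shows "cel F (\<alpha> \<lhd>\<^bsub>C\<^esub> f) = cel F \<alpha> \<lhd>\<^bsub>D\<^esub> mor F f"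
  using cel_hcomp[of f "src C f" "trg C f" "cdom C \<alpha>" "trg C (cdom C \<alpha>)" "idc C f" f \<alpha> "ccod C \<alpha>"]
    assms
  by (auto simp: Hom_def Cells_def rwhisk_def cel_idc C.category_simps)

lemmas two_functor_simps = functor_simps mor_idm mor_comp_Mor cel_lwhisk cel_rwhisk

end

section \<open>2-monads and pseudoalgebras\<close>

context two_monad
begin

lemma mult_typ:
  assumes "A \<in> Obj D"
  shows "mult S A \<in> Mor D" "src D (mult S A) = ob S (ob S A)" "trg D (mult S A) = ob S A"
  using mult_Hom[OF assms] by (auto simp: Hom_def)

lemma unit_typ:
  assumes "A \<in> Obj D"
  shows "unit S A \<in> Mor D" "src D (unit S A) = A" "trg D (unit S A) = ob S A"
  using unit_Hom[OF assms] by (auto simp: Hom_def)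

lemmas monad_typing = C.category_simps two_functor_simps mult_typ unit_typ

text \<open>Composites are nested to the right, which hides \<open>q \<odot> p\<close> inside
  \<open>q \<odot> (p \<odot> x)\<close>. Every monad law therefore gets a second version with a
  tail \<open>x\<close>.\<close>

lemma comp_extend:
  assumes "q \<odot> p = r" "p \<in> Mor D" "q \<in> Mor D" "x \<in> Mor D" "trg D p = src D q" "trg D x = src D p"
  shows "q \<odot> (p \<odot> x) = r \<odot> x"
  using C.comp_assoc_Mor[of x p q] assms by simp

text \<open>The second equation is the image of the first under \<open>S\<close>. It is stated
  separately because \<open>mor S\<close> is distributed over composites, after which the first no
  longer matches. The same applies to the multiplication below.\<close>

lemma unit_nat:
  assumes "f \<in> Mor D" "src D f = A"
  shows "mor S f \<odot> unit S A = unit S (trg D f) \<odot> f"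
    and "mor S (mor S f) \<odot> mor S (unit S A) = mor S (unit S (trg D f)) \<odot> mor S f"
proof -
  show 1: "mor S f \<odot> unit S A = unit S (trg D f) \<odot> f"
    using unit_natural[of f A "trg D f"] assms by (simp add: Hom_def)
  show "mor S (mor S f) \<odot> mor S (unit S A) = mor S (unit S (trg D f)) \<odot> mor S f"
    using arg_cong[OF 1, of "mor S"] assms by (auto simp: monad_typing)
qed

lemma mult_nat:
  assumes "f \<in> Mor D" "trg D f = B"
  shows "mult S B \<odot> mor S (mor S f) = mor S f \<odot> mult S (src D f)"
    and "mor S (mult S B) \<odot> mor S (mor S (mor S f)) = mor S (mor S f) \<odot> mor S (mult S (src D f))"
proof -
  show 1: "mult S B \<odot> mor S (mor S f) = mor S f \<odot> mult S (src D f)"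
    using mult_natural[of f "src D f" B] assms by (simp add: Hom_def)
  show "mor S (mult S B) \<odot> mor S (mor S (mor S f)) = mor S (mor S f) \<odot> mor S (mult S (src D f))"
    using arg_cong[OF 1, of "mor S"] assms by (auto simp: monad_typing)
qed

lemma mult_units:
  assumes "A \<in> Obj D"
  shows "mult S A \<odot> unit S (ob S A) = idm D (ob S A)"
    and "mor S (mult S A) \<odot> mor S (unit S (ob S A)) = idm D (ob S (ob S A))"
    and "mult S A \<odot> mor S (unit S A) = idm D (ob S A)"
    and "mor S (mult S A) \<odot> mor S (mor S (unit S A)) = idm D (ob S (ob S A))"
proof -
  show 1: "mult S A \<odot> unit S (ob S A) = idm D (ob S A)"
    and 2: "mult S A \<odot> mor S (unit S A) = idm D (ob S A)"
    using assms mult_unit mult_unit' by auto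
  show "mor S (mult S A) \<odot> mor S (unit S (ob S A)) = idm D (ob S (ob S A))"
    using arg_cong[OF 1, of "mor S"] assms by (auto simp: monad_typing)
  show "mor S (mult S A) \<odot> mor S (mor S (unit S A)) = idm D (ob S (ob S A))"
    using arg_cong[OF 2, of "mor S"] assms by (auto simp: monad_typing)
qed

lemma unit_nat_extend:
  assumes "f \<in> Mor D" "src D f = A" "x \<in> Mor D"
  shows "trg D x = A \<Longrightarrow> mor S f \<odot> (unit S A \<odot> x) = unit S (trg D f) \<odot> (f \<odot> x)"
    and "trg D x = ob S A \<Longrightarrow> mor S (mor S f) \<odot> (mor S (unit S A) \<odot> x)
      = mor S (unit S (trg D f)) \<odot> (mor S f \<odot> x)"
proof -
  assume "trg D x = A"
  then show "mor S f \<odot> (unit S A \<odot> x) = unit S (trg D f) \<odot> (f \<odot> x)"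
    using assms by (subst comp_extend[OF unit_nat(1)]) (auto simp: monad_typing)
next
  assume "trg D x = ob S A"
  then show "mor S (mor S f) \<odot> (mor S (unit S A) \<odot> x) = mor S (unit S (trg D f)) \<odot> (mor S f \<odot> x)"
    using assms by (subst comp_extend[OF unit_nat(2)]) (auto simp: monad_typing)
qed

lemma mult_nat_extend:
  assumes "f \<in> Mor D" "trg D f = B" "x \<in> Mor D"
  shows "trg D x = ob S (ob S (src D f)) \<Longrightarrow>
      mult S B \<odot> (mor S (mor S f) \<odot> x) = mor S f \<odot> (mult S (src D f) \<odot> x)"
    and "trg D x = ob S (ob S (ob S (src D f))) \<Longrightarrow>
      mor S (mult S B) \<odot> (mor S (mor S (mor S f)) \<odot> x)
        = mor S (mor S f) \<odot> (mor S (mult S (src D f)) \<odot> x)"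
proof -
  assume "trg D x = ob S (ob S (src D f))"
  then show "mult S B \<odot> (mor S (mor S f) \<odot> x) = mor S f \<odot> (mult S (src D f) \<odot> x)"
    using assms by (subst comp_extend[OF mult_nat(1)]) (auto simp: monad_typing)
next
  assume "trg D x = ob S (ob S (ob S (src D f)))"
  then show "mor S (mult S B) \<odot> (mor S (mor S (mor S f)) \<odot> x)
      = mor S (mor S f) \<odot> (mor S (mult S (src D f)) \<odot> x)"
    using assms by (subst comp_extend[OF mult_nat(2)]) (auto simp: monad_typing)
qed

lemma mult_units_extend:
  assumes "A \<in> Obj D" "x \<in> Mor D"
  shows "trg D x = ob S A \<Longrightarrow> mult S A \<odot> (unit S (ob S A) \<odot> x) = x"
    and "trg D x = ob S (ob S A) \<Longrightarrow> mor S (mult S A) \<odot> (mor S (unit S (ob S A)) \<odot> x) = x"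
    and "trg D x = ob S A \<Longrightarrow> mult S A \<odot> (mor S (unit S A) \<odot> x) = x"
    and "trg D x = ob S (ob S A) \<Longrightarrow> mor S (mult S A) \<odot> (mor S (mor S (unit S A)) \<odot> x) = x"
  using assms
  by (simp_all add: monad_typing mult_units comp_extend[OF mult_units(1)] comp_extend[OF mult_units(2)]
      comp_extend[OF mult_units(3)] comp_extend[OF mult_units(4)])

lemma mult_mult_extend:
  assumes "A \<in> Obj D" "x \<in> Mor D" "trg D x = ob S (ob S (ob S A))"
  shows "mult S A \<odot> (mor S (mult S A) \<odot> x) = mult S A \<odot> (mult S (ob S A) \<odot> x)"
  using assms by (subst comp_extend[OF mult_assoc]) (simp_all add: monad_typing)

text \<open>The orientation is uniform: components of the unit move left past S(f), components of
  the multiplication move right, and m S(m) becomes the composite of m with the multiplication at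
  SA.\<close>

lemmas monad_laws = unit_nat mult_nat mult_units mult_assoc unit_nat_extend mult_nat_extend
  mult_units_extend mult_mult_extend

lemmas monad_simps = monad_typing C.whisker_simps monad_laws

lemma unit_cell: "\<lbrakk>\<alpha> \<in> Cel D; trg D (cdom D \<alpha>) = B\<rbrakk>
    \<Longrightarrow> unit S B \<rhd> \<alpha> = cel S \<alpha> \<lhd> unit S (src D (cdom D \<alpha>))"
  using unit_natural_cell[of "cdom D \<alpha>" "src D (cdom D \<alpha>)" B \<alpha> "ccod D \<alpha>"]
  by (simp add: Hom_def Cells_def monad_typing)

lemma mult_cell: "\<lbrakk>\<alpha> \<in> Cel D; trg D (cdom D \<alpha>) = B\<rbrakk>
    \<Longrightarrow> mult S B \<rhd> cel S (cel S \<alpha>) = cel S \<alpha> \<lhd> mult S (src D (cdom D \<alpha>))"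
  using mult_natural_cell[of "cdom D \<alpha>" "src D (cdom D \<alpha>)" B \<alpha> "ccod D \<alpha>"]
  by (simp add: Hom_def Cells_def monad_typing)

end

context pseudoalgebra
begin

lemma alg_typ:
  "aob A \<in> Obj D" "act A \<in> Mor D" "src D (act A) = ob S (aob A)" "trg D (act A) = aob A"
  "aassoc A \<in> Cel D" "cdom D (aassoc A) = act A \<odot> mor S (act A)"
  "ccod D (aassoc A) = act A \<odot> mult S (aob A)" "C.iso (aassoc A)"
  "aunit A \<in> Cel D" "cdom D (aunit A) = idm D (aob A)"
  "ccod D (aunit A) = act A \<odot> unit S (aob A)" "C.iso (aunit A)"
  using act_Hom aassoc_Iso aunit_Iso aob_Obj
  by (auto simp: Hom_def C.IsoCells_iff C.iso_Cel)

text \<open>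
  Kelly's redundancy argument: for the composite \<open>l\<close> on the left, associativity restricted along
  \<open>S(e\<^sub>S)\<close> gives \<open>a S(l) = 1\<close>, and naturality of \<open>1 \<Rightarrow> a e\<close> turns this into \<open>l = 1\<close>.
\<close>
lemma alg_unit_left:
  "(aassoc A \<lhd> unit S (ob S (aob A))) \<cdot> (aunit A \<lhd> act A) = idc D (act A)"
proof -
  let ?b = "act A" and ?\<beta> = "aassoc A" and ?\<nu> = "aunit A"
  let ?e = "unit S (aob A)" and ?eS = "unit S (ob S (aob A))"
  let ?m = "mult S (aob A)" and ?mS = "mult S (ob S (aob A))"
  define l where "l = (?\<beta> \<lhd> ?eS) \<cdot> (?\<nu> \<lhd> ?b)"
  have l: "l \<in> Cel D" "cdom D l = ?b" "ccod D l = ?b"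
    by (simp_all add: l_def monad_simps alg_typ)
  have "((?\<beta> \<lhd> ?mS) \<cdot> (?\<beta> \<lhd> mor S (mor S ?b))) \<lhd> mor S ?eS
      = ((?\<beta> \<lhd> mor S ?m) \<cdot> (?b \<rhd> cel S ?\<beta>)) \<lhd> mor S ?eS"
    by (simp only: alg_assoc)
  then have "?\<beta> \<cdot> (?\<beta> \<lhd> (mor S ?e \<odot> mor S ?b)) = ?\<beta> \<cdot> (?b \<rhd> (cel S ?\<beta> \<lhd> mor S ?eS))"
    by (simp add: monad_simps alg_typ)
  then have 1: "?\<beta> \<lhd> (mor S ?e \<odot> mor S ?b) = ?b \<rhd> (cel S ?\<beta> \<lhd> mor S ?eS)"
    by (rule C.iso_cancel_left[rotated 5]) (simp_all add: monad_simps alg_typ)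
  have "?b \<rhd> cel S l = (?b \<rhd> (cel S ?\<beta> \<lhd> mor S ?eS)) \<cdot> (?b \<rhd> (cel S ?\<nu> \<lhd> mor S ?b))"
    by (simp add: l_def monad_simps alg_typ)
  also have "\<dots> = ((?\<beta> \<lhd> mor S ?e) \<cdot> (?b \<rhd> cel S ?\<nu>)) \<lhd> mor S ?b"
    unfolding 1[symmetric] by (simp add: monad_simps alg_typ)
  also have "\<dots> = idc D (?b \<odot> mor S ?b)"
    unfolding alg_unit by (simp add: monad_simps alg_typ)
  finally have 2: "?b \<rhd> cel S l = idc D (?b \<odot> mor S ?b)" .
  have "(?b \<odot> ?e) \<rhd> l = ?b \<rhd> (?e \<rhd> l)"
    by (simp add: monad_simps alg_typ l)
  also have "\<dots> = (?b \<rhd> cel S l) \<lhd> ?eS"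
    by (simp add: unit_cell monad_simps alg_typ l)
  also have "\<dots> = idc D (?b \<odot> ?e \<odot> ?b)"
    unfolding 2 by (simp add: monad_simps alg_typ l)
  finally have 3: "(?b \<odot> ?e) \<rhd> l = idc D (?b \<odot> ?e \<odot> ?b)" .
  have "(?\<nu> \<lhd> ?b) \<cdot> l = ((?b \<odot> ?e) \<rhd> l) \<cdot> (?\<nu> \<lhd> ?b)"
    using C.whisk_exchange[of l ?\<nu>] by (simp add: monad_simps alg_typ l)
  also have "\<dots> = (?\<nu> \<lhd> ?b) \<cdot> idc D ?b"
    unfolding 3 by (simp add: monad_simps alg_typ)
  finally have "l = idc D ?b"
    by (rule C.iso_cancel_left[rotated 5]) (simp_all add: monad_simps alg_typ l C.iso_intros)
  then show ?thesis
    by (simp add: l_def)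
qed

end

section \<open>Pseudomorphisms out of free algebras\<close>

definition free_ext ::
    "('o, 'm, 'c) two_cat \<Rightarrow> ('o, 'm, 'c) two_mnd \<Rightarrow> ('o, 'm, 'c) alg \<Rightarrow> 'm \<Rightarrow> 'm" where
  "free_ext D S B f = act B \<odot>\<^bsub>D\<^esub> mor S f"

definition free_ext2 ::
    "('o, 'm, 'c) two_cat \<Rightarrow> ('o, 'm, 'c) two_mnd \<Rightarrow> ('o, 'm, 'c) alg \<Rightarrow> 'c \<Rightarrow> 'c" where
  "free_ext2 D S B \<alpha> = act B \<rhd>\<^bsub>D\<^esub> cel S \<alpha>"

text \<open>
  The structure 2-cell of \<open>b S(f) : A \<rightarrow> B\<close>, where \<open>A\<close> is \<open>SX\<close> with action \<open>m\<close>, but possibly non-identity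
  2-cells, and \<open>c : m \<Rightarrow> m\<close> is a pseudomorphism structure on the identity from \<open>A\<close> to the free algebra.
\<close>
definition free_str ::
    "('o, 'm, 'c) two_cat \<Rightarrow> ('o, 'm, 'c) two_mnd \<Rightarrow> ('o, 'm, 'c) alg \<Rightarrow> 'c \<Rightarrow> 'm \<Rightarrow> 'c" where
  "free_str D S B c f =
    (free_ext D S B f \<rhd>\<^bsub>D\<^esub> c) \<cdot>\<^bsub>D\<^esub> (aassoc B \<lhd>\<^bsub>D\<^esub> mor S (mor S f))"

definition free_alg ::
    "('o, 'm, 'c) two_cat \<Rightarrow> ('o, 'm, 'c) two_mnd \<Rightarrow> 'o \<Rightarrow> ('o, 'm, 'c) alg" where
  "free_alg D S X = \<lparr> aob = ob S X, act = mult S X,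
     aassoc = idc D (mult S X \<odot>\<^bsub>D\<^esub> mor S (mult S X)), aunit = idc D (idm D (ob S X)) \<rparr>"

context two_monad
begin

lemma pseudomorphism_iff:
  "pseudomorphism D S A B f fb \<longleftrightarrow>
    f \<in> Mor D \<and> src D f = aob A \<and> trg D f = aob B \<and>
    C.iso fb \<and> cdom D fb = act B \<odot> mor S f \<and> ccod D fb = f \<odot> act A \<and>
    (f \<rhd> aassoc A) \<cdot> (fb \<lhd> mor S (act A)) \<cdot> (act B \<rhd> cel S fb)
      = (fb \<lhd> mult S (aob A)) \<cdot> (aassoc B \<lhd> mor S (mor S f)) \<and>
    (fb \<lhd> unit S (aob A)) \<cdot> (aunit B \<lhd> f) = f \<rhd> aunit A"
  by (auto simp: pseudomorphism_def Hom_def C.IsoCells_iff)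

lemma algebra_cell_iff:
  "algebra_cell D S A B f fb g gb \<alpha> \<longleftrightarrow>
    \<alpha> \<in> Cel D \<and> cdom D \<alpha> = f \<and> ccod D \<alpha> = g \<and>
    gb \<cdot> (act B \<rhd> cel S \<alpha>) = (\<alpha> \<lhd> act A) \<cdot> fb"
  by (auto simp: algebra_cell_def Cells_def)

lemma free_ext_typ:
  assumes "pseudoalgebra D S B" "f \<in> Mor D" "trg D f = aob B"
  shows "free_ext D S B f \<in> Mor D" "src D (free_ext D S B f) = ob S (src D f)"
    "trg D (free_ext D S B f) = aob B"
proof -
  interpret B: pseudoalgebra D S B by fact
  show "free_ext D S B f \<in> Mor D" "src D (free_ext D S B f) = ob S (src D f)"
    "trg D (free_ext D S B f) = aob B"
    using assms(2,3) by (simp_all add: free_ext_def monad_simps B.alg_typ)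
qed

text \<open>This is \<open>alg_assoc\<close> whiskered with SSS(f) and brought to normal form, where
  naturality has moved the multiplications from \<open>aob B\<close> to \<open>X\<close>.\<close>

lemma free_assoc:
  assumes "pseudoalgebra D S B" "f \<in> Mor D" "src D f = X" "trg D f = aob B"
  shows "(aassoc B \<lhd> (mor S (mor S f) \<odot> mor S (mult S X))) \<cdot>
      (act B \<rhd> (cel S (aassoc B) \<lhd> mor S (mor S (mor S f))))
    = (aassoc B \<lhd> (mor S (mor S f) \<odot> mult S (ob S X))) \<cdot>
      (aassoc B \<lhd> (mor S (mor S (act B)) \<odot> mor S (mor S (mor S f))))"
proof -
  interpret B: pseudoalgebra D S B by fact
  show ?thesis
    using arg_cong[OF B.alg_assoc, of "\<lambda>x. x \<lhd> mor S (mor S (mor S f))"] assms(2-4)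
    by (auto simp: monad_simps B.alg_typ)
qed

lemma free_unit:
  assumes "pseudoalgebra D S B" "f \<in> Mor D" "src D f = X" "trg D f = aob B"
  shows "(aassoc B \<lhd> (unit S (ob S (aob B)) \<odot> mor S f)) \<cdot> (aunit B \<lhd> (act B \<odot> mor S f))
    = idc D (act B \<odot> mor S f)"
proof -
  interpret B: pseudoalgebra D S B by fact
  show ?thesis
    using arg_cong[OF B.alg_unit_left, of "\<lambda>x. x \<lhd> mor S f"] assms(2-4)
    by (auto simp: monad_simps B.alg_typ)
qed

text \<open>Interchange separates the copies of \<open>c\<close> from those of the associator of
  \<open>B\<close>, so the axioms split into those of \<open>B\<close> and two equations saying that
  \<open>c\<close> is a structure on the identity. The latter are assumed only after whiskering with
  \<open>free_ext D S B f\<close>, the form in which they can be obtained for \<open>J\<close> of a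
  free algebra.\<close>

lemma free_pseudomorphism:
  assumes B: "pseudoalgebra D S B"
    and f: "f \<in> Mor D" "src D f = X" "trg D f = aob B"
    and A: "aob A = ob S X" "act A = mult S X"
      "aassoc A \<in> Cel D" "cdom D (aassoc A) = mult S X \<odot> mult S (ob S X)"
      "ccod D (aassoc A) = mult S X \<odot> mult S (ob S X)"
      "aunit A \<in> Cel D" "cdom D (aunit A) = idm D (ob S X)" "ccod D (aunit A) = idm D (ob S X)"
    and c: "C.iso c" "cdom D c = mult S X" "ccod D c = mult S X"
    and c_assoc: "free_ext D S B f \<rhd> (aassoc A \<cdot> (c \<lhd> mor S (mult S X)) \<cdot> (mult S X \<rhd> cel S c))
        = free_ext D S B f \<rhd> (c \<lhd> mult S (ob S X))"
    and c_unit: "free_ext D S B f \<rhd> (c \<lhd> unit S (ob S X)) = free_ext D S B f \<rhd> aunit A"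
  shows "pseudomorphism D S A B (free_ext D S B f) (free_str D S B c f)"
proof -
  interpret B: pseudoalgebra D S B by fact
  note [simp] = f A c(2,3) C.iso_Cel[OF c(1)] B.alg_typ
  have [simp]: "X \<in> Obj D"
    using f C.src_Obj by blast
  let ?b = "act B" and ?\<beta> = "aassoc B" and ?k = "free_ext D S B f"
  let ?m = "mult S X" and ?mS = "mult S (ob S X)"
  note fe [simp] = free_ext_typ[OF B f(1,3), unfolded f(2)]
  \<comment> \<open>The copy S(c) is applied before the associator of \<open>B\<close>. Interchange
    moves it after, next to the other copy of \<open>c\<close>, where \<open>c_assoc\<close>
    applies.\<close>
  have ex: "(?\<beta> \<lhd> (mor S (mor S f) \<odot> mor S ?m)) \<cdot> ((?b \<odot> mor S ?b \<odot> mor S (mor S f)) \<rhd> cel S c)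
      = ((?b \<odot> mor S f \<odot> ?m) \<rhd> cel S c) \<cdot> (?\<beta> \<lhd> (mor S (mor S f) \<odot> mor S ?m))"
    using C.whisk_exchange[of "cel S c" "?\<beta> \<lhd> mor S (mor S f)"] by (simp add: monad_simps)
  have "(?k \<rhd> aassoc A) \<cdot> (free_str D S B c f \<lhd> mor S ?m) \<cdot> (?b \<rhd> cel S (free_str D S B c f))
    = (?k \<rhd> aassoc A) \<cdot> (?k \<rhd> (c \<lhd> mor S ?m)) \<cdot>
        ((?\<beta> \<lhd> (mor S (mor S f) \<odot> mor S ?m)) \<cdot> ((?b \<odot> mor S ?b \<odot> mor S (mor S f)) \<rhd> cel S c))
        \<cdot> (?b \<rhd> (cel S ?\<beta> \<lhd> mor S (mor S (mor S f))))"
    by (simp add: free_str_def monad_simps) (simp add: free_ext_def monad_simps)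
  also have "\<dots> = (?k \<rhd> (aassoc A \<cdot> (c \<lhd> mor S ?m) \<cdot> (?m \<rhd> cel S c))) \<cdot>
      ((?\<beta> \<lhd> (mor S (mor S f) \<odot> mor S ?m)) \<cdot> (?b \<rhd> (cel S ?\<beta> \<lhd> mor S (mor S (mor S f)))))"
    unfolding ex by (simp add: free_ext_def monad_simps)
  also have "\<dots> = (free_str D S B c f \<lhd> ?mS) \<cdot> (?\<beta> \<lhd> mor S (mor S ?k))"
    unfolding c_assoc free_assoc[OF B f] by (simp add: free_ext_def free_str_def monad_simps)
  finally have 1: "(?k \<rhd> aassoc A) \<cdot> (free_str D S B c f \<lhd> mor S ?m) \<cdot> (?b \<rhd> cel S (free_str D S B c f))
    = (free_str D S B c f \<lhd> ?mS) \<cdot> (?\<beta> \<lhd> mor S (mor S ?k))" .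
  have "(free_str D S B c f \<lhd> unit S (ob S X)) \<cdot> (aunit B \<lhd> ?k)
     = (?k \<rhd> (c \<lhd> unit S (ob S X))) \<cdot>
        ((?\<beta> \<lhd> (unit S (ob S (aob B)) \<odot> mor S f)) \<cdot> (aunit B \<lhd> (?b \<odot> mor S f)))"
    by (simp add: free_ext_def free_str_def monad_simps)
  also have "\<dots> = ?k \<rhd> aunit A"
    unfolding free_unit[OF B f] c_unit by (simp add: free_ext_def monad_simps)
  finally have 2: "(free_str D S B c f \<lhd> unit S (ob S X)) \<cdot> (aunit B \<lhd> ?k) = ?k \<rhd> aunit A" .
  have 3: "C.iso (free_str D S B c f)" "cdom D (free_str D S B c f) = ?b \<odot> mor S ?k"
    "ccod D (free_str D S B c f) = ?k \<odot> ?m"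
    by (simp_all add: free_ext_def free_str_def monad_simps c C.iso_intros)
  show ?thesis
    unfolding pseudomorphism_iff using 1 2 3 by simp
qed

text \<open>The associator of \<open>B\<close> is natural by interchange and the multiplication is
  2-natural, which is the case of an identity \<open>c\<close>. A general \<open>c\<close> slides
  past \<alpha>, since the two act on different sides of the composite.\<close>

lemma free_algebra_cell:
  assumes B: "pseudoalgebra D S B"
    and f: "cdom D \<alpha> = f" "ccod D \<alpha> = f'" "src D f = X" "trg D f = aob B" "\<alpha> \<in> Cel D"
    and A: "act A = mult S X"
    and c: "c \<in> Cel D" "cdom D c = mult S X" "ccod D c = mult S X"
  shows "algebra_cell D S A B (free_ext D S B f) (free_str D S B c f)
    (free_ext D S B f') (free_str D S B c f') (free_ext2 D S B \<alpha>)"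
proof -
  interpret B: pseudoalgebra D S B by fact
  have f' [simp]: "src D f' = X" "trg D f' = aob B" "f' \<in> Mor D" "f \<in> Mor D"
    using f by (auto simp: C.cell_typ)
  note [simp] = f A c B.alg_typ
  have [simp]: "X \<in> Obj D"
    using C.src_Obj[of f] by simp
  let ?b = "act B" and ?\<beta> = "aassoc B" and ?m = "mult S X"
  \<comment> \<open>Interchange with \<beta> replaces b S(b) by b m in front of SS(\<alpha>), and
    \<open>mult_cell\<close> then turns m SS(\<alpha>) into S(\<alpha>) m.\<close>
  have ex1: "(?\<beta> \<lhd> mor S (mor S f')) \<cdot> ((?b \<odot> mor S ?b) \<rhd> cel S (cel S \<alpha>))
      = (?b \<rhd> (cel S \<alpha> \<lhd> ?m)) \<cdot> (?\<beta> \<lhd> mor S (mor S f))"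
    using C.whisk_exchange[of "cel S (cel S \<alpha>)" ?\<beta>]
      C.lwhisk_comp[of "cel S (cel S \<alpha>)" "mult S (aob B)" ?b]
    by (simp add: monad_typing mult_cell)
  have ex2: "((?b \<odot> mor S f') \<rhd> c) \<cdot> (?b \<rhd> (cel S \<alpha> \<lhd> ?m))
      = (?b \<rhd> (cel S \<alpha> \<lhd> ?m)) \<cdot> ((?b \<odot> mor S f) \<rhd> c)"
    using C.whisk_exchange[of c "?b \<rhd> cel S \<alpha>"] by (simp add: monad_simps)
  have "free_str D S B c f' \<cdot> (?b \<rhd> cel S (free_ext2 D S B \<alpha>))
      = ((?b \<odot> mor S f') \<rhd> c) \<cdot> ((?\<beta> \<lhd> mor S (mor S f')) \<cdot> ((?b \<odot> mor S ?b) \<rhd> cel S (cel S \<alpha>)))"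
    by (simp add: free_str_def free_ext_def free_ext2_def monad_simps)
  also have "\<dots> = (((?b \<odot> mor S f') \<rhd> c) \<cdot> (?b \<rhd> (cel S \<alpha> \<lhd> ?m))) \<cdot> (?\<beta> \<lhd> mor S (mor S f))"
    unfolding ex1 by (simp add: monad_simps)
  also have "\<dots> = (free_ext2 D S B \<alpha> \<lhd> ?m) \<cdot> free_str D S B c f"
    unfolding ex2 by (simp add: free_str_def free_ext_def free_ext2_def monad_simps)
  finally show ?thesis
    by (simp add: algebra_cell_iff free_ext_def free_ext2_def monad_simps)
qed

text \<open>The algebra 2-cell condition is the associativity axiom of \<open>hb\<close> whiskered
  with SS(f), with \<open>c\<close> carried along by interchange. Taken with h the extension of g^S,
  this cell is the comparison from which the new \<mu> is built.\<close>

lemma free_comparison: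
  assumes B: "pseudoalgebra D S B" and B': "pseudoalgebra D S B'"
    and h: "pseudomorphism D S B B' h hb"
    and f: "f \<in> Mor D" "src D f = X" "trg D f = aob B"
    and A: "act A = mult S X"
    and c: "c \<in> Cel D" "cdom D c = mult S X" "ccod D c = mult S X"
  shows "algebra_cell D S A B' (free_ext D S B' (h \<odot> f)) (free_str D S B' c (h \<odot> f))
    (h \<odot> free_ext D S B f) (comp_str D S h hb (free_ext D S B f) (free_str D S B c f))
    (hb \<lhd> mor S f)"
proof -
  interpret B: pseudoalgebra D S B by fact
  interpret B': pseudoalgebra D S B' by fact
  note [simp] = f A c B.alg_typ B'.alg_typ
  have [simp]: "X \<in> Obj D"
    using C.src_Obj[of f] by simp
  have [simp]: "h \<in> Mor D" "src D h = aob B" "trg D h = aob B'" "C.iso hb" "hb \<in> Cel D"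
    "cdom D hb = act B' \<odot> mor S h" "ccod D hb = h \<odot> act B"
    and hb_assoc: "(h \<rhd> aassoc B) \<cdot> (hb \<lhd> mor S (act B)) \<cdot> (act B' \<rhd> cel S hb)
      = (hb \<lhd> mult S (aob B)) \<cdot> (aassoc B' \<lhd> mor S (mor S h))"
    using h C.iso_Cel unfolding pseudomorphism_iff by blast+
  let ?b = "act B" and ?\<beta> = "aassoc B" and ?m = "mult S X" and ?b' = "act B'" and ?\<beta>' = "aassoc B'"
  have ex: "((h \<odot> ?b \<odot> mor S f) \<rhd> c) \<cdot> (hb \<lhd> (mor S f \<odot> ?m))
      = (hb \<lhd> (mor S f \<odot> ?m)) \<cdot> ((?b' \<odot> mor S h \<odot> mor S f) \<rhd> c)"
    using C.whisk_exchange[of c "hb \<lhd> mor S f"] by (simp add: monad_simps)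
  have "comp_str D S h hb (free_ext D S B f) (free_str D S B c f) \<cdot> (?b' \<rhd> cel S (hb \<lhd> mor S f))
    = ((h \<odot> ?b \<odot> mor S f) \<rhd> c) \<cdot>
      (((h \<rhd> ?\<beta>) \<cdot> (hb \<lhd> mor S ?b) \<cdot> (?b' \<rhd> cel S hb)) \<lhd> mor S (mor S f))"
    by (simp add: comp_str_def free_str_def free_ext_def monad_simps)
  also have "\<dots> = (((h \<odot> ?b \<odot> mor S f) \<rhd> c) \<cdot> (hb \<lhd> (mor S f \<odot> ?m))) \<cdot>
      (?\<beta>' \<lhd> (mor S (mor S h) \<odot> mor S (mor S f)))"
    unfolding hb_assoc by (simp add: monad_simps)
  also have "\<dots> = ((hb \<lhd> mor S f) \<lhd> ?m) \<cdot> free_str D S B' c (h \<odot> f)"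
    unfolding ex by (simp add: free_str_def free_ext_def monad_simps)
  finally show ?thesis
    by (simp add: algebra_cell_iff free_ext_def monad_simps)
qed

text \<open>
  The 2-cell \<open>w\<close> of the proof is an isomorphism \<open>b S(i e) \<Rightarrow> i\<close>. Carrying the free structure of \<open>b S(i e)\<close>
  along it yields a second structure on \<open>i\<close>, which differs from \<open>ib\<close> by the inverse of \<open>c\<close>; comparing the
  axioms of the two structures gives the two equations. That \<open>A\<close> is a pseudoalgebra is not available
  where this is applied.
\<close>
lemma twist:
  assumes B: "pseudoalgebra D S B" and X: "X \<in> Obj D"
    and A: "aob A = ob S X" "act A = mult S X" "C.iso (aassoc A)"
      "cdom D (aassoc A) = mult S X \<odot> mult S (ob S X)"
      "ccod D (aassoc A) = mult S X \<odot> mult S (ob S X)"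
      "aunit A \<in> Cel D" "cdom D (aunit A) = idm D (ob S X)" "ccod D (aunit A) = idm D (ob S X)"
    and i: "pseudomorphism D S A B i ib"
    and c_def: "c = inv_cell D (aassoc A \<lhd> mor S (mor S (unit S X)))"
  shows "i \<rhd> (aassoc A \<cdot> (c \<lhd> mor S (mult S X)) \<cdot> (mult S X \<rhd> cel S c))
      = i \<rhd> (c \<lhd> mult S (ob S X))"
    and "i \<rhd> (c \<lhd> unit S (ob S X)) = i \<rhd> aunit A"
proof -
  interpret B: pseudoalgebra D S B by fact
  note [simp] = X A C.iso_Cel[OF A(3)] B.alg_typ
  let ?b = "act B" and ?\<beta> = "aassoc B" and ?\<nu> = "aunit B"
  let ?m = "mult S X" and ?mS = "mult S (ob S X)" and ?e = "unit S X" and ?eS = "unit S (ob S X)"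
  note i' = i[unfolded pseudomorphism_iff]
  have [simp]: "i \<in> Mor D" "src D i = ob S X" "trg D i = aob B" "C.iso ib" "ib \<in> Cel D"
    "cdom D ib = ?b \<odot> mor S i" "ccod D ib = i \<odot> ?m"
    and ib_assoc: "(i \<rhd> aassoc A) \<cdot> (ib \<lhd> mor S ?m) \<cdot> (?b \<rhd> cel S ib)
      = (ib \<lhd> ?mS) \<cdot> (?\<beta> \<lhd> mor S (mor S i))"
    and ib_unit: "(ib \<lhd> ?eS) \<cdot> (?\<nu> \<lhd> i) = i \<rhd> aunit A"
    using i' C.iso_Cel by auto
  define d where "d = aassoc A \<lhd> mor S (mor S ?e)"
  have d [simp]: "C.iso d" "d \<in> Cel D" "cdom D d = ?m" "ccod D d = ?m"
    by (simp_all add: d_def monad_simps C.iso_intros)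
  have c [simp]: "c \<in> Cel D" "cdom D c = ?m" "ccod D c = ?m"
    and cd: "c \<cdot> d = idc D ?m" "d \<cdot> c = idc D ?m"
    using C.inv_cell_inverse[OF d(1)] by (simp_all add: c_def flip: d_def)
  define w where "w = ib \<lhd> mor S ?e"
  define ib' where "ib' = (i \<rhd> d) \<cdot> ib"
  have w [simp]: "w \<in> Cel D" "cdom D w = ?b \<odot> mor S i \<odot> mor S ?e" "ccod D w = i" "C.iso w"
    by (simp_all add: w_def monad_simps C.iso_intros)
  have ib' [simp]: "ib' \<in> Cel D" "cdom D ib' = ?b \<odot> mor S i" "ccod D ib' = i \<odot> ?m"
    by (simp_all add: ib'_def monad_simps)
  define \<phi> where "\<phi> = ?\<beta> \<lhd> (mor S (mor S i) \<odot> mor S (mor S ?e))"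
  have \<phi> [simp]: "\<phi> \<in> Cel D" "cdom D \<phi> = ?b \<odot> mor S ?b \<odot> mor S (mor S i) \<odot> mor S (mor S ?e)"
    "ccod D \<phi> = ?b \<odot> mor S i \<odot> mor S ?e \<odot> ?m"
    by (simp_all add: \<phi>_def monad_simps)
  \<comment> \<open>This is \<open>ib_assoc\<close> whiskered with SS(e): the associator of
    \<open>A\<close> becomes \<open>d\<close>, and S(m) SS(e) = 1 leaves \<open>ib\<close> bare. It
    says that \<open>w\<close> is an algebra 2-cell from the free structure \<open>\<phi>\<close> to
    \<open>ib'\<close>.\<close>
  have w_cell: "ib' \<cdot> (?b \<rhd> cel S w) = (w \<lhd> ?m) \<cdot> \<phi>"
    using arg_cong[OF ib_assoc, of "\<lambda>x. x \<lhd> mor S (mor S ?e)"]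
    by (simp add: ib'_def w_def d_def \<phi>_def monad_simps)
  have j: "i \<odot> ?e \<in> Mor D" "src D (i \<odot> ?e) = X" "trg D (i \<odot> ?e) = aob B"
    by (simp_all add: monad_simps)
  have \<phi>_unit: "(\<phi> \<lhd> ?eS) \<cdot> (?\<nu> \<lhd> (?b \<odot> mor S i \<odot> mor S ?e)) = idc D (?b \<odot> mor S i \<odot> mor S ?e)"
    using free_unit[OF B j] by (simp add: \<phi>_def monad_simps)
  have \<phi>_assoc: "(\<phi> \<lhd> mor S ?m) \<cdot> (?b \<rhd> cel S \<phi>)
      = (\<phi> \<lhd> ?mS) \<cdot> (?\<beta> \<lhd> (mor S (mor S ?b) \<odot> mor S (mor S (mor S i)) \<odot> mor S (mor S (mor S ?e))))"
    using free_assoc[OF B j] by (simp add: \<phi>_def monad_simps)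

  have ex1: "(?b \<rhd> (cel S w \<lhd> ?eS)) \<cdot> (?\<nu> \<lhd> (?b \<odot> mor S i \<odot> mor S ?e)) = (?\<nu> \<lhd> i) \<cdot> w"
    using C.whisk_exchange[of w ?\<nu>] C.lwhisk_comp[of w "unit S (aob B)" ?b]
    by (simp add: monad_simps unit_cell)
  \<comment> \<open>The unit law of \<open>\<phi>\<close> is transported along \<open>w\<close>,
    which is invertible and cancelled at the end.\<close>
  have "((ib' \<lhd> ?eS) \<cdot> (?\<nu> \<lhd> i)) \<cdot> w = (ib' \<lhd> ?eS) \<cdot> ((?\<nu> \<lhd> i) \<cdot> w)"
    by (simp add: monad_simps)
  also have "\<dots> = ((ib' \<cdot> (?b \<rhd> cel S w)) \<lhd> ?eS) \<cdot> (?\<nu> \<lhd> (?b \<odot> mor S i \<odot> mor S ?e))"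
    unfolding ex1[symmetric] by (simp add: monad_simps)
  also have "\<dots> = w \<cdot> ((\<phi> \<lhd> ?eS) \<cdot> (?\<nu> \<lhd> (?b \<odot> mor S i \<odot> mor S ?e)))"
    unfolding w_cell by (simp add: monad_simps)
  also have "\<dots> = idc D i \<cdot> w"
    unfolding \<phi>_unit by (simp add: monad_simps)
  finally have ib'_unit: "(ib' \<lhd> ?eS) \<cdot> (?\<nu> \<lhd> i) = idc D i"
    by (rule C.iso_cancel_right[rotated 5]) (simp_all add: monad_simps)

  let ?P = "(?b \<odot> mor S ?b) \<rhd> cel S (cel S w)"
  let ?k = "mor S (mor S ?b) \<odot> mor S (mor S (mor S i)) \<odot> mor S (mor S (mor S ?e))"
  have ex2: "(?\<beta> \<lhd> mor S (mor S i)) \<cdot> ?P = (?b \<rhd> (cel S w \<lhd> ?mS)) \<cdot> (?\<beta> \<lhd> ?k)"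
    using C.whisk_exchange[of "cel S (cel S w)" ?\<beta>]
      C.lwhisk_comp[of "cel S (cel S w)" "mult S (aob B)" ?b]
    by (simp add: monad_typing mult_cell)
  \<comment> \<open>Associativity is transported in the same way. Since the action is applied twice,
    the cell to be cancelled is the double image \<open>?P\<close> of \<open>w\<close>.\<close>
  have "((ib' \<lhd> mor S ?m) \<cdot> (?b \<rhd> cel S ib')) \<cdot> ?P = (ib' \<lhd> mor S ?m) \<cdot> (?b \<rhd> cel S (ib' \<cdot> (?b \<rhd> cel S w)))"
    by (simp add: monad_simps)
  also have "\<dots> = (ib' \<lhd> mor S ?m) \<cdot> (?b \<rhd> cel S ((w \<lhd> ?m) \<cdot> \<phi>))"
    by (simp only: w_cell)
  also have "\<dots> = ((ib' \<cdot> (?b \<rhd> cel S w)) \<lhd> mor S ?m) \<cdot> (?b \<rhd> cel S \<phi>)"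
    by (simp add: monad_simps)
  also have "\<dots> = (w \<lhd> (?m \<odot> ?mS)) \<cdot> ((\<phi> \<lhd> mor S ?m) \<cdot> (?b \<rhd> cel S \<phi>))"
    unfolding w_cell by (simp add: monad_simps)
  also have "\<dots> = (((w \<lhd> ?m) \<cdot> \<phi>) \<lhd> ?mS) \<cdot> (?\<beta> \<lhd> ?k)"
    unfolding \<phi>_assoc by (simp add: monad_simps)
  also have "\<dots> = (ib' \<lhd> ?mS) \<cdot> ((?\<beta> \<lhd> mor S (mor S i)) \<cdot> ?P)"
    unfolding ex2 w_cell[symmetric] by (simp add: monad_simps)
  also have "\<dots> = ((ib' \<lhd> ?mS) \<cdot> (?\<beta> \<lhd> mor S (mor S i))) \<cdot> ?P"
    by (simp add: monad_simps)
  finally have ib'_assoc: "(ib' \<lhd> mor S ?m) \<cdot> (?b \<rhd> cel S ib') = (ib' \<lhd> ?mS) \<cdot> (?\<beta> \<lhd> mor S (mor S i))"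
    by (rule C.iso_cancel_right[rotated 5]) (simp_all add: monad_simps C.iso_intros iso_cel)

  \<comment> \<open>The unit law of \<open>ib\<close> has \<open>i \<rhd> aunit A\<close> on its
    right side, that of \<open>ib'\<close> an identity. As \<open>ib'\<close> is
    \<open>(i \<rhd> d) \<cdot> ib\<close>, the two combine into a law for \<open>d\<close>
    alone.\<close>
  have d_unit: "(i \<rhd> (d \<lhd> ?eS)) \<cdot> (i \<rhd> aunit A) = idc D i"
    unfolding ib_unit[symmetric] using ib'_unit by (simp add: ib'_def monad_simps)
  have "i \<rhd> (c \<lhd> ?eS) = (i \<rhd> (c \<lhd> ?eS)) \<cdot> ((i \<rhd> (d \<lhd> ?eS)) \<cdot> (i \<rhd> aunit A))"
    unfolding d_unit by (simp add: monad_simps)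
  also have "\<dots> = (i \<rhd> ((c \<cdot> d) \<lhd> ?eS)) \<cdot> (i \<rhd> aunit A)"
    by (simp add: monad_simps)
  also have "\<dots> = i \<rhd> aunit A"
    unfolding cd by (simp add: monad_simps)
  finally show "i \<rhd> (c \<lhd> ?eS) = i \<rhd> aunit A" .

  let ?Q = "(ib \<lhd> mor S ?m) \<cdot> (?b \<rhd> cel S ib)"
  have ex3: "(ib \<lhd> mor S ?m) \<cdot> ((?b \<odot> mor S i) \<rhd> cel S d) = ((i \<odot> ?m) \<rhd> cel S d) \<cdot> (ib \<lhd> mor S ?m)"
    using C.whisk_exchange[of "cel S d" ib] by (simp add: monad_simps)
  \<comment> \<open>The associativity law of \<open>ib\<close> contains \<open>aassoc A\<close>,
    that of \<open>ib'\<close> does not. Both can be written as a cell built from \<open>d\<close>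
    after the common invertible cell \<open>?Q\<close>, which is cancelled.\<close>
  have "(i \<rhd> ((d \<lhd> mor S ?m) \<cdot> (?m \<rhd> cel S d))) \<cdot> ?Q
    = (i \<rhd> (d \<lhd> mor S ?m)) \<cdot> (((i \<odot> ?m) \<rhd> cel S d) \<cdot> (ib \<lhd> mor S ?m)) \<cdot> (?b \<rhd> cel S ib)"
    by (simp add: monad_simps)
  also have "\<dots> = (ib' \<lhd> mor S ?m) \<cdot> (?b \<rhd> cel S ib')"
    unfolding ex3[symmetric] by (simp add: ib'_def monad_simps)
  also have "\<dots> = (i \<rhd> (d \<lhd> ?mS)) \<cdot> ((ib \<lhd> ?mS) \<cdot> (?\<beta> \<lhd> mor S (mor S i)))"
    unfolding ib'_assoc by (simp add: ib'_def monad_simps)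
  also have "\<dots> = (i \<rhd> ((d \<lhd> ?mS) \<cdot> aassoc A)) \<cdot> ?Q"
    unfolding ib_assoc[symmetric] by (simp add: monad_simps)
  finally have d_assoc: "i \<rhd> ((d \<lhd> mor S ?m) \<cdot> (?m \<rhd> cel S d)) = i \<rhd> ((d \<lhd> ?mS) \<cdot> aassoc A)"
    by (rule C.iso_cancel_right[rotated 5]) (simp_all add: monad_simps C.iso_intros iso_cel)

  \<comment> \<open>It remains to solve \<open>d_assoc\<close> for \<open>c\<close>: the pasting of
    two copies of \<open>d\<close> has the pasting of two copies of \<open>c\<close> as right
    inverse.\<close>
  have "(d \<lhd> mor S ?m) \<cdot> (?m \<rhd> cel S d) \<cdot> (?m \<rhd> cel S c) \<cdot> (c \<lhd> mor S ?m)
     = (d \<lhd> mor S ?m) \<cdot> (?m \<rhd> cel S (d \<cdot> c)) \<cdot> (c \<lhd> mor S ?m)"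
    by (simp add: monad_simps)
  also have "\<dots> = (d \<lhd> mor S ?m) \<cdot> (?m \<rhd> cel S (idc D ?m)) \<cdot> (c \<lhd> mor S ?m)"
    by (simp only: cd)
  also have "\<dots> = (d \<cdot> c) \<lhd> mor S ?m"
    by (simp add: monad_simps)
  also have "\<dots> = idc D (?m \<odot> ?mS)"
    unfolding cd by (simp add: monad_simps)
  finally have dc: "(d \<lhd> mor S ?m) \<cdot> (?m \<rhd> cel S d) \<cdot> (?m \<rhd> cel S c) \<cdot> (c \<lhd> mor S ?m)
    = idc D (?m \<odot> ?mS)" .
  have ex4: "(?m \<rhd> cel S c) \<cdot> (c \<lhd> mor S ?m) = (c \<lhd> mor S ?m) \<cdot> (?m \<rhd> cel S c)"
    using C.whisk_exchange[of "cel S c" c] by (simp add: monad_simps)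
  have "i \<rhd> (c \<lhd> ?mS)
    = (i \<rhd> (c \<lhd> ?mS)) \<cdot> (i \<rhd> ((d \<lhd> mor S ?m) \<cdot> (?m \<rhd> cel S d) \<cdot> (?m \<rhd> cel S c) \<cdot> (c \<lhd> mor S ?m)))"
    unfolding dc by (simp add: monad_simps)
  also have "\<dots> = (i \<rhd> (c \<lhd> ?mS)) \<cdot> (i \<rhd> ((d \<lhd> mor S ?m) \<cdot> (?m \<rhd> cel S d)))
      \<cdot> (i \<rhd> ((?m \<rhd> cel S c) \<cdot> (c \<lhd> mor S ?m)))"
    by (simp add: monad_simps)
  also have "\<dots> = (i \<rhd> ((c \<cdot> d) \<lhd> ?mS)) \<cdot> (i \<rhd> aassoc A)
      \<cdot> (i \<rhd> ((?m \<rhd> cel S c) \<cdot> (c \<lhd> mor S ?m)))"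
    unfolding d_assoc by (simp add: monad_simps)
  also have "\<dots> = i \<rhd> (aassoc A \<cdot> (c \<lhd> mor S ?m) \<cdot> (?m \<rhd> cel S c))"
    unfolding cd ex4 by (simp add: monad_simps)
  finally show "i \<rhd> (aassoc A \<cdot> (c \<lhd> mor S ?m) \<cdot> (?m \<rhd> cel S c)) = i \<rhd> (c \<lhd> ?mS)" ..
qed

section \<open>Free algebras, composites of pseudomorphisms and of algebra 2-cells\<close>

lemma free_alg_strict:
  assumes "X \<in> Obj D"
  shows "strict_algebra D S (free_alg D S X)"
proof -
  have "pseudoalgebra D S (free_alg D S X)"
  proof (unfold_locales, goal_cases)
    case 1 then show ?case using assms by (simp add: free_alg_def monad_typing)
  next
    case 2 then show ?case using assms by (simp add: free_alg_def Hom_def monad_typing)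
  next
    case 3 then show ?case using assms by (simp add: free_alg_def C.IsoCells_iff C.iso_intros monad_simps)
  next
    case 4 then show ?case using assms by (simp add: free_alg_def C.IsoCells_iff C.iso_intros monad_simps)
  next
    case 5 then show ?case using assms by (simp add: free_alg_def monad_simps)
  next
    case 6 then show ?case using assms by (simp add: free_alg_def monad_simps)
  qed
  then show ?thesis
    by (simp add: strict_algebra_def free_alg_def)
qed

text \<open>The source \<open>A\<close> is given by the typing of its data alone, because the lemma
  is applied to \<open>Jfree X\<close>, whose coherence axioms are not at hand.\<close>

lemma comp_pseudomorphism:
  assumes B: "pseudoalgebra D S B" and E: "pseudoalgebra D S E"
    and A: "aob A \<in> Obj D" "act A \<in> Mor D" "src D (act A) = ob S (aob A)" "trg D (act A) = aob A"
      "aassoc A \<in> Cel D" "cdom D (aassoc A) = act A \<odot> mor S (act A)"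
      "ccod D (aassoc A) = act A \<odot> mult S (aob A)"
      "aunit A \<in> Cel D" "cdom D (aunit A) = idm D (aob A)" "ccod D (aunit A) = act A \<odot> unit S (aob A)"
    and f: "pseudomorphism D S A B f fb" and g: "pseudomorphism D S B E g gb"
  shows "pseudomorphism D S A E (g \<odot> f) (comp_str D S g gb f fb)"
proof -
  interpret B: pseudoalgebra D S B by fact
  interpret E: pseudoalgebra D S E by fact
  let ?a = "act A" and ?b = "act B" and ?e = "act E"
  note [simp] = A B.alg_typ E.alg_typ
  have [simp]: "f \<in> Mor D" "src D f = aob A" "trg D f = aob B" "C.iso fb" "fb \<in> Cel D"
    "cdom D fb = ?b \<odot> mor S f" "ccod D fb = f \<odot> ?a"
    and fb: "(f \<rhd> aassoc A) \<cdot> (fb \<lhd> mor S ?a) \<cdot> (?b \<rhd> cel S fb)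
      = (fb \<lhd> mult S (aob A)) \<cdot> (aassoc B \<lhd> mor S (mor S f))"
      "(fb \<lhd> unit S (aob A)) \<cdot> (aunit B \<lhd> f) = f \<rhd> aunit A"
    using f C.iso_Cel unfolding pseudomorphism_iff by auto
  have [simp]: "g \<in> Mor D" "src D g = aob B" "trg D g = aob E" "C.iso gb" "gb \<in> Cel D"
    "cdom D gb = ?e \<odot> mor S g" "ccod D gb = g \<odot> ?b"
    and gb: "(g \<rhd> aassoc B) \<cdot> (gb \<lhd> mor S ?b) \<cdot> (?e \<rhd> cel S gb)
      = (gb \<lhd> mult S (aob B)) \<cdot> (aassoc E \<lhd> mor S (mor S g))"
      "(gb \<lhd> unit S (aob B)) \<cdot> (aunit E \<lhd> g) = g \<rhd> aunit B"
    using g C.iso_Cel unfolding pseudomorphism_iff by auto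
  let ?c = "comp_str D S g gb f fb"
  \<comment> \<open>Interchange gathers the cells of \<open>f\<close> on one side. The associativity
    axiom of \<open>f\<close> then produces the associator of \<open>B\<close>, which the axiom of
    \<open>g\<close> consumes.\<close>
  have ex: "(gb \<lhd> (mor S f \<odot> mor S ?a)) \<cdot> ((?e \<odot> mor S g) \<rhd> cel S fb)
      = ((g \<odot> ?b) \<rhd> cel S fb) \<cdot> (gb \<lhd> (mor S ?b \<odot> mor S (mor S f)))"
    using C.whisk_exchange[of "cel S fb" gb] by (simp add: monad_simps)
  have "((g \<odot> f) \<rhd> aassoc A) \<cdot> (?c \<lhd> mor S ?a) \<cdot> (?e \<rhd> cel S ?c)
    = ((g \<odot> f) \<rhd> aassoc A) \<cdot> (g \<rhd> (fb \<lhd> mor S ?a)) \<cdot>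
      ((gb \<lhd> (mor S f \<odot> mor S ?a)) \<cdot> ((?e \<odot> mor S g) \<rhd> cel S fb)) \<cdot>
      (?e \<rhd> (cel S gb \<lhd> mor S (mor S f)))"
    by (simp add: comp_str_def monad_simps)
  also have "\<dots> = (g \<rhd> ((f \<rhd> aassoc A) \<cdot> (fb \<lhd> mor S ?a) \<cdot> (?b \<rhd> cel S fb))) \<cdot>
      (((gb \<lhd> mor S ?b) \<cdot> (?e \<rhd> cel S gb)) \<lhd> mor S (mor S f))"
    unfolding ex by (simp add: monad_simps)
  also have "\<dots> = (g \<rhd> (fb \<lhd> mult S (aob A))) \<cdot>
      (((g \<rhd> aassoc B) \<cdot> (gb \<lhd> mor S ?b) \<cdot> (?e \<rhd> cel S gb)) \<lhd> mor S (mor S f))"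
    unfolding fb by (simp add: monad_simps)
  also have "\<dots> = (?c \<lhd> mult S (aob A)) \<cdot> (aassoc E \<lhd> mor S (mor S (g \<odot> f)))"
    unfolding gb by (simp add: comp_str_def monad_simps)
  finally have 1: "((g \<odot> f) \<rhd> aassoc A) \<cdot> (?c \<lhd> mor S ?a) \<cdot> (?e \<rhd> cel S ?c)
    = (?c \<lhd> mult S (aob A)) \<cdot> (aassoc E \<lhd> mor S (mor S (g \<odot> f)))" .
  have "(?c \<lhd> unit S (aob A)) \<cdot> (aunit E \<lhd> (g \<odot> f))
     = (g \<rhd> (fb \<lhd> unit S (aob A))) \<cdot> (((gb \<lhd> unit S (aob B)) \<cdot> (aunit E \<lhd> g)) \<lhd> f)"
    by (simp add: comp_str_def monad_simps)
  also have "\<dots> = g \<rhd> ((fb \<lhd> unit S (aob A)) \<cdot> (aunit B \<lhd> f))"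
    unfolding gb by (simp add: monad_simps)
  also have "\<dots> = (g \<odot> f) \<rhd> aunit A"
    unfolding fb by (simp add: monad_simps)
  finally have 2: "(?c \<lhd> unit S (aob A)) \<cdot> (aunit E \<lhd> (g \<odot> f)) = (g \<odot> f) \<rhd> aunit A" .
  show ?thesis
    unfolding pseudomorphism_iff using 1 2
    by (simp add: comp_str_def monad_simps C.iso_intros)
qed

lemma algebra_cell_vcomp:
  assumes A: "act A \<in> Mor D" "trg D (act A) = aob A"
    and B: "act B \<in> Mor D" "src D (act B) = ob S (aob B)"
    and f: "f \<in> Mor D" "src D f = aob A" "trg D f = aob B"
    and b: "fb \<in> Cel D" "cdom D fb = act B \<odot> mor S f" "ccod D fb = f \<odot> act A"
      "gb \<in> Cel D" "cdom D gb = act B \<odot> mor S g" "ccod D gb = g \<odot> act A"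
      "hb \<in> Cel D" "cdom D hb = act B \<odot> mor S h" "ccod D hb = h \<odot> act A"
    and \<alpha>: "algebra_cell D S A B f fb g gb \<alpha>" and \<beta>: "algebra_cell D S A B g gb h hb \<beta>"
  shows "algebra_cell D S A B f fb h hb (\<beta> \<cdot> \<alpha>)"
proof -
  have [simp]: "\<alpha> \<in> Cel D" "cdom D \<alpha> = f" "ccod D \<alpha> = g" "\<beta> \<in> Cel D" "cdom D \<beta> = g" "ccod D \<beta> = h"
    and eq: "gb \<cdot> (act B \<rhd> cel S \<alpha>) = (\<alpha> \<lhd> act A) \<cdot> fb"
      "hb \<cdot> (act B \<rhd> cel S \<beta>) = (\<beta> \<lhd> act A) \<cdot> gb"
    using \<alpha> \<beta> by (auto simp: algebra_cell_iff)
  have [simp]: "g \<in> Mor D" "src D g = aob A" "trg D g = aob B"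
    using C.cell_typ[of \<alpha>] f by auto
  note [simp] = A B f b
  have "hb \<cdot> (act B \<rhd> cel S (\<beta> \<cdot> \<alpha>)) = (hb \<cdot> (act B \<rhd> cel S \<beta>)) \<cdot> (act B \<rhd> cel S \<alpha>)"
    by (simp add: monad_simps)
  also have "\<dots> = (\<beta> \<lhd> act A) \<cdot> (gb \<cdot> (act B \<rhd> cel S \<alpha>))"
    unfolding eq(2) by (simp add: monad_simps)
  also have "\<dots> = ((\<beta> \<cdot> \<alpha>) \<lhd> act A) \<cdot> fb"
    unfolding eq(1) by (simp add: monad_simps)
  finally show ?thesis
    by (simp add: algebra_cell_iff monad_simps)
qed

end

section \<open>Relative pseudomonads\<close>

context relative_pseudomonad
begin

lemma ext_typ:
  assumes "X \<in> Obj C" "Y \<in> Obj C" "f \<in> Mor D" "src D f = ob J X" "trg D f = Tob T Y"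
  shows "ext T X Y f \<in> Mor D" "src D (ext T X Y f) = Tob T X" "trg D (ext T X Y f) = Tob T Y"
  using ext_Hom[of X Y f] assms by (auto simp: Hom_def)

lemma ext2_typ:
  assumes "X \<in> Obj C" "Y \<in> Obj C" "\<alpha> \<in> Cel D" "src D (cdom D \<alpha>) = ob J X" "trg D (cdom D \<alpha>) = Tob T Y"
  shows "ext2 T X Y \<alpha> \<in> Cel D" "cdom D (ext2 T X Y \<alpha>) = ext T X Y (cdom D \<alpha>)"
    "ccod D (ext2 T X Y \<alpha>) = ext T X Y (ccod D \<alpha>)"
  using ext2_Cells[of X Y "cdom D \<alpha>" \<alpha> "ccod D \<alpha>"] assms by (auto simp: Hom_def Cells_def D.category_simps)

lemma ext2_idc_Mor:
  "\<lbrakk>X \<in> Obj C; Y \<in> Obj C; f \<in> Mor D; src D f = ob J X; trg D f = Tob T Y\<rbrakk>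
    \<Longrightarrow> ext2 T X Y (idc D f) = idc D (ext T X Y f)"
  using ext2_idc[of X Y f] by (auto simp: Hom_def)

lemma ext2_vcomp_Cel:
  assumes "X \<in> Obj C" "Y \<in> Obj C" "\<alpha> \<in> Cel D" "src D (cdom D \<alpha>) = ob J X" "trg D (cdom D \<alpha>) = Tob T Y"
    "\<beta> \<in> Cel D" "ccod D \<alpha> = cdom D \<beta>"
  shows "ext2 T X Y (\<beta> \<cdot>\<^bsub>D\<^esub> \<alpha>) = ext2 T X Y \<beta> \<cdot>\<^bsub>D\<^esub> ext2 T X Y \<alpha>"
  using ext2_vcomp[of X Y "cdom D \<alpha>" \<alpha> "ccod D \<alpha>" \<beta> "ccod D \<beta>"] assms
  by (auto simp: Hom_def Cells_def D.category_simps)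

lemma iso_ext2:
  assumes "X \<in> Obj C" "Y \<in> Obj C" "D.iso \<alpha>" "src D (cdom D \<alpha>) = ob J X" "trg D (cdom D \<alpha>) = Tob T Y"
  shows "D.iso (ext2 T X Y \<alpha>)"
  using assms(3)
proof (rule D.isoE)
  fix \<beta> assume b: "\<alpha> \<in> Cel D" "\<beta> \<in> Cel D" "cdom D \<beta> = ccod D \<alpha>" "ccod D \<beta> = cdom D \<alpha>"
    "\<beta> \<cdot>\<^bsub>D\<^esub> \<alpha> = idc D (cdom D \<alpha>)" "\<alpha> \<cdot>\<^bsub>D\<^esub> \<beta> = idc D (ccod D \<alpha>)"
  show ?thesis
    by (rule D.isoI[where \<beta> = "ext2 T X Y \<beta>"])
      (use b assms in \<open>simp_all add: D.cell_typ ext2_typ ext2_idc_Mor flip: ext2_vcomp_Cel\<close>)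
qed

lemma tunit_typ:
  assumes "X \<in> Obj C"
  shows "tunit T X \<in> Mor D" "src D (tunit T X) = ob J X" "trg D (tunit T X) = Tob T X"
  using tunit_Hom[of X] assms by (auto simp: Hom_def)

lemma mu_typ:
  assumes "X \<in> Obj C" "Y \<in> Obj C" "Z \<in> Obj C" "f \<in> Mor D" "src D f = ob J X" "trg D f = Tob T Y"
    "g \<in> Mor D" "src D g = ob J Y" "trg D g = Tob T Z"
  shows "D.iso (mu T X Y Z g f)" "mu T X Y Z g f \<in> Cel D"
    "cdom D (mu T X Y Z g f) = ext T X Z (ext T Y Z g \<odot>\<^bsub>D\<^esub> f)"
    "ccod D (mu T X Y Z g f) = ext T Y Z g \<odot>\<^bsub>D\<^esub> ext T X Y f"
  using mu_Iso[of X Y Z f g] assms by (auto simp: Hom_def D.IsoCells_iff D.iso_Cel)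

text \<open>Naturality is split into its two variables by taking one cell to be an identity, so that
  only whiskerings occur.\<close>

lemma mu_natural_left:
  assumes "X \<in> Obj C" "Y \<in> Obj C" "Z \<in> Obj C" "\<alpha> \<in> Cel D" "cdom D \<alpha> = f" "ccod D \<alpha> = f'"
    "src D f = ob J X" "trg D f = Tob T Y" "g \<in> Mor D" "src D g = ob J Y" "trg D g = Tob T Z"
  shows "mu T X Y Z g f' \<cdot>\<^bsub>D\<^esub> ext2 T X Z (ext T Y Z g \<rhd>\<^bsub>D\<^esub> \<alpha>)
    = (ext T Y Z g \<rhd>\<^bsub>D\<^esub> ext2 T X Y \<alpha>) \<cdot>\<^bsub>D\<^esub> mu T X Y Z g f"
  using mu_natural[of X Y Z f g \<alpha> f' "idc D g" g] assms D.cell_typ[of \<alpha>]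
  by (simp add: Hom_def Cells_def D.category_simps ext2_idc_Mor lwhisk_def)

lemma mu_natural_right:
  assumes "X \<in> Obj C" "Y \<in> Obj C" "Z \<in> Obj C" "f \<in> Mor D" "src D f = ob J X" "trg D f = Tob T Y"
    "\<beta> \<in> Cel D" "cdom D \<beta> = g" "ccod D \<beta> = g'" "src D g = ob J Y" "trg D g = Tob T Z"
  shows "mu T X Y Z g' f \<cdot>\<^bsub>D\<^esub> ext2 T X Z (ext2 T Y Z \<beta> \<lhd>\<^bsub>D\<^esub> f)
    = (ext2 T Y Z \<beta> \<lhd>\<^bsub>D\<^esub> ext T X Y f) \<cdot>\<^bsub>D\<^esub> mu T X Y Z g f"
  using mu_natural[of X Y Z f g "idc D f" f \<beta> g'] assms D.cell_typ[of \<beta>]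
  by (simp add: Hom_def Cells_def D.category_simps ext2_idc_Mor rwhisk_def)

lemma eta_typ:
  assumes "X \<in> Obj C" "Y \<in> Obj C" "f \<in> Mor D" "src D f = ob J X" "trg D f = Tob T Y"
  shows "D.iso (eta T X Y f)" "eta T X Y f \<in> Cel D" "cdom D (eta T X Y f) = f"
    "ccod D (eta T X Y f) = ext T X Y f \<odot>\<^bsub>D\<^esub> tunit T X"
  using eta_Iso[of X Y f] assms by (auto simp: Hom_def D.IsoCells_iff D.iso_Cel)

lemma eta_natural_Cel:
  assumes "X \<in> Obj C" "Y \<in> Obj C" "\<alpha> \<in> Cel D" "cdom D \<alpha> = f" "ccod D \<alpha> = f'"
    "src D f = ob J X" "trg D f = Tob T Y"
  shows "eta T X Y f' \<cdot>\<^bsub>D\<^esub> \<alpha> = (ext2 T X Y \<alpha> \<lhd>\<^bsub>D\<^esub> tunit T X) \<cdot>\<^bsub>D\<^esub> eta T X Y f"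
  using eta_natural[of X Y f \<alpha> f'] assms D.cell_typ[of \<alpha>] by (simp add: Hom_def Cells_def)

lemma theta_typ:
  assumes "X \<in> Obj C"
  shows "D.iso (theta T X)" "theta T X \<in> Cel D" "cdom D (theta T X) = ext T X X (tunit T X)"
    "ccod D (theta T X) = idm D (Tob T X)"
  using theta_Iso[of X] assms by (auto simp: D.IsoCells_iff D.iso_Cel)

lemmas ext_simps = Tob_Obj ext_typ ext2_typ ext2_idc_Mor ext2_vcomp_Cel tunit_typ mu_typ eta_typ theta_typ

text \<open>Every \<open>k : JX \<rightarrow> TY\<close> is isomorphic to \<open>k\<^sup>* i\<^sub>X\<close>.\<close>
lemma tunit_faithful:
  assumes X: "X \<in> Obj C" "Y \<in> Obj C" and k: "k \<in> Mor D" "src D k = ob J X" "trg D k = Tob T Y"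
    and x: "x \<in> Cel D" "y \<in> Cel D" "cdom D x = p" "cdom D y = p" "ccod D x = q" "ccod D y = q"
      "trg D p = ob J X"
    and eq: "tunit T X \<rhd>\<^bsub>D\<^esub> x = tunit T X \<rhd>\<^bsub>D\<^esub> y"
  shows "k \<rhd>\<^bsub>D\<^esub> x = k \<rhd>\<^bsub>D\<^esub> y"
proof -
  let ?\<eta> = "eta T X Y k" and ?K = "ext T X Y k \<odot>\<^bsub>D\<^esub> tunit T X"
  have q: "p \<in> Mor D" "q \<in> Mor D" "trg D q = ob J X"
    using D.cell_typ[of x] x by auto
  note [simp] = X k x q ext_simps
  have 1: "(?\<eta> \<lhd>\<^bsub>D\<^esub> q) \<cdot>\<^bsub>D\<^esub> (k \<rhd>\<^bsub>D\<^esub> x) = (?K \<rhd>\<^bsub>D\<^esub> x) \<cdot>\<^bsub>D\<^esub> (?\<eta> \<lhd>\<^bsub>D\<^esub> p)"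
    "(?\<eta> \<lhd>\<^bsub>D\<^esub> q) \<cdot>\<^bsub>D\<^esub> (k \<rhd>\<^bsub>D\<^esub> y) = (?K \<rhd>\<^bsub>D\<^esub> y) \<cdot>\<^bsub>D\<^esub> (?\<eta> \<lhd>\<^bsub>D\<^esub> p)"
    using D.whisk_exchange[of x ?\<eta>] D.whisk_exchange[of y ?\<eta>] by simp_all
  have "?K \<rhd>\<^bsub>D\<^esub> x = ?K \<rhd>\<^bsub>D\<^esub> y"
    using eq by (simp flip: D.lwhisk_comp)
  then have "(?\<eta> \<lhd>\<^bsub>D\<^esub> q) \<cdot>\<^bsub>D\<^esub> (k \<rhd>\<^bsub>D\<^esub> x) = (?\<eta> \<lhd>\<^bsub>D\<^esub> q) \<cdot>\<^bsub>D\<^esub> (k \<rhd>\<^bsub>D\<^esub> y)"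
    unfolding 1 by simp
  then show ?thesis
    by (rule D.iso_cancel_left[rotated 5]) (simp_all add: D.iso_intros D.whisker_simps D.category_simps)
qed

end

section \<open>The composite relative pseudomonad\<close>

context lifting
begin

definition free :: "'o \<Rightarrow> ('o, 'm, 'c) alg" where "free X = free_alg C R X"
definition Jfree :: "'o \<Rightarrow> ('p, 'n, 'd) alg" where "Jfree X = alg_image C D J R (free X)"
definition Tfree :: "'o \<Rightarrow> ('p, 'n, 'd) alg" where "Tfree X = Talg L (free X)"

text \<open>
  \<open>J\<close> of the free algebra on \<open>X\<close> has action \<open>m\<close>, but its 2-cells are composites of constraints of \<open>J\<close>
  which need not be identities. The cell \<open>twist X\<close> compares it with the free algebra on \<open>JX\<close>.
\<close>
definition twist_inv :: "'o \<Rightarrow> 'd" where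
  "twist_inv X = aassoc (Jfree X) \<lhd>\<^bsub>D\<^esub> mor S (mor S (unit S (ob J X)))"

definition twist :: "'o \<Rightarrow> 'd" where
  "twist X = inv_cell D (twist_inv X)"

abbreviation fe :: "'o \<Rightarrow> 'n \<Rightarrow> 'n" where "fe Y f \<equiv> free_ext D S (Tfree Y) f"
abbreviation fe2 :: "'o \<Rightarrow> 'd \<Rightarrow> 'd" where "fe2 Y \<alpha> \<equiv> free_ext2 D S (Tfree Y) \<alpha>"
abbreviation fs :: "'o \<Rightarrow> 'o \<Rightarrow> 'n \<Rightarrow> 'd" where "fs X Y f \<equiv> free_str D S (Tfree Y) (twist X) f"

definition TS_ext :: "'o \<Rightarrow> 'o \<Rightarrow> 'n \<Rightarrow> 'n" where
  "TS_ext X Y f = ext T (ob R X) (ob R Y) (fe Y f)"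
definition TS_ext2 :: "'o \<Rightarrow> 'o \<Rightarrow> 'd \<Rightarrow> 'd" where
  "TS_ext2 X Y \<alpha> = ext2 T (ob R X) (ob R Y) (fe2 Y \<alpha>)"
definition TS_str :: "'o \<Rightarrow> 'o \<Rightarrow> 'n \<Rightarrow> 'd" where
  "TS_str X Y f = ext_str L (free X) (free Y) (fe Y f) (fs X Y f)"

section \<open>The algebras JSX and TSX and the twist\<close>

lemma free_strict: "X \<in> Obj C \<Longrightarrow> strict_algebra C R (free X)"
  by (simp add: free_def Rm.free_alg_strict)

lemma free_aob: "aob (free X) = ob R X"
  by (simp add: free_def free_alg_def)

lemma Tfree_alg: "X \<in> Obj C \<Longrightarrow> pseudoalgebra D S (Tfree X)"
  by (simp add: Tfree_def free_strict lift_alg)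

lemma Tfree_aob: "X \<in> Obj C \<Longrightarrow> aob (Tfree X) = Tob T (ob R X)"
  by (simp add: Tfree_def free_strict lift_ob free_aob)

lemma restr_typ:
  assumes "X \<in> Obj C"
  shows "ob R X \<in> Obj C" "ob J X \<in> Obj D" "ob J (ob R X) = ob S (ob J X)"
  using assms by (simp_all add: Rm.ob_Obj ob_Obj ob_restr)

lemma phi_typ:
  assumes "f \<in> Mor C" "g \<in> Mor C" "trg C f = src C g"
  shows "D.iso (phi J g f)" "cdom D (phi J g f) = mor J g \<odot>\<^bsub>D\<^esub> mor J f"
    "ccod D (phi J g f) = mor J (g \<odot>\<^bsub>C\<^esub> f)"
  using phi_Iso[of f "src C f" "trg C f" g "trg C g"] assms
  by (auto simp: Hom_def D.IsoCells_iff)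

lemma phi0_typ:
  assumes "X \<in> Obj C"
  shows "D.iso (phi0 J X)" "cdom D (phi0 J X) = idm D (ob J X)"
    "ccod D (phi0 J X) = mor J (idm C X)"
  using phi0_Iso[of X] assms by (auto simp: D.IsoCells_iff)

text \<open>Restriction along \<open>J\<close> identifies J(m) with m and J(R m) with S(m), so the
  associativity and unit laws of the monad give each coherence cell equal domain and codomain. The
  cells are invertible as composites of constraints of \<open>J\<close> with images of
  identities.\<close>

lemma Jfree_typ:
  assumes X: "X \<in> Obj C"
  shows "aob (Jfree X) = ob S (ob J X)" "act (Jfree X) = mult S (ob J X)"
    "D.iso (aassoc (Jfree X))" "aassoc (Jfree X) \<in> Cel D"
    "cdom D (aassoc (Jfree X)) = mult S (ob J X) \<odot>\<^bsub>D\<^esub> mult S (ob S (ob J X))"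
    "ccod D (aassoc (Jfree X)) = mult S (ob J X) \<odot>\<^bsub>D\<^esub> mult S (ob S (ob J X))"
    "D.iso (aunit (Jfree X))" "aunit (Jfree X) \<in> Cel D"
    "cdom D (aunit (Jfree X)) = idm D (ob S (ob J X))"
    "ccod D (aunit (Jfree X)) = idm D (ob S (ob J X))"
proof -
  note [simp] = X restr_typ mor_restr mult_restr unit_restr phi_typ phi0_typ D.inv_cell_inverse
    Rm.monad_simps Sm.monad_simps D.iso_intros functor_simps
  show "aob (Jfree X) = ob S (ob J X)" "act (Jfree X) = mult S (ob J X)"
    by (simp_all add: Jfree_def free_def free_alg_def alg_image_def)
  show 1: "D.iso (aassoc (Jfree X))"
    "cdom D (aassoc (Jfree X)) = mult S (ob J X) \<odot>\<^bsub>D\<^esub> mult S (ob S (ob J X))"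
    "ccod D (aassoc (Jfree X)) = mult S (ob J X) \<odot>\<^bsub>D\<^esub> mult S (ob S (ob J X))"
    by (simp_all add: Jfree_def free_def free_alg_def alg_image_def)
  show 2: "D.iso (aunit (Jfree X))" "cdom D (aunit (Jfree X)) = idm D (ob S (ob J X))"
    "ccod D (aunit (Jfree X)) = idm D (ob S (ob J X))"
    by (simp_all add: Jfree_def free_def free_alg_def alg_image_def)
  show "aassoc (Jfree X) \<in> Cel D" "aunit (Jfree X) \<in> Cel D"
    using 1 2 D.iso_Cel by auto
qed

text \<open>Whiskering with SS(e) reduces the composite of m with the multiplication at SJX to m
  S(e) m = m.\<close>

lemma twist_typ:
  assumes X: "X \<in> Obj C"
  shows "D.iso (twist X)" "twist X \<in> Cel D" "cdom D (twist X) = mult S (ob J X)"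
    "ccod D (twist X) = mult S (ob J X)"
    "D.iso (twist_inv X)" "twist_inv X \<in> Cel D" "cdom D (twist_inv X) = mult S (ob J X)"
    "ccod D (twist_inv X) = mult S (ob J X)"
    "twist_inv X \<cdot>\<^bsub>D\<^esub> twist X = idc D (mult S (ob J X))"
proof -
  note [simp] = X restr_typ Jfree_typ Sm.monad_simps
  show 1: "D.iso (twist_inv X)" "twist_inv X \<in> Cel D" "cdom D (twist_inv X) = mult S (ob J X)"
    "ccod D (twist_inv X) = mult S (ob J X)"
    by (simp_all add: twist_inv_def D.iso_intros)
  show "D.iso (twist X)" "twist X \<in> Cel D" "cdom D (twist X) = mult S (ob J X)"
    "ccod D (twist X) = mult S (ob J X)" "twist_inv X \<cdot>\<^bsub>D\<^esub> twist X = idc D (mult S (ob J X))"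
    using D.inv_cell_inverse[OF 1(1)] 1 by (simp_all add: twist_def)
qed

lemma tunit_pseudomorphism:
  "X \<in> Obj C \<Longrightarrow> pseudomorphism D S (Jfree X) (Tfree X) (tunit T (ob R X)) (tunit_str L (free X))"
  using lift_tunit[OF free_strict] by (simp add: Jfree_def Tfree_def free_aob)

lemma fe_typ:
  assumes "Y \<in> Obj C" "f \<in> Mor D" "trg D f = Tob T (ob R Y)"
  shows "fe Y f \<in> Mor D" "src D (fe Y f) = ob S (src D f)" "trg D (fe Y f) = Tob T (ob R Y)"
  using Sm.free_ext_typ[OF Tfree_alg, of Y f] assms by (simp_all add: Tfree_aob)

lemma fe_pseudomorphism:
  assumes X: "X \<in> Obj C" "Y \<in> Obj C"
    and f: "f \<in> Mor D" "src D f = ob J X" "trg D f = Tob T (ob R Y)"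
  shows "pseudomorphism D S (Jfree X) (Tfree Y) (fe Y f) (fs X Y f)"
proof -
  note [simp] = X f restr_typ Jfree_typ twist_typ Tfree_aob fe_typ Sm.monad_simps
  let ?m = "mult S (ob J X)"
  \<comment> \<open>The unit of \<open>T\<close> at \<open>ob R X\<close> is lifted to a
    pseudomorphism out of \<open>Jfree X\<close>, so it can serve as the \<open>i\<close> of the
    twist lemma.\<close>
  note tw = Sm.twist[OF Tfree_alg[OF X(1)] restr_typ(2)[OF X(1)] Jfree_typ(1-3,5,6,8-10)[OF X(1)]
      tunit_pseudomorphism[OF X(1)] refl, folded twist_inv_def, folded twist_def]
  \<comment> \<open>Since SJX is J of \<open>ob R X\<close>, \<open>fe Y f\<close> is a morphism of
    the kind that \<open>T\<close> extends; \<open>tunit_faithful\<close> therefore transfers the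
    equation from the unit of \<open>T\<close> to it.\<close>
  have a: "fe Y f \<rhd>\<^bsub>D\<^esub> (aassoc (Jfree X) \<cdot>\<^bsub>D\<^esub> (twist X \<lhd>\<^bsub>D\<^esub> mor S ?m) \<cdot>\<^bsub>D\<^esub> (?m \<rhd>\<^bsub>D\<^esub> cel S (twist X)))
      = fe Y f \<rhd>\<^bsub>D\<^esub> (twist X \<lhd>\<^bsub>D\<^esub> mult S (ob S (ob J X)))"
    by (rule tunit_faithful[OF _ _ _ _ _ _ _ _ _ _ _ _ tw(1), where Y = "ob R Y" and p = "?m \<odot>\<^bsub>D\<^esub> mult S (ob S (ob J X))"])
      (simp_all)
  have b: "fe Y f \<rhd>\<^bsub>D\<^esub> (twist X \<lhd>\<^bsub>D\<^esub> unit S (ob S (ob J X))) = fe Y f \<rhd>\<^bsub>D\<^esub> aunit (Jfree X)"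
    by (rule tunit_faithful[OF _ _ _ _ _ _ _ _ _ _ _ _ tw(2), where Y = "ob R Y" and p = "idm D (ob S (ob J X))"])
      (simp_all)
  show ?thesis
    by (rule Sm.free_pseudomorphism[OF Tfree_alg[OF X(2)] f(1,2) _ Jfree_typ(1,2,4-6,8-10)[OF X(1)]
        twist_typ(1,3,4)[OF X(1)] a b]) simp
qed

lemma TS_ext_pseudomorphism:
  assumes "X \<in> Obj C" "Y \<in> Obj C" "f \<in> Mor D" "src D f = ob J X" "trg D f = Tob T (ob R Y)"
  shows "pseudomorphism D S (Tfree X) (Tfree Y) (TS_ext X Y f) (TS_str X Y f)"
  using lift_ext[OF free_strict free_strict fe_pseudomorphism[OF assms, unfolded Jfree_def Tfree_def]] assms
  by (simp add: TS_ext_def TS_str_def Tfree_def free_aob)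

lemma TS_ext_typ:
  assumes "X \<in> Obj C" "Y \<in> Obj C" "f \<in> Mor D" "src D f = ob J X" "trg D f = Tob T (ob R Y)"
  shows "TS_ext X Y f \<in> Mor D" "src D (TS_ext X Y f) = Tob T (ob R X)" "trg D (TS_ext X Y f) = Tob T (ob R Y)"
    "D.iso (TS_str X Y f)" "TS_str X Y f \<in> Cel D" "cdom D (TS_str X Y f) = act (Tfree Y) \<odot>\<^bsub>D\<^esub> mor S (TS_ext X Y f)"
    "ccod D (TS_str X Y f) = TS_ext X Y f \<odot>\<^bsub>D\<^esub> act (Tfree X)"
  using TS_ext_pseudomorphism[OF assms] assms D.iso_Cel
  by (auto simp: Sm.pseudomorphism_iff Tfree_aob)

lemma fe2_typ:
  assumes "Y \<in> Obj C" "\<alpha> \<in> Cel D" "trg D (cdom D \<alpha>) = Tob T (ob R Y)"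
  shows "fe2 Y \<alpha> \<in> Cel D" "cdom D (fe2 Y \<alpha>) = fe Y (cdom D \<alpha>)" "ccod D (fe2 Y \<alpha>) = fe Y (ccod D \<alpha>)"
  using assms
  by (simp_all add: free_ext2_def free_ext_def Sm.monad_simps pseudoalgebra.alg_typ[OF Tfree_alg] Tfree_aob)

text \<open>Naturality of the new \<mu> in g rests on this: the structure cells of the extensions of
  g^S vary naturally with g.\<close>

lemma TS_ext2_cell:
  assumes X: "X \<in> Obj C" "Y \<in> Obj C" and \<alpha>: "\<alpha> \<in> Cel D" "cdom D \<alpha> = f" "ccod D \<alpha> = f'"
    and f: "src D f = ob J X" "trg D f = Tob T (ob R Y)"
  shows "algebra_cell D S (Tfree X) (Tfree Y) (TS_ext X Y f) (TS_str X Y f) (TS_ext X Y f') (TS_str X Y f')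
    (TS_ext2 X Y \<alpha>)"
proof -
  have f': "f \<in> Mor D" "f' \<in> Mor D" "src D f' = ob J X" "trg D f' = Tob T (ob R Y)"
    using D.cell_typ[of \<alpha>] \<alpha> f by auto
  have "algebra_cell D S (Jfree X) (Tfree Y) (fe Y f) (fs X Y f) (fe Y f') (fs X Y f') (fe2 Y \<alpha>)"
    by (rule Sm.free_algebra_cell) (use X \<alpha> f in \<open>simp_all add: Tfree_alg Tfree_aob Jfree_typ twist_typ\<close>)
  then show ?thesis
    using lift_ext2[OF free_strict[OF X(1)] free_strict[OF X(2)], folded Jfree_def Tfree_def,
        OF fe_pseudomorphism[OF X f'(1) f] fe_pseudomorphism[OF X f'(2-4)]]
    by (simp add: TS_ext_def TS_ext2_def TS_str_def free_aob)
qed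

lemma comparison_cell:
  assumes X: "X \<in> Obj C" "Y \<in> Obj C" "Z \<in> Obj C"
    and f: "f \<in> Mor D" "src D f = ob J X" "trg D f = Tob T (ob R Y)"
    and g: "g \<in> Mor D" "src D g = ob J Y" "trg D g = Tob T (ob R Z)"
  shows "algebra_cell D S (Jfree X) (Tfree Z) (fe Z (TS_ext Y Z g \<odot>\<^bsub>D\<^esub> f)) (fs X Z (TS_ext Y Z g \<odot>\<^bsub>D\<^esub> f))
    (TS_ext Y Z g \<odot>\<^bsub>D\<^esub> fe Y f) (comp_str D S (TS_ext Y Z g) (TS_str Y Z g) (fe Y f) (fs X Y f))
    (TS_str Y Z g \<lhd>\<^bsub>D\<^esub> mor S f)"
  by (rule Sm.free_comparison[OF Tfree_alg Tfree_alg TS_ext_pseudomorphism])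
    (use X f g in \<open>simp_all add: Tfree_aob Jfree_typ twist_typ\<close>)

section \<open>The data of the composite: \<mu>, then \<eta>, i and \<theta>\<close>

definition comparison :: "'o \<Rightarrow> 'o \<Rightarrow> 'n \<Rightarrow> 'n \<Rightarrow> 'd" where
  "comparison Y Z g f = TS_str Y Z g \<lhd>\<^bsub>D\<^esub> mor S f"

definition TS_mu :: "'o \<Rightarrow> 'o \<Rightarrow> 'o \<Rightarrow> 'n \<Rightarrow> 'n \<Rightarrow> 'd" where
  "TS_mu X Y Z g f = mu T (ob R X) (ob R Y) (ob R Z) (fe Z g) (fe Y f) \<cdot>\<^bsub>D\<^esub>
    ext2 T (ob R X) (ob R Z) (comparison Y Z g f)"

text \<open>Both factors are algebra 2-cells, the extended comparison by \<open>lift_ext2\<close>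
  and \<mu> by \<open>lift_mu\<close>. Associativity needs this for the pair h, g, where the new
  \<mu> is whiskered with f and then extended.\<close>

lemma TS_mu_cell:
  assumes X: "X \<in> Obj C" "Y \<in> Obj C" "Z \<in> Obj C"
    and f: "f \<in> Mor D" "src D f = ob J X" "trg D f = Tob T (ob R Y)"
    and g: "g \<in> Mor D" "src D g = ob J Y" "trg D g = Tob T (ob R Z)"
  shows "algebra_cell D S (Tfree X) (Tfree Z)
    (TS_ext X Z (TS_ext Y Z g \<odot>\<^bsub>D\<^esub> f)) (TS_str X Z (TS_ext Y Z g \<odot>\<^bsub>D\<^esub> f))
    (TS_ext Y Z g \<odot>\<^bsub>D\<^esub> TS_ext X Y f) (comp_str D S (TS_ext Y Z g) (TS_str Y Z g) (TS_ext X Y f) (TS_str X Y f))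
    (TS_mu X Y Z g f)"
proof -
  note [simp] = X f g restr_typ Jfree_typ twist_typ Tfree_aob Tfree_alg fe_typ TS_ext_typ Sm.monad_simps pseudoalgebra.alg_typ[OF Tfree_alg]
  let ?gf = "TS_ext Y Z g \<odot>\<^bsub>D\<^esub> f"
  have gf [simp]: "?gf \<in> Mor D" "src D ?gf = ob J X" "trg D ?gf = Tob T (ob R Z)"
    by simp_all
  let ?u = "comp_str D S (TS_ext Y Z g) (TS_str Y Z g) (fe Y f) (fs X Y f)"
  note ps = fe_pseudomorphism[OF X(1,2) f] fe_pseudomorphism[OF X(2,3) g] fe_pseudomorphism[OF X(1,3) gf]
  \<comment> \<open>The extension of this composite pseudomorphism is the middle term between the
    two factors. Its structure cell \<open>?u\<close> is at once the target in
    \<open>comparison_cell\<close> and the one prescribed by \<open>lift_mu\<close>.\<close>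
  have c: "pseudomorphism D S (Jfree X) (Tfree Z) (TS_ext Y Z g \<odot>\<^bsub>D\<^esub> fe Y f) ?u"
    by (rule Sm.comp_pseudomorphism[OF Tfree_alg Tfree_alg _ _ _ _ _ _ _ _ _ _ ps(1) TS_ext_pseudomorphism[OF X(2,3) g]])
      simp_all
  note e = lift_ext[OF free_strict[OF X(1)] free_strict[OF X(3)] c[unfolded Jfree_def Tfree_def], folded Tfree_def]
  have 1: "algebra_cell D S (Tfree X) (Tfree Z) (TS_ext X Z ?gf) (TS_str X Z ?gf)
     (ext T (ob R X) (ob R Z) (TS_ext Y Z g \<odot>\<^bsub>D\<^esub> fe Y f)) (ext_str L (free X) (free Z) (TS_ext Y Z g \<odot>\<^bsub>D\<^esub> fe Y f) ?u)
     (ext2 T (ob R X) (ob R Z) (TS_str Y Z g \<lhd>\<^bsub>D\<^esub> mor S f))"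
    using lift_ext2[OF free_strict[OF X(1)] free_strict[OF X(3)], folded Jfree_def Tfree_def, OF ps(3) c
        comparison_cell[OF X f g]]
    by (simp add: free_aob TS_ext_def TS_str_def)
  have 2: "algebra_cell D S (Tfree X) (Tfree Z)
     (ext T (ob R X) (ob R Z) (TS_ext Y Z g \<odot>\<^bsub>D\<^esub> fe Y f)) (ext_str L (free X) (free Z) (TS_ext Y Z g \<odot>\<^bsub>D\<^esub> fe Y f) ?u)
     (TS_ext Y Z g \<odot>\<^bsub>D\<^esub> TS_ext X Y f) (comp_str D S (TS_ext Y Z g) (TS_str Y Z g) (TS_ext X Y f) (TS_str X Y f))
     (mu T (ob R X) (ob R Y) (ob R Z) (fe Z g) (fe Y f))"
    using lift_mu[OF free_strict[OF X(1)] free_strict[OF X(2)] free_strict[OF X(3)], folded Jfree_def Tfree_def, OF ps(1,2)]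
    by (simp add: free_aob TS_ext_def TS_str_def)
  have e': "ext_str L (free X) (free Z) (TS_ext Y Z g \<odot>\<^bsub>D\<^esub> fe Y f) ?u \<in> Cel D"
    "cdom D (ext_str L (free X) (free Z) (TS_ext Y Z g \<odot>\<^bsub>D\<^esub> fe Y f) ?u)
       = act (Tfree Z) \<odot>\<^bsub>D\<^esub> mor S (ext T (ob R X) (ob R Z) (TS_ext Y Z g \<odot>\<^bsub>D\<^esub> fe Y f))"
    "ccod D (ext_str L (free X) (free Z) (TS_ext Y Z g \<odot>\<^bsub>D\<^esub> fe Y f) ?u)
       = ext T (ob R X) (ob R Z) (TS_ext Y Z g \<odot>\<^bsub>D\<^esub> fe Y f) \<odot>\<^bsub>D\<^esub> act (Tfree X)"
    using e D.iso_Cel unfolding Sm.pseudomorphism_iff free_aob by auto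
  show ?thesis
    unfolding TS_mu_def comparison_def
    by (rule Sm.algebra_cell_vcomp[OF _ _ _ _ _ _ _ _ _ _ e' _ _ _ 1 2]) (simp_all add: comp_str_def)
qed

text \<open>With b the action on TSY, this is f \<Rightarrow> b e f = b S(f) e followed by \<eta> of
  b S(f) whiskered with e. The equality is naturality of the unit of \<open>S\<close>.\<close>

definition TS_eta :: "'o \<Rightarrow> 'o \<Rightarrow> 'n \<Rightarrow> 'd" where
  "TS_eta X Y f = (eta T (ob R X) (ob R Y) (fe Y f) \<lhd>\<^bsub>D\<^esub> unit S (ob J X)) \<cdot>\<^bsub>D\<^esub> (aunit (Tfree Y) \<lhd>\<^bsub>D\<^esub> f)"

definition TS_tunit :: "'o \<Rightarrow> 'n" where
  "TS_tunit X = tunit T (ob R X) \<odot>\<^bsub>D\<^esub> unit S (ob J X)"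

text \<open>The structure cell of i, whiskered with S(e), goes from b S(i e) to i m S(e) = i. The
  factor with \<open>twist_inv\<close> is an automorphism of i; it compensates for the twist built
  into \<open>fs\<close>, as the unit law requires.\<close>

definition tunit_comparison :: "'o \<Rightarrow> 'd" where
  "tunit_comparison X = (tunit T (ob R X) \<rhd>\<^bsub>D\<^esub> (twist_inv X \<lhd>\<^bsub>D\<^esub> mor S (unit S (ob J X)))) \<cdot>\<^bsub>D\<^esub>
    (tunit_str L (free X) \<lhd>\<^bsub>D\<^esub> mor S (unit S (ob J X)))"

definition TS_theta :: "'o \<Rightarrow> 'd" where
  "TS_theta X = theta T (ob R X) \<cdot>\<^bsub>D\<^esub> ext2 T (ob R X) (ob R X) (tunit_comparison X)"

definition TS_psmnd :: "('o, 'p, 'n, 'd) rel_psmnd" where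
  "TS_psmnd = \<lparr> Tob = (\<lambda>X. Tob T (ob R X)), ext = TS_ext, ext2 = TS_ext2, tunit = TS_tunit,
    mu = TS_mu, eta = TS_eta, theta = TS_theta \<rparr>"

lemma tunit_str_typ:
  assumes "X \<in> Obj C"
  shows "D.iso (tunit_str L (free X))" "tunit_str L (free X) \<in> Cel D"
    "cdom D (tunit_str L (free X)) = act (Tfree X) \<odot>\<^bsub>D\<^esub> mor S (tunit T (ob R X))"
    "ccod D (tunit_str L (free X)) = tunit T (ob R X) \<odot>\<^bsub>D\<^esub> mult S (ob J X)"
  using tunit_pseudomorphism[OF assms] D.iso_Cel unfolding Sm.pseudomorphism_iff
  by (auto simp: Jfree_typ[OF assms])

lemma TS_tunit_typ:
  assumes "X \<in> Obj C"
  shows "TS_tunit X \<in> Mor D" "src D (TS_tunit X) = ob J X" "trg D (TS_tunit X) = Tob T (ob R X)"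
  using assms by (simp_all add: TS_tunit_def restr_typ ext_simps Sm.monad_simps)

lemma TS_ext2_typ:
  assumes "X \<in> Obj C" "Y \<in> Obj C" "\<alpha> \<in> Cel D" "src D (cdom D \<alpha>) = ob J X"
    "trg D (cdom D \<alpha>) = Tob T (ob R Y)"
  shows "TS_ext2 X Y \<alpha> \<in> Cel D" "cdom D (TS_ext2 X Y \<alpha>) = TS_ext X Y (cdom D \<alpha>)"
    "ccod D (TS_ext2 X Y \<alpha>) = TS_ext X Y (ccod D \<alpha>)"
  using assms by (simp_all add: TS_ext2_def TS_ext_def ext_simps fe2_typ fe_typ restr_typ D.category_simps)

lemmas lifting_simps = restr_typ Jfree_typ twist_typ Tfree_aob Tfree_alg fe_typ fe2_typ TS_ext_typ TS_ext2_typ TS_tunit_typ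
  tunit_str_typ ext_simps Sm.monad_simps pseudoalgebra.alg_typ[OF Tfree_alg]

lemma comparison_typ:
  assumes X: "Y \<in> Obj C" "Z \<in> Obj C"
    and f: "f \<in> Mor D" "trg D f = Tob T (ob R Y)"
    and g: "g \<in> Mor D" "src D g = ob J Y" "trg D g = Tob T (ob R Z)"
  shows "D.iso (comparison Y Z g f)" "comparison Y Z g f \<in> Cel D"
    "cdom D (comparison Y Z g f) = fe Z (TS_ext Y Z g \<odot>\<^bsub>D\<^esub> f)"
    "ccod D (comparison Y Z g f) = TS_ext Y Z g \<odot>\<^bsub>D\<^esub> fe Y f"
  using X f g by (simp_all add: lifting_simps D.iso_intros comparison_def free_ext_def)

lemma ext_free: "ext T (ob R X) (ob R Y) (fe Y f) = TS_ext X Y f"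
  "ext2 T (ob R X) (ob R Y) (fe2 Y \<alpha>) = TS_ext2 X Y \<alpha>"
  by (simp_all add: TS_ext_def TS_ext2_def)

section \<open>Naturality and associativity of the new multiplication\<close>

lemma TS_mu_typ:
  assumes X: "X \<in> Obj C" "Y \<in> Obj C" "Z \<in> Obj C"
    and f: "f \<in> Mor D" "src D f = ob J X" "trg D f = Tob T (ob R Y)"
    and g: "g \<in> Mor D" "src D g = ob J Y" "trg D g = Tob T (ob R Z)"
  shows "D.iso (TS_mu X Y Z g f)" "TS_mu X Y Z g f \<in> Cel D"
    "cdom D (TS_mu X Y Z g f) = TS_ext X Z (TS_ext Y Z g \<odot>\<^bsub>D\<^esub> f)"
    "ccod D (TS_mu X Y Z g f) = TS_ext Y Z g \<odot>\<^bsub>D\<^esub> TS_ext X Y f"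
  using X f g by (simp_all add: TS_mu_def lifting_simps D.iso_intros iso_ext2 comparison_typ ext_free)

lemma TS_mu_natural:
  assumes X: "X \<in> Obj C" "Y \<in> Obj C" "Z \<in> Obj C"
    and f: "f \<in> Mor D" "src D f = ob J X" "trg D f = Tob T (ob R Y)"
    and g: "g \<in> Mor D" "src D g = ob J Y" "trg D g = Tob T (ob R Z)"
    and \<alpha>: "\<alpha> \<in> Cel D" "cdom D \<alpha> = f" "ccod D \<alpha> = f'"
    and \<beta>: "\<beta> \<in> Cel D" "cdom D \<beta> = g" "ccod D \<beta> = g'"
  shows "TS_mu X Y Z g' f' \<cdot>\<^bsub>D\<^esub> TS_ext2 X Z (TS_ext2 Y Z \<beta> \<star>\<^bsub>D\<^esub> \<alpha>)
      = (TS_ext2 Y Z \<beta> \<star>\<^bsub>D\<^esub> TS_ext2 X Y \<alpha>) \<cdot>\<^bsub>D\<^esub> TS_mu X Y Z g f"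
proof -
  have f': "f' \<in> Mor D" "src D f' = ob J X" "trg D f' = Tob T (ob R Y)"
    using D.cell_typ[of \<alpha>] \<alpha> f by auto
  have g': "g' \<in> Mor D" "src D g' = ob J Y" "trg D g' = Tob T (ob R Z)"
    using D.cell_typ[of \<beta>] \<beta> g by auto
  note [simp] = X f g f' g' \<alpha> \<beta> lifting_simps D.hcomp_whisk comparison_typ ext_free
  let ?E2 = "ext2 T (ob R X) (ob R Z)"
  let ?c = "act (Tfree Z)" and ?a = "act (Tfree Y)"
  let ?\<mu> = "mu T (ob R X) (ob R Y) (ob R Z)"
  have cell: "TS_str Y Z g' \<cdot>\<^bsub>D\<^esub> (?c \<rhd>\<^bsub>D\<^esub> cel S (TS_ext2 Y Z \<beta>)) = (TS_ext2 Y Z \<beta> \<lhd>\<^bsub>D\<^esub> ?a) \<cdot>\<^bsub>D\<^esub> TS_str Y Z g"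
    using TS_ext2_cell[OF X(2,3) \<beta> g(2,3)] by (simp add: Sm.algebra_cell_iff)
  have ex: "(TS_str Y Z g \<lhd>\<^bsub>D\<^esub> mor S f') \<cdot>\<^bsub>D\<^esub> ((?c \<odot>\<^bsub>D\<^esub> mor S (TS_ext Y Z g)) \<rhd>\<^bsub>D\<^esub> cel S \<alpha>)
      = ((TS_ext Y Z g \<odot>\<^bsub>D\<^esub> ?a) \<rhd>\<^bsub>D\<^esub> cel S \<alpha>) \<cdot>\<^bsub>D\<^esub> (TS_str Y Z g \<lhd>\<^bsub>D\<^esub> mor S f)"
    using D.whisk_exchange[of "cel S \<alpha>" "TS_str Y Z g"] by simp
  \<comment> \<open>The comparison is natural in both variables: \<open>cell\<close> moves \<beta>
    across the structure cell, and the interchange \<open>ex\<close> moves \<alpha>. Naturality of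
    the old \<mu> does the rest.\<close>
  have "comparison Y Z g' f' \<cdot>\<^bsub>D\<^esub> fe2 Z (TS_ext2 Y Z \<beta> \<star>\<^bsub>D\<^esub> \<alpha>)
    = ((TS_str Y Z g' \<cdot>\<^bsub>D\<^esub> (?c \<rhd>\<^bsub>D\<^esub> cel S (TS_ext2 Y Z \<beta>))) \<lhd>\<^bsub>D\<^esub> mor S f') \<cdot>\<^bsub>D\<^esub>
       ((?c \<odot>\<^bsub>D\<^esub> mor S (TS_ext Y Z g)) \<rhd>\<^bsub>D\<^esub> cel S \<alpha>)"
    by (simp add: free_ext2_def comparison_def)
  also have "\<dots> = (TS_ext2 Y Z \<beta> \<lhd>\<^bsub>D\<^esub> (?a \<odot>\<^bsub>D\<^esub> mor S f')) \<cdot>\<^bsub>D\<^esub>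
       ((TS_str Y Z g \<lhd>\<^bsub>D\<^esub> mor S f') \<cdot>\<^bsub>D\<^esub> ((?c \<odot>\<^bsub>D\<^esub> mor S (TS_ext Y Z g)) \<rhd>\<^bsub>D\<^esub> cel S \<alpha>))"
    unfolding cell by simp
  also have "\<dots> = (TS_ext2 Y Z \<beta> \<lhd>\<^bsub>D\<^esub> fe Y f') \<cdot>\<^bsub>D\<^esub> (TS_ext Y Z g \<rhd>\<^bsub>D\<^esub> fe2 Y \<alpha>) \<cdot>\<^bsub>D\<^esub> comparison Y Z g f"
    unfolding ex by (simp add: free_ext_def free_ext2_def comparison_def)
  finally have 1: "comparison Y Z g' f' \<cdot>\<^bsub>D\<^esub> fe2 Z (TS_ext2 Y Z \<beta> \<star>\<^bsub>D\<^esub> \<alpha>)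
    = (TS_ext2 Y Z \<beta> \<lhd>\<^bsub>D\<^esub> fe Y f') \<cdot>\<^bsub>D\<^esub> (TS_ext Y Z g \<rhd>\<^bsub>D\<^esub> fe2 Y \<alpha>) \<cdot>\<^bsub>D\<^esub> comparison Y Z g f" .
  have mr: "?\<mu> (fe Z g') (fe Y f') \<cdot>\<^bsub>D\<^esub> ?E2 (TS_ext2 Y Z \<beta> \<lhd>\<^bsub>D\<^esub> fe Y f')
    = (TS_ext2 Y Z \<beta> \<lhd>\<^bsub>D\<^esub> TS_ext X Y f') \<cdot>\<^bsub>D\<^esub> ?\<mu> (fe Z g) (fe Y f')"
    using mu_natural_right[of "ob R X" "ob R Y" "ob R Z" "fe Y f'" "fe2 Z \<beta>" "fe Z g" "fe Z g'"] by simp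
  have ml: "?\<mu> (fe Z g) (fe Y f') \<cdot>\<^bsub>D\<^esub> ?E2 (TS_ext Y Z g \<rhd>\<^bsub>D\<^esub> fe2 Y \<alpha>)
    = (TS_ext Y Z g \<rhd>\<^bsub>D\<^esub> TS_ext2 X Y \<alpha>) \<cdot>\<^bsub>D\<^esub> ?\<mu> (fe Z g) (fe Y f)"
    using mu_natural_left[of "ob R X" "ob R Y" "ob R Z" "fe2 Y \<alpha>" "fe Y f" "fe Y f'" "fe Z g"] by simp
  have "TS_mu X Y Z g' f' \<cdot>\<^bsub>D\<^esub> TS_ext2 X Z (TS_ext2 Y Z \<beta> \<star>\<^bsub>D\<^esub> \<alpha>)
    = ?\<mu> (fe Z g') (fe Y f') \<cdot>\<^bsub>D\<^esub> ?E2 (comparison Y Z g' f' \<cdot>\<^bsub>D\<^esub> fe2 Z (TS_ext2 Y Z \<beta> \<star>\<^bsub>D\<^esub> \<alpha>))"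
    by (simp add: TS_mu_def)
  also have "\<dots> = (?\<mu> (fe Z g') (fe Y f') \<cdot>\<^bsub>D\<^esub> ?E2 (TS_ext2 Y Z \<beta> \<lhd>\<^bsub>D\<^esub> fe Y f')) \<cdot>\<^bsub>D\<^esub>
     ?E2 (TS_ext Y Z g \<rhd>\<^bsub>D\<^esub> fe2 Y \<alpha>) \<cdot>\<^bsub>D\<^esub> ?E2 (comparison Y Z g f)"
    unfolding 1 by simp
  also have "\<dots> = (TS_ext2 Y Z \<beta> \<lhd>\<^bsub>D\<^esub> TS_ext X Y f') \<cdot>\<^bsub>D\<^esub>
     (?\<mu> (fe Z g) (fe Y f') \<cdot>\<^bsub>D\<^esub> ?E2 (TS_ext Y Z g \<rhd>\<^bsub>D\<^esub> fe2 Y \<alpha>)) \<cdot>\<^bsub>D\<^esub> ?E2 (comparison Y Z g f)"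
    unfolding mr by simp
  also have "\<dots> = (TS_ext2 Y Z \<beta> \<star>\<^bsub>D\<^esub> TS_ext2 X Y \<alpha>) \<cdot>\<^bsub>D\<^esub> TS_mu X Y Z g f"
    unfolding ml by (simp add: TS_mu_def)
  finally show ?thesis .
qed

lemma TS_mu_assoc:
  assumes X: "X \<in> Obj C" "Y \<in> Obj C" "Z \<in> Obj C" "V \<in> Obj C"
    and f: "f \<in> Mor D" "src D f = ob J X" "trg D f = Tob T (ob R Y)"
    and g: "g \<in> Mor D" "src D g = ob J Y" "trg D g = Tob T (ob R Z)"
    and h: "h \<in> Mor D" "src D h = ob J Z" "trg D h = Tob T (ob R V)"
  shows "(TS_ext Z V h \<rhd>\<^bsub>D\<^esub> TS_mu X Y Z g f) \<cdot>\<^bsub>D\<^esub> TS_mu X Z V h (TS_ext Y Z g \<odot>\<^bsub>D\<^esub> f)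
          \<cdot>\<^bsub>D\<^esub> TS_ext2 X V (TS_mu Y Z V h g \<lhd>\<^bsub>D\<^esub> f)
      = (TS_mu Y Z V h g \<lhd>\<^bsub>D\<^esub> TS_ext X Y f) \<cdot>\<^bsub>D\<^esub> TS_mu X Y V (TS_ext Z V h \<odot>\<^bsub>D\<^esub> g) f"
proof -
  note [simp] = X f g h lifting_simps TS_mu_typ comparison_typ ext_free
  let ?E2 = "ext2 T (ob R X) (ob R V)"
  let ?F = "fe Y f" and ?G = "fe Z g" and ?H = "fe V h"
  let ?F' = "TS_ext X Y f" and ?G' = "TS_ext Y Z g" and ?H' = "TS_ext Z V h"
  let ?gf = "?G' \<odot>\<^bsub>D\<^esub> f" and ?hg = "?H' \<odot>\<^bsub>D\<^esub> g"
  let ?a = "act (Tfree Y)" and ?c = "act (Tfree V)"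
  let ?\<mu>gf = "mu T (ob R X) (ob R Y) (ob R Z) ?G ?F"
    and ?\<mu>hg = "mu T (ob R Y) (ob R Z) (ob R V) ?H ?G"
  let ?\<mu>h = "mu T (ob R X) (ob R Z) (ob R V) ?H"
    and ?\<mu>f = "\<lambda>k. mu T (ob R X) (ob R Y) (ob R V) k ?F"
  let ?\<rho>gf = "comparison Y Z g f" and ?\<rho>hg = "comparison Z V h g"
    and ?\<rho>h = "comparison Z V h ?gf" and ?\<rho>f = "comparison Y V ?hg f"
  let ?\<rho>hg' = "ext2 T (ob R Y) (ob R V) ?\<rho>hg"
  have "comp_str D S ?H' (TS_str Z V h) ?G' (TS_str Y Z g) \<cdot>\<^bsub>D\<^esub> (?c \<rhd>\<^bsub>D\<^esub> cel S (TS_mu Y Z V h g))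
     = (TS_mu Y Z V h g \<lhd>\<^bsub>D\<^esub> ?a) \<cdot>\<^bsub>D\<^esub> TS_str Y V ?hg"
    using TS_mu_cell[OF X(2-4) g h] by (simp add: Sm.algebra_cell_iff)
  note cell = arg_cong[OF this, of "\<lambda>x. x \<lhd>\<^bsub>D\<^esub> mor S f"]
  \<comment> \<open>This is the coherence of the comparisons for three composable morphisms. It is
    the algebra 2-cell condition for the new \<mu> of h and g, whiskered with S(f).\<close>
  have I: "(?H' \<rhd>\<^bsub>D\<^esub> ?\<rho>gf) \<cdot>\<^bsub>D\<^esub> ?\<rho>h \<cdot>\<^bsub>D\<^esub> fe2 V (TS_mu Y Z V h g \<lhd>\<^bsub>D\<^esub> f)
     = (TS_mu Y Z V h g \<lhd>\<^bsub>D\<^esub> ?F) \<cdot>\<^bsub>D\<^esub> ?\<rho>f"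
    using cell by (simp add: free_ext_def free_ext2_def comp_str_def comparison_def)
  have nl: "(?H' \<rhd>\<^bsub>D\<^esub> ext2 T (ob R X) (ob R Z) ?\<rho>gf) \<cdot>\<^bsub>D\<^esub> ?\<mu>h (fe Z ?gf)
      = ?\<mu>h (?G' \<odot>\<^bsub>D\<^esub> ?F) \<cdot>\<^bsub>D\<^esub> ?E2 (?H' \<rhd>\<^bsub>D\<^esub> ?\<rho>gf)"
    using mu_natural_left[of "ob R X" "ob R Z" "ob R V" ?\<rho>gf "fe Z ?gf" "?G' \<odot>\<^bsub>D\<^esub> ?F" ?H] by simp
  have nr: "?\<mu>f (?H' \<odot>\<^bsub>D\<^esub> ?G) \<cdot>\<^bsub>D\<^esub> ?E2 (?\<rho>hg' \<lhd>\<^bsub>D\<^esub> ?F) = (?\<rho>hg' \<lhd>\<^bsub>D\<^esub> ?F') \<cdot>\<^bsub>D\<^esub> ?\<mu>f (fe V ?hg)"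
    using mu_natural_right[of "ob R X" "ob R Y" "ob R V" ?F ?\<rho>hg "fe V ?hg" "?H' \<odot>\<^bsub>D\<^esub> ?G"] by simp
  have assoc: "(?H' \<rhd>\<^bsub>D\<^esub> ?\<mu>gf) \<cdot>\<^bsub>D\<^esub> ?\<mu>h (?G' \<odot>\<^bsub>D\<^esub> ?F) \<cdot>\<^bsub>D\<^esub> ?E2 (?\<mu>hg \<lhd>\<^bsub>D\<^esub> ?F)
      = (?\<mu>hg \<lhd>\<^bsub>D\<^esub> ?F') \<cdot>\<^bsub>D\<^esub> ?\<mu>f (?H' \<odot>\<^bsub>D\<^esub> ?G)"
    using mu_assoc[of "ob R X" "ob R Y" "ob R Z" "ob R V" ?F ?G ?H] by (simp add: Hom_def)
  \<comment> \<open>Naturality of \<mu> first collects the comparisons under one extension, where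
    \<open>I\<close> rewrites them. The associativity of \<open>T\<close> at f^S, g^S and h^S then
    applies to what remains outside.\<close>
  have "(?H' \<rhd>\<^bsub>D\<^esub> TS_mu X Y Z g f) \<cdot>\<^bsub>D\<^esub> TS_mu X Z V h ?gf \<cdot>\<^bsub>D\<^esub> TS_ext2 X V (TS_mu Y Z V h g \<lhd>\<^bsub>D\<^esub> f)
    = (?H' \<rhd>\<^bsub>D\<^esub> ?\<mu>gf) \<cdot>\<^bsub>D\<^esub> ((?H' \<rhd>\<^bsub>D\<^esub> ext2 T (ob R X) (ob R Z) ?\<rho>gf) \<cdot>\<^bsub>D\<^esub> ?\<mu>h (fe Z ?gf)) \<cdot>\<^bsub>D\<^esub>
       ?E2 ?\<rho>h \<cdot>\<^bsub>D\<^esub> TS_ext2 X V (TS_mu Y Z V h g \<lhd>\<^bsub>D\<^esub> f)"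
    by (simp add: TS_mu_def[of X])
  also have "\<dots> = (?H' \<rhd>\<^bsub>D\<^esub> ?\<mu>gf) \<cdot>\<^bsub>D\<^esub> ?\<mu>h (?G' \<odot>\<^bsub>D\<^esub> ?F) \<cdot>\<^bsub>D\<^esub>
       ?E2 ((?H' \<rhd>\<^bsub>D\<^esub> ?\<rho>gf) \<cdot>\<^bsub>D\<^esub> ?\<rho>h \<cdot>\<^bsub>D\<^esub> fe2 V (TS_mu Y Z V h g \<lhd>\<^bsub>D\<^esub> f))"
    unfolding nl by simp
  also have "\<dots> = ((?H' \<rhd>\<^bsub>D\<^esub> ?\<mu>gf) \<cdot>\<^bsub>D\<^esub> ?\<mu>h (?G' \<odot>\<^bsub>D\<^esub> ?F) \<cdot>\<^bsub>D\<^esub> ?E2 (?\<mu>hg \<lhd>\<^bsub>D\<^esub> ?F)) \<cdot>\<^bsub>D\<^esub>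
       ?E2 (?\<rho>hg' \<lhd>\<^bsub>D\<^esub> ?F) \<cdot>\<^bsub>D\<^esub> ?E2 ?\<rho>f"
    unfolding I by (simp add: TS_mu_def)
  also have "\<dots> = (?\<mu>hg \<lhd>\<^bsub>D\<^esub> ?F') \<cdot>\<^bsub>D\<^esub> (?\<mu>f (?H' \<odot>\<^bsub>D\<^esub> ?G) \<cdot>\<^bsub>D\<^esub> ?E2 (?\<rho>hg' \<lhd>\<^bsub>D\<^esub> ?F)) \<cdot>\<^bsub>D\<^esub> ?E2 ?\<rho>f"
    unfolding assoc by simp
  also have "\<dots> = (TS_mu Y Z V h g \<lhd>\<^bsub>D\<^esub> ?F') \<cdot>\<^bsub>D\<^esub> TS_mu X Y V ?hg f"
    unfolding nr by (simp add: TS_mu_def)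
  finally show ?thesis .
qed

section \<open>Naturality of the new \<eta> and the unit law\<close>

lemma tunit_comparison_typ:
  assumes X: "X \<in> Obj C"
  shows "D.iso (tunit_comparison X)" "tunit_comparison X \<in> Cel D" "cdom D (tunit_comparison X) = fe X (TS_tunit X)"
    "ccod D (tunit_comparison X) = tunit T (ob R X)"
  using X by (simp_all add: lifting_simps D.iso_intros tunit_comparison_def TS_tunit_def free_ext_def)

lemma TS_theta_typ:
  assumes X: "X \<in> Obj C"
  shows "D.iso (TS_theta X)" "TS_theta X \<in> Cel D" "cdom D (TS_theta X) = TS_ext X X (TS_tunit X)"
    "ccod D (TS_theta X) = idm D (Tob T (ob R X))"
  using X by (simp_all add: lifting_simps D.iso_intros iso_ext2 tunit_comparison_typ TS_theta_def ext_free)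

lemma TS_eta_typ:
  assumes X: "X \<in> Obj C" "Y \<in> Obj C"
    and f: "f \<in> Mor D" "src D f = ob J X" "trg D f = Tob T (ob R Y)"
  shows "D.iso (TS_eta X Y f)" "TS_eta X Y f \<in> Cel D" "cdom D (TS_eta X Y f) = f"
    "ccod D (TS_eta X Y f) = TS_ext X Y f \<odot>\<^bsub>D\<^esub> TS_tunit X"
proof -
  have "fe Y f \<odot>\<^bsub>D\<^esub> unit S (ob J X) = act (Tfree Y) \<odot>\<^bsub>D\<^esub> unit S (Tob T (ob R Y)) \<odot>\<^bsub>D\<^esub> f"
    using X f by (simp add: free_ext_def lifting_simps)
  then show "D.iso (TS_eta X Y f)" "TS_eta X Y f \<in> Cel D" "cdom D (TS_eta X Y f) = f"
    "ccod D (TS_eta X Y f) = TS_ext X Y f \<odot>\<^bsub>D\<^esub> TS_tunit X"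
    using X f by (simp_all add: lifting_simps D.iso_intros TS_eta_def TS_tunit_def ext_free)
qed

lemma TS_eta_natural:
  assumes X: "X \<in> Obj C" "Y \<in> Obj C"
    and f: "f \<in> Mor D" "src D f = ob J X" "trg D f = Tob T (ob R Y)"
    and \<alpha>: "\<alpha> \<in> Cel D" "cdom D \<alpha> = f" "ccod D \<alpha> = f'"
  shows "TS_eta X Y f' \<cdot>\<^bsub>D\<^esub> \<alpha> = (TS_ext2 X Y \<alpha> \<lhd>\<^bsub>D\<^esub> TS_tunit X) \<cdot>\<^bsub>D\<^esub> TS_eta X Y f"
proof -
  have f': "f' \<in> Mor D" "src D f' = ob J X" "trg D f' = Tob T (ob R Y)"
    using D.cell_typ[of \<alpha>] \<alpha> f by auto
  note [simp] = X f f' \<alpha> lifting_simps ext_free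
  let ?b = "act (Tfree Y)" and ?\<nu> = "aunit (Tfree Y)" and ?e = "unit S (ob J X)"
  let ?\<eta> = "eta T (ob R X) (ob R Y)"
  have c: "fe Y k \<odot>\<^bsub>D\<^esub> ?e = ?b \<odot>\<^bsub>D\<^esub> unit S (Tob T (ob R Y)) \<odot>\<^bsub>D\<^esub> k"
    if "k \<in> Mor D" "src D k = ob J X" "trg D k = Tob T (ob R Y)" for k
    using that by (simp add: free_ext_def)
  note [simp] = c[OF f] c[OF f']
  have ex: "(?\<nu> \<lhd>\<^bsub>D\<^esub> f') \<cdot>\<^bsub>D\<^esub> \<alpha> = (fe2 Y \<alpha> \<lhd>\<^bsub>D\<^esub> ?e) \<cdot>\<^bsub>D\<^esub> (?\<nu> \<lhd>\<^bsub>D\<^esub> f)"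
    using D.whisk_exchange[of \<alpha> ?\<nu>] D.lwhisk_comp[of \<alpha> "unit S (Tob T (ob R Y))" ?b]
    by (simp add: Sm.unit_cell free_ext2_def)
  have en: "?\<eta> (fe Y f') \<cdot>\<^bsub>D\<^esub> fe2 Y \<alpha> = (TS_ext2 X Y \<alpha> \<lhd>\<^bsub>D\<^esub> tunit T (ob R X)) \<cdot>\<^bsub>D\<^esub> ?\<eta> (fe Y f)"
    using eta_natural_Cel[of "ob R X" "ob R Y" "fe2 Y \<alpha>" "fe Y f" "fe Y f'"] by simp
  have "TS_eta X Y f' \<cdot>\<^bsub>D\<^esub> \<alpha> = (?\<eta> (fe Y f') \<lhd>\<^bsub>D\<^esub> ?e) \<cdot>\<^bsub>D\<^esub> ((?\<nu> \<lhd>\<^bsub>D\<^esub> f') \<cdot>\<^bsub>D\<^esub> \<alpha>)"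
    by (simp add: TS_eta_def)
  also have "\<dots> = ((?\<eta> (fe Y f') \<cdot>\<^bsub>D\<^esub> fe2 Y \<alpha>) \<lhd>\<^bsub>D\<^esub> ?e) \<cdot>\<^bsub>D\<^esub> (?\<nu> \<lhd>\<^bsub>D\<^esub> f)"
    unfolding ex by simp
  also have "\<dots> = (TS_ext2 X Y \<alpha> \<lhd>\<^bsub>D\<^esub> TS_tunit X) \<cdot>\<^bsub>D\<^esub> TS_eta X Y f"
    unfolding en by (simp add: TS_eta_def TS_tunit_def)
  finally show ?thesis .
qed

lemma TS_mu_unit:
  assumes X: "X \<in> Obj C" "Y \<in> Obj C"
    and f: "f \<in> Mor D" "src D f = ob J X" "trg D f = Tob T (ob R Y)"
  shows "(TS_ext X Y f \<rhd>\<^bsub>D\<^esub> TS_theta X) \<cdot>\<^bsub>D\<^esub> TS_mu X X Y f (TS_tunit X) \<cdot>\<^bsub>D\<^esub> TS_ext2 X Y (TS_eta X Y f)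
    = idc D (TS_ext X Y f)"
proof -
  note [simp] = X f lifting_simps ext_free comparison_typ TS_eta_typ tunit_comparison_typ
  interpret B: pseudoalgebra D S "Tfree Y" by simp
  let ?b = "act (Tfree Y)" and ?\<beta> = "aassoc (Tfree Y)" and ?\<nu> = "aunit (Tfree Y)"
  let ?e = "unit S (ob J X)" and ?i = "tunit T (ob R X)" and ?ib = "tunit_str L (free X)"
  define h where "h = eta T (ob R X) (ob R Y) (fe Y f)"
  let ?\<theta> = "theta T (ob R X)" and ?\<zeta> = "tunit_comparison X"
  let ?F = "fe Y f" and ?F' = "TS_ext X Y f" and ?d = "twist_inv X"
  let ?E2 = "ext2 T (ob R X) (ob R Y)" and ?m = "mult S (ob J X)"
  have h [simp]: "h \<in> Cel D" "cdom D h = ?b \<odot>\<^bsub>D\<^esub> mor S f" "ccod D h = ?F' \<odot>\<^bsub>D\<^esub> ?i"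
    by (simp_all add: h_def) (simp add: free_ext_def)
  have TS_eta_eq: "TS_eta X Y f = (h \<lhd>\<^bsub>D\<^esub> ?e) \<cdot>\<^bsub>D\<^esub> (?\<nu> \<lhd>\<^bsub>D\<^esub> f)"
    by (simp add: TS_eta_def h_def)
  \<comment> \<open>That \<eta> of f^S is an algebra 2-cell lets the structure cell of the extension
    be traded for \<open>fs X Y f\<close>, which consists of the twist and the associator of
    TSY.\<close>
  have ec: "comp_str D S ?F' (TS_str X Y f) ?i ?ib \<cdot>\<^bsub>D\<^esub> (?b \<rhd>\<^bsub>D\<^esub> cel S h) = (h \<lhd>\<^bsub>D\<^esub> ?m) \<cdot>\<^bsub>D\<^esub> fs X Y f"
    using lift_eta[OF free_strict[OF X(1)] free_strict[OF X(2)], folded Jfree_def Tfree_def, OF fe_pseudomorphism[OF X f]]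
    by (simp add: Sm.algebra_cell_iff free_aob TS_str_def h_def)
  \<comment> \<open>The unit axiom of TSY, whiskered with S(f), removes that associator together
    with the unit cell that enters through \<open>TS_eta\<close>.\<close>
  have au: "(?\<beta> \<lhd>\<^bsub>D\<^esub> (mor S (unit S (Tob T (ob R Y))) \<odot>\<^bsub>D\<^esub> mor S f)) \<cdot>\<^bsub>D\<^esub> (?b \<rhd>\<^bsub>D\<^esub> (cel S ?\<nu> \<lhd>\<^bsub>D\<^esub> mor S f)) = idc D ?F"
    using arg_cong[OF B.alg_unit, of "\<lambda>x. x \<lhd>\<^bsub>D\<^esub> mor S f"] by (simp add: free_ext_def)
  \<comment> \<open>Interchange takes the factor with \<open>twist_inv\<close> across
    \<open>h\<close> to meet the twist, and the two cancel.\<close>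
  have ex: "((?F' \<odot>\<^bsub>D\<^esub> ?i) \<rhd>\<^bsub>D\<^esub> (?d \<lhd>\<^bsub>D\<^esub> mor S ?e)) \<cdot>\<^bsub>D\<^esub> h = h \<cdot>\<^bsub>D\<^esub> (?F \<rhd>\<^bsub>D\<^esub> (?d \<lhd>\<^bsub>D\<^esub> mor S ?e))"
    using D.whisk_exchange[of "?d \<lhd>\<^bsub>D\<^esub> mor S ?e" h] by (simp add: free_ext_def)
  have "(?F' \<rhd>\<^bsub>D\<^esub> ?\<zeta>) \<cdot>\<^bsub>D\<^esub> comparison X Y f (TS_tunit X) \<cdot>\<^bsub>D\<^esub> fe2 Y (TS_eta X Y f)
    = ((?F' \<odot>\<^bsub>D\<^esub> ?i) \<rhd>\<^bsub>D\<^esub> (?d \<lhd>\<^bsub>D\<^esub> mor S ?e)) \<cdot>\<^bsub>D\<^esub>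
       ((comp_str D S ?F' (TS_str X Y f) ?i ?ib \<cdot>\<^bsub>D\<^esub> (?b \<rhd>\<^bsub>D\<^esub> cel S h)) \<lhd>\<^bsub>D\<^esub> mor S ?e) \<cdot>\<^bsub>D\<^esub>
       (?b \<rhd>\<^bsub>D\<^esub> (cel S ?\<nu> \<lhd>\<^bsub>D\<^esub> mor S f))"
    by (simp add: tunit_comparison_def comparison_def TS_tunit_def TS_eta_eq comp_str_def free_ext2_def free_ext_def)
  also have "\<dots> = (((?F' \<odot>\<^bsub>D\<^esub> ?i) \<rhd>\<^bsub>D\<^esub> (?d \<lhd>\<^bsub>D\<^esub> mor S ?e)) \<cdot>\<^bsub>D\<^esub> h) \<cdot>\<^bsub>D\<^esub> (?F \<rhd>\<^bsub>D\<^esub> (twist X \<lhd>\<^bsub>D\<^esub> mor S ?e)) \<cdot>\<^bsub>D\<^esub>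
       ((?\<beta> \<lhd>\<^bsub>D\<^esub> (mor S (unit S (Tob T (ob R Y))) \<odot>\<^bsub>D\<^esub> mor S f)) \<cdot>\<^bsub>D\<^esub> (?b \<rhd>\<^bsub>D\<^esub> (cel S ?\<nu> \<lhd>\<^bsub>D\<^esub> mor S f)))"
    unfolding ec by (simp add: free_str_def free_ext_def)
  also have "\<dots> = h \<cdot>\<^bsub>D\<^esub> (?F \<rhd>\<^bsub>D\<^esub> ((?d \<cdot>\<^bsub>D\<^esub> twist X) \<lhd>\<^bsub>D\<^esub> mor S ?e))"
    unfolding au ex by (simp add: free_ext_def del: twist_typ(9))
  also have "\<dots> = h"
    by (simp add: free_ext_def)
  finally have 1: "(?F' \<rhd>\<^bsub>D\<^esub> ?\<zeta>) \<cdot>\<^bsub>D\<^esub> comparison X Y f (TS_tunit X) \<cdot>\<^bsub>D\<^esub> fe2 Y (TS_eta X Y f) = h" .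
  have nl: "(?F' \<rhd>\<^bsub>D\<^esub> ext2 T (ob R X) (ob R X) ?\<zeta>) \<cdot>\<^bsub>D\<^esub> mu T (ob R X) (ob R X) (ob R Y) ?F (fe X (TS_tunit X))
      = mu T (ob R X) (ob R X) (ob R Y) ?F ?i \<cdot>\<^bsub>D\<^esub> ?E2 (?F' \<rhd>\<^bsub>D\<^esub> ?\<zeta>)"
    using mu_natural_left[of "ob R X" "ob R X" "ob R Y" ?\<zeta> "fe X (TS_tunit X)" ?i ?F] by simp
  have mu: "(?F' \<rhd>\<^bsub>D\<^esub> ?\<theta>) \<cdot>\<^bsub>D\<^esub> mu T (ob R X) (ob R X) (ob R Y) ?F ?i \<cdot>\<^bsub>D\<^esub> ?E2 h = idc D ?F'"
    using mu_unit[of "ob R X" "ob R Y" ?F] by (simp add: Hom_def h_def)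
  \<comment> \<open>Once naturality of \<mu> has put \<open>?\<zeta>\<close> under the extension,
    the extended cell is \<open>h\<close> by the fact \<open>1\<close>, and the unit law of
    \<open>T\<close> at f^S remains.\<close>
  have "(?F' \<rhd>\<^bsub>D\<^esub> TS_theta X) \<cdot>\<^bsub>D\<^esub> TS_mu X X Y f (TS_tunit X) \<cdot>\<^bsub>D\<^esub> TS_ext2 X Y (TS_eta X Y f)
    = (?F' \<rhd>\<^bsub>D\<^esub> ?\<theta>) \<cdot>\<^bsub>D\<^esub> ((?F' \<rhd>\<^bsub>D\<^esub> ext2 T (ob R X) (ob R X) ?\<zeta>) \<cdot>\<^bsub>D\<^esub>
        mu T (ob R X) (ob R X) (ob R Y) ?F (fe X (TS_tunit X))) \<cdot>\<^bsub>D\<^esub>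
      ?E2 (comparison X Y f (TS_tunit X)) \<cdot>\<^bsub>D\<^esub> TS_ext2 X Y (TS_eta X Y f)"
    by (simp add: TS_theta_def TS_mu_def)
  also have "\<dots> = (?F' \<rhd>\<^bsub>D\<^esub> ?\<theta>) \<cdot>\<^bsub>D\<^esub> mu T (ob R X) (ob R X) (ob R Y) ?F ?i \<cdot>\<^bsub>D\<^esub>
      ?E2 ((?F' \<rhd>\<^bsub>D\<^esub> ?\<zeta>) \<cdot>\<^bsub>D\<^esub> comparison X Y f (TS_tunit X) \<cdot>\<^bsub>D\<^esub> fe2 Y (TS_eta X Y f))"
    unfolding nl by simp
  also have "\<dots> = idc D ?F'"
    unfolding 1 mu ..
  finally show ?thesis .
qed

lemma TS_ext2_idc:
  assumes "X \<in> Obj C" "Y \<in> Obj C" "f \<in> Mor D" "src D f = ob J X" "trg D f = Tob T (ob R Y)"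
  shows "TS_ext2 X Y (idc D f) = idc D (TS_ext X Y f)"
proof -
  have "fe2 Y (idc D f) = idc D (fe Y f)"
    using assms by (simp add: free_ext2_def free_ext_def lifting_simps)
  then show ?thesis
    using assms by (simp add: TS_ext2_def TS_ext_def lifting_simps)
qed

lemma TS_ext2_vcomp:
  assumes "X \<in> Obj C" "Y \<in> Obj C" "\<alpha> \<in> Cel D" "src D (cdom D \<alpha>) = ob J X"
    "trg D (cdom D \<alpha>) = Tob T (ob R Y)" "\<beta> \<in> Cel D" "cdom D \<beta> = ccod D \<alpha>"
  shows "TS_ext2 X Y (\<beta> \<cdot>\<^bsub>D\<^esub> \<alpha>) = TS_ext2 X Y \<beta> \<cdot>\<^bsub>D\<^esub> TS_ext2 X Y \<alpha>"
proof -
  have "fe2 Y (\<beta> \<cdot>\<^bsub>D\<^esub> \<alpha>) = fe2 Y \<beta> \<cdot>\<^bsub>D\<^esub> fe2 Y \<alpha>"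
    using assms by (simp add: free_ext2_def lifting_simps)
  then show ?thesis
    using assms by (simp add: TS_ext2_def lifting_simps)
qed

section \<open>Assembly of the relative pseudomonad\<close>

lemma relative_pseudomonad_TS: "relative_pseudomonad C D J TS_psmnd"
proof (intro relative_pseudomonad.intro relative_pseudomonad_axioms.intro, goal_cases)
  case 1 show ?case by unfold_locales
qed (auto simp: TS_psmnd_def Hom_def Cells_def D.IsoCells_iff restr_typ Tob_Obj TS_ext_typ TS_ext2_typ
    TS_tunit_typ TS_mu_typ TS_eta_typ TS_theta_typ
    intro!: TS_ext2_idc TS_ext2_vcomp TS_mu_natural TS_eta_natural TS_mu_assoc TS_mu_unit)

end

theorem theorem6p4:
  fixes C :: "('o, 'm, 'c) two_cat" and D :: "('p, 'n, 'd) two_cat"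
    and J :: "('o, 'm, 'c, 'p, 'n, 'd) psfun"
    and T :: "('o, 'p, 'n, 'd) rel_psmnd"
    and S :: "('p, 'n, 'd) two_mnd" and R :: "('o, 'm, 'c) two_mnd"
  assumes "two_category C" and "two_category D"
    and "pseudofunctor C D J"
    and "relative_pseudomonad C D J T"
    and "two_monad D S"
    and "restricts_along C D J R S"
    and "\<exists>L. lifting C D J T R S L"
  shows "\<exists>T'. relative_pseudomonad C D J T' \<and> Tob T' = (\<lambda>X. Tob T (ob R X))"
proof -
  obtain L where "lifting C D J T R S L"
    using assms(7) by blast
  then interpret lifting C D J T R S L .
  show ?thesis
    using relative_pseudomonad_TS by (intro exI[of _ TS_psmnd]) (simp add: TS_psmnd_def)
qed

end
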